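(* Let $k$ be a field of characteristic $0$, let $D$ be the $n$-th Weyl algebra over $k$, and let $D^{(h)}$ be the homogenized Weyl algebra. Let $M$ be a finitely generated left $D$-module, let $\mathbf{F}$ be a free resolution of $M$ over $D$ with shifts $\mathbf{n}_i\in\mathbb{Z}^{r_i}$ that is adapted to the $(\mathbf{1},\mathbf{1})$-filtration and induces a graded minimal free resolution of $\operatorname{gr}M=\operatorname{gr}^{(\mathbf{1},\mathbf{1})}[\mathbf{n}_0]M$ over $S=\operatorname{gr}D$, and let $M^{(h)}$ be the graded left $D^{(h)}$-module obtained by homogenizing $\mathbf{F}$ (all as defined in the context). Then the graded Betti numbers of $M^{(h)}$ over $D^{(h)}$, of $\operatorname{gr}M$ over $S$, and of $\operatorname{gr}M^{(h)}=\operatorname{gr}^{(\mathbf{1},\mathbf{1})}[\mathbf{n}_0]M^{(h)}$ over $S[h]=\operatorname{gr}D^{(h)}$ coincide.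
   Context: $D=k[x_1,\dots,x_n]\langle\partial_1,\dots,\partial_n\rangle$ has relations $x_ix_j=x_jx_i$, $\partial_i\partial_j=\partial_j\partial_i$, $\partial_ix_j-x_j\partial_i=\delta_{ij}$. The homogenized Weyl algebra $D^{(h)}=k[h,x_1,\dots,x_n]\langle\partial_1,\dots,\partial_n\rangle$ has relations $x_ix_j=x_jx_i$, $\partial_i\partial_j=\partial_j\partial_i$, $\partial_ix_j-x_j\partial_i=\delta_{ij}h^2$, with $h$ central; it is $\mathbb{N}$-graded by total degree in $h,x,\partial$ (each variable of degree 1). The $L=(\mathbf{1},\mathbf{1})$-filtration on $D$ and on $D^{(h)}$: the monomials $x^\alpha\partial^\gamma$ and $h^lx^\alpha\partial^\gamma$ have $L$-degree $|\alpha|+|\gamma|$ (so $h$ has $L$-degree $0$), the $L$-degree $\deg^L P$ of an element is the maximum over its monomials, and $L_i$ consists of the elements of $L$-degree at most $i$. The associated graded rings are the commutative polynomial rings $S=\operatorname{gr}D=k[x,\partial]$ and $S[h]=\operatorname{gr}D^{(h)}=k[h,x,\partial]$, which are given the standard $\mathbb{N}$-grading by total degree. For $\mathbf{m}\in\mathbb{Z}^r$, put $L_j[\mathbf{m}]D^r=\{P\in D^r:\deg^L(P_b)+m_b\le j\ \text{for all } b\}$, and similarly for $(D^{(h)})^r$; the associated graded module is denoted $\operatorname{gr}^L[\mathbf{m}]D^r$, a graded free $S$-module (respectively $\operatorname{gr}^L[\mathbf{m}](D^{(h)})^r$, a free $S[h]$-module) with generators in degrees $m_1,\dots,m_r$.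 If $\varphi:D^r\to N$ is surjective, $N$ has the filtration $\varphi(L_j[\mathbf{m}]D^r)$, with associated graded module $\operatorname{gr}^L[\mathbf{m}]N$; similarly over $D^{(h)}$. Given a finitely generated left $D$-module $M$, there is (known result) a free resolution $\mathbf{F}:\cdots\xrightarrow{\varphi_2}D^{r_1}\xrightarrow{\varphi_1}D^{r_0}\xrightarrow{\varphi_0}M\to0$ and shifts $\mathbf{n}_i\in\mathbb{Z}^{r_i}$ with $\varphi_i(L_j[\mathbf{n}_i]D^{r_i})\subseteq L_j[\mathbf{n}_{i-1}]D^{r_{i-1}}$ for all $i>0$, $j\in\mathbb{Z}$, such that the induced complex $\operatorname{gr}^L\mathbf{F}:\cdots\to\operatorname{gr}^L[\mathbf{n}_1]D^{r_1}\to\operatorname{gr}^L[\mathbf{n}_0]D^{r_0}\to\operatorname{gr}^L[\mathbf{n}_0]M\to0$ is a graded minimal free resolution over $S$. This is the type of resolution meant in the claim. Homogenization of $\mathbf{F}$: if $\varphi_i$ is given by the matrix with entries $P_{ab}=\sum c_{\alpha\gamma}x^\alpha\partial^\gamma$ (the $b$-th component of $\varphi_i(e_a)$), let $\psi_i$ be the map given by the matrix with entries $\sum c_{\alpha\gamma}h^{m-|\alpha|-|\gamma|}x^\alpha\partial^\gamma$, where $m=n_{i,a}-n_{i-1,b}$. Then $\psi_i:(D^{(h)})^{r_i}[\mathbf{n}_i]\to(D^{(h)})^{r_{i-1}}[\mathbf{n}_{i-1}]$ is homogeneous of degree $0$, where $(D^{(h)})^r[\mathbf{m}]$ is the graded free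 module with generators in degrees $m_1,\dots,m_r$. Set $M^{(h)}=\operatorname{coker}\psi_1$. It is known that the $\psi_i$ form a graded minimal free resolution $\mathbf{F}^{(h)}$ of $M^{(h)}$ over $D^{(h)}$ and that setting $h=1$ recovers $\mathbf{F}$ and $M$. The module $\operatorname{gr}M^{(h)}=\operatorname{gr}^L[\mathbf{n}_0]M^{(h)}$ is formed using the surjection $(D^{(h)})^{r_0}\to M^{(h)}$ and is regarded as graded by total degree. The graded Betti numbers of a finitely generated graded module over one of the $\mathbb{N}$-graded algebras $D^{(h)},S,S[h]$ are the numbers $\beta_{i,j}$ of free generators of degree $j$ in homological position $i$ of a graded minimal free resolution. *)

theory Defs
  imports
    "HOL-Algebra.Module"
    "HOL-Algebra.AbelCoset"
    "HOL-Library.Poly_Mapping"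
    "HOL-Library.Product_Plus"
    "HOL-Computational_Algebra.Polynomial"
begin

section \<open>Weyl algebras\<close>

text \<open>
  The pair \<open>(\<alpha>, \<gamma>)\<close> stands for the monomial \<open>x\<^sup>\<alpha> \<partial>\<^sup>\<gamma>\<close>. The variables are indexed by a finite
  type \<open>'n\<close> (so \<open>n\<close> is its cardinality). Elements of all four algebras are stored by their
  coefficients on these monomials: over \<open>'k\<close> for \<open>D\<close> and \<open>S\<close>, and over \<open>'k poly\<close>, the
  polynomial ring \<open>k[h]\<close>, for \<open>D\<^sup>(\<^sup>h\<^sup>)\<close> and \<open>S[h]\<close>.
\<close>

type_synonym 'n expo = "('n \<Rightarrow>\<^sub>0 nat) \<times> ('n \<Rightarrow>\<^sub>0 nat)"

definition vdeg :: "('n::finite \<Rightarrow>\<^sub>0 nat) \<Rightarrow> nat" where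
  "vdeg \<alpha> = (\<Sum>i\<in>UNIV. Poly_Mapping.lookup \<alpha> i)"

definition mdeg :: "'n::finite expo \<Rightarrow> nat" where
  "mdeg \<mu> = vdeg (fst \<mu>) + vdeg (snd \<mu>)"

text \<open>
  Normally ordered product for the relations \<open>\<partial>\<^sub>i x\<^sub>j - x\<^sub>j \<partial>\<^sub>i = \<delta>\<^sub>i\<^sub>j t\<close> with \<open>t\<close> central, by the Leibniz rule
  \<open>\<partial>\<^sup>\<gamma> x\<^sup>\<beta> = \<Sum>\<^sub>\<kappa> \<kappa>! (\<gamma> choose \<kappa>) (\<beta> choose \<kappa>) t\<^bsup>|\<kappa>|\<^esup> x\<^bsup>\<beta>-\<kappa>\<^esup> \<partial>\<^bsup>\<gamma>-\<kappa>\<^esup>\<close>.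
  The lemmas \<open>weyl_ring\<close>, \<open>weyl_relations\<close> and \<open>weyl_monomial_basis\<close> below show that this is a
  ring satisfying the relations, in which the basis elements are the products \<open>x\<^sup>\<alpha> \<partial>\<^sup>\<gamma>\<close>.
\<close>

definition weyl_coeff :: "'r::comm_ring_1 \<Rightarrow> ('n::finite \<Rightarrow>\<^sub>0 nat) \<Rightarrow> ('n \<Rightarrow>\<^sub>0 nat) \<Rightarrow> ('n \<Rightarrow>\<^sub>0 nat) \<Rightarrow> 'r" where
  "weyl_coeff t \<gamma> \<beta> \<kappa> =
     of_nat (\<Prod>i\<in>UNIV. fact (Poly_Mapping.lookup \<kappa> i) * (Poly_Mapping.lookup \<gamma> i choose Poly_Mapping.lookup \<kappa> i) * (Poly_Mapping.lookup \<beta> i choose Poly_Mapping.lookup \<kappa> i))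
       * t ^ vdeg \<kappa>"

definition weyl_mult ::
  "'r::comm_ring_1 \<Rightarrow> ('n::finite expo \<Rightarrow>\<^sub>0 'r) \<Rightarrow> ('n expo \<Rightarrow>\<^sub>0 'r) \<Rightarrow> ('n expo \<Rightarrow>\<^sub>0 'r)" where
  "weyl_mult t P Q =
     (\<Sum>(\<alpha>, \<gamma>)\<in>Poly_Mapping.keys P. \<Sum>(\<beta>, \<delta>)\<in>Poly_Mapping.keys Q. \<Sum>\<kappa> | \<forall>i. Poly_Mapping.lookup \<kappa> i \<le> Poly_Mapping.lookup \<gamma> i \<and> Poly_Mapping.lookup \<kappa> i \<le> Poly_Mapping.lookup \<beta> i.
        Poly_Mapping.single (\<alpha> + (\<beta> - \<kappa>), (\<gamma> - \<kappa>) + \<delta>)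
          (Poly_Mapping.lookup P (\<alpha>, \<gamma>) * Poly_Mapping.lookup Q (\<beta>, \<delta>) * weyl_coeff t \<gamma> \<beta> \<kappa>))"

record 'a graded_ring = "'a ring" +
  rgrade :: "int \<Rightarrow> 'a set"

definition weyl_algebra :: "('n::finite expo \<Rightarrow>\<^sub>0 'k::field_char_0) ring" where
  "weyl_algebra = \<lparr>carrier = UNIV, monoid.mult = weyl_mult 1, one = 1, zero = 0, add = (+)\<rparr>"

text \<open>In \<open>k[h]\<close>, the element \<open>h\<^sup>2\<close> is \<open>monom 1 2\<close>.\<close>

definition hom_weyl_algebra :: "('n::finite expo \<Rightarrow>\<^sub>0 'k::field_char_0 poly) graded_ring" where
  "hom_weyl_algebra = \<lparr>carrier = UNIV, monoid.mult = weyl_mult (monom 1 2), one = 1, zero = 0, add = (+),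
     rgrade = (\<lambda>d. {P. \<forall>\<mu> l. coeff (Poly_Mapping.lookup P \<mu>) l \<noteq> 0 \<longrightarrow> int (l + mdeg \<mu>) = d})\<rparr>"

definition poly_S :: "('n::finite expo \<Rightarrow>\<^sub>0 'k::field_char_0) graded_ring" where
  "poly_S = \<lparr>carrier = UNIV, monoid.mult = (*), one = 1, zero = 0, add = (+),
     rgrade = (\<lambda>d. {P. \<forall>\<mu>. Poly_Mapping.lookup P \<mu> \<noteq> 0 \<longrightarrow> int (mdeg \<mu>) = d})\<rparr>"

definition poly_Sh :: "('n::finite expo \<Rightarrow>\<^sub>0 'k::field_char_0 poly) graded_ring" where
  "poly_Sh = \<lparr>carrier = UNIV, monoid.mult = (*), one = 1, zero = 0, add = (+),
     rgrade = (\<lambda>d. {P. \<forall>\<mu> l. coeff (Poly_Mapping.lookup P \<mu>) l \<noteq> 0 \<longrightarrow> int (l + mdeg \<mu>) = d})\<rparr>"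


section \<open>Left modules over noncommutative rings\<close>

text \<open>The locale \<open>module\<close> of HOL-Algebra requires a commutative ring; its record type is reused.\<close>

locale left_module = R?: ring R + M?: abelian_group M
  for R :: "('a, 'r) ring_scheme" (structure) and M :: "('a, 'b, 'm) module_scheme" (structure) +
  assumes smult_closed: "\<lbrakk>a \<in> carrier R; x \<in> carrier M\<rbrakk> \<Longrightarrow> a \<odot>\<^bsub>M\<^esub> x \<in> carrier M"
    and smult_l_distr: "\<lbrakk>a \<in> carrier R; b \<in> carrier R; x \<in> carrier M\<rbrakk>
      \<Longrightarrow> (a \<oplus>\<^bsub>R\<^esub> b) \<odot>\<^bsub>M\<^esub> x = a \<odot>\<^bsub>M\<^esub> x \<oplus>\<^bsub>M\<^esub> b \<odot>\<^bsub>M\<^esub> x"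
    and smult_r_distr: "\<lbrakk>a \<in> carrier R; x \<in> carrier M; y \<in> carrier M\<rbrakk>
      \<Longrightarrow> a \<odot>\<^bsub>M\<^esub> (x \<oplus>\<^bsub>M\<^esub> y) = a \<odot>\<^bsub>M\<^esub> x \<oplus>\<^bsub>M\<^esub> a \<odot>\<^bsub>M\<^esub> y"
    and smult_assoc: "\<lbrakk>a \<in> carrier R; b \<in> carrier R; x \<in> carrier M\<rbrakk>
      \<Longrightarrow> (a \<otimes>\<^bsub>R\<^esub> b) \<odot>\<^bsub>M\<^esub> x = a \<odot>\<^bsub>M\<^esub> (b \<odot>\<^bsub>M\<^esub> x)"
    and smult_one: "x \<in> carrier M \<Longrightarrow> \<one>\<^bsub>R\<^esub> \<odot>\<^bsub>M\<^esub> x = x"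

text \<open>
  Elements of \<open>R\<^sup>r\<close> are row vectors, zero from index \<open>r\<close> on. A left linear map \<open>R\<^sup>r \<rightarrow> R\<^sup>s\<close> with
  matrix \<open>A\<close> (row \<open>a\<close> is the image of \<open>e\<^sub>a\<close>) is multiplication by \<open>A\<close> from the right.
\<close>

definition free_carrier :: "('a, 'r) ring_scheme \<Rightarrow> nat \<Rightarrow> (nat \<Rightarrow> 'a) set" where
  "free_carrier R r = {v. (\<forall>a<r. v a \<in> carrier R) \<and> (\<forall>a\<ge>r. v a = \<zero>\<^bsub>R\<^esub>)}"

definition mat_map ::
  "('a, 'r) ring_scheme \<Rightarrow> nat \<Rightarrow> nat \<Rightarrow> (nat \<Rightarrow> nat \<Rightarrow> 'a) \<Rightarrow> (nat \<Rightarrow> 'a) \<Rightarrow> (nat \<Rightarrow> 'a)" where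
  "mat_map R r s A v = (\<lambda>b. if b < s then (\<Oplus>\<^bsub>R\<^esub>a\<in>{..<r}. v a \<otimes>\<^bsub>R\<^esub> A a b) else \<zero>\<^bsub>R\<^esub>)"

definition gen_map ::
  "('a, 'b, 'm) module_scheme \<Rightarrow> nat \<Rightarrow> (nat \<Rightarrow> 'b) \<Rightarrow> (nat \<Rightarrow> 'a) \<Rightarrow> 'b" where
  "gen_map M r e v = (\<Oplus>\<^bsub>M\<^esub>a\<in>{..<r}. v a \<odot>\<^bsub>M\<^esub> e a)"

definition fin_gen_left_module :: "('a, 'r) ring_scheme \<Rightarrow> ('a, 'b, 'm) module_scheme \<Rightarrow> bool" where
  "fin_gen_left_module R M \<longleftrightarrow> left_module R M \<and>
     (\<exists>r e. (\<forall>a<r. e a \<in> carrier M) \<and> gen_map M r e ` free_carrier R r = carrier M)"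

text \<open>
  The resolution \<open>\<cdots> \<rightarrow> R\<^bsup>r 1\<^esup> \<rightarrow> R\<^bsup>r 0\<^esup> \<rightarrow> M \<rightarrow> 0\<close>: \<open>\<Phi> (Suc i)\<close> is the matrix of \<open>\<phi>\<^sub>i\<^sub>+\<^sub>1 : R\<^bsup>r (i+1)\<^esup> \<rightarrow> R\<^bsup>r i\<^esup>\<close>, and
  \<open>\<phi>\<^sub>0\<close> is given by the images \<open>e a\<close> of the basis vectors; \<open>\<Phi> 0\<close> is not used.
\<close>

definition free_resolution ::
  "('a, 'r) ring_scheme \<Rightarrow> ('a, 'b, 'm) module_scheme \<Rightarrow> (nat \<Rightarrow> nat)
     \<Rightarrow> (nat \<Rightarrow> nat \<Rightarrow> nat \<Rightarrow> 'a) \<Rightarrow> (nat \<Rightarrow> 'b) \<Rightarrow> bool" where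
  "free_resolution R M r \<Phi> e \<longleftrightarrow>
     (\<forall>a<r 0. e a \<in> carrier M) \<and>
     (\<forall>i. \<forall>a<r (Suc i). \<forall>b<r i. \<Phi> (Suc i) a b \<in> carrier R) \<and>
     gen_map M (r 0) e ` free_carrier R (r 0) = carrier M \<and>
     {v \<in> free_carrier R (r 0). gen_map M (r 0) e v = \<zero>\<^bsub>M\<^esub>}
       = mat_map R (r 1) (r 0) (\<Phi> 1) ` free_carrier R (r 1) \<and>
     (\<forall>i. {v \<in> free_carrier R (r (Suc i)). mat_map R (r (Suc i)) (r i) (\<Phi> (Suc i)) v = (\<lambda>_. \<zero>\<^bsub>R\<^esub>)}
       = mat_map R (r (Suc (Suc i))) (r (Suc i)) (\<Phi> (Suc (Suc i))) ` free_carrier R (r (Suc (Suc i))))"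


section \<open>Graded minimal free resolutions and graded Betti numbers\<close>

record ('a, 'b) graded_module = "('a, 'b) module" +
  mgrade :: "int \<Rightarrow> 'b set"

text \<open>
  The \<open>a\<close>-th generator in homological position \<open>i\<close> has degree \<open>m i a\<close>. Minimality says that
  the matrix entries lie in the ideal of elements of positive degree; as the entries are
  homogeneous, this means that those of degree \<open>0\<close> vanish.
\<close>

definition graded_min_free_resolution ::
  "('a, 'r) graded_ring_scheme \<Rightarrow> ('a, 'b, 'm) graded_module_scheme \<Rightarrow> (nat \<Rightarrow> nat)
     \<Rightarrow> (nat \<Rightarrow> nat \<Rightarrow> int) \<Rightarrow> (nat \<Rightarrow> nat \<Rightarrow> nat \<Rightarrow> 'a) \<Rightarrow> (nat \<Rightarrow> 'b) \<Rightarrow> bool" where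
  "graded_min_free_resolution R N r m \<Phi> e \<longleftrightarrow>
     free_resolution R N r \<Phi> e \<and>
     (\<forall>a<r 0. e a \<in> mgrade N (m 0 a)) \<and>
     (\<forall>i. \<forall>a<r (Suc i). \<forall>b<r i. \<Phi> (Suc i) a b \<in> rgrade R (m (Suc i) a - m i b)) \<and>
     (\<forall>i. \<forall>a<r (Suc i). \<forall>b<r i. \<Phi> (Suc i) a b \<in> rgrade R 0 \<longrightarrow> \<Phi> (Suc i) a b = \<zero>\<^bsub>R\<^esub>)"

text \<open>Number of generators of degree \<open>j\<close> in position \<open>i\<close>; it does not depend on the resolution.\<close>

definition graded_betti ::
  "('a, 'r) graded_ring_scheme \<Rightarrow> ('a, 'b, 'm) graded_module_scheme \<Rightarrow> nat \<Rightarrow> int \<Rightarrow> nat" where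
  "graded_betti R N i j =
     (THE c. \<exists>r m \<Phi> e. graded_min_free_resolution R N r m \<Phi> e \<and> c = card {a. a < r i \<and> m i a = j})"


section \<open>The \<open>L\<close>-filtration and associated graded modules\<close>

text \<open>The submodule \<open>L\<^sub>j[m]D\<^sup>r\<close>; the variable \<open>h\<close>, being part of the coefficients, has \<open>L\<close>-degree \<open>0\<close>.\<close>

definition L_filt :: "nat \<Rightarrow> (nat \<Rightarrow> int) \<Rightarrow> int \<Rightarrow> (nat \<Rightarrow> ('n::finite expo \<Rightarrow>\<^sub>0 'r::zero)) set" where
  "L_filt r m j = {v. (\<forall>b<r. \<forall>\<mu>\<in>Poly_Mapping.keys (v b). int (mdeg \<mu>) + m b \<le> j) \<and> (\<forall>b\<ge>r. v b = 0)}"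

definition L_part :: "int \<Rightarrow> ('n::finite expo \<Rightarrow>\<^sub>0 'r::comm_monoid_add) \<Rightarrow> ('n expo \<Rightarrow>\<^sub>0 'r)" where
  "L_part d P = (\<Sum>\<mu>\<in>{\<mu> \<in> Poly_Mapping.keys P. int (mdeg \<mu>) = d}. Poly_Mapping.single \<mu> (Poly_Mapping.lookup P \<mu>))"

text \<open>
  The associated graded module \<open>\<Oplus>\<^sub>j F\<^sub>j / F\<^sub>j\<^sub>-\<^sub>1\<close> of a module \<open>M\<close> over \<open>D\<close> or \<open>D\<^sup>(\<^sup>h\<^sup>)\<close> with a filtration
  \<open>F\<close>. Its elements are the families of cosets \<open>f j \<in> F\<^sub>j / F\<^sub>j\<^sub>-\<^sub>1\<close> with finite support. The class
  in \<open>S\<^sub>d\<close> of an element of \<open>L\<^sub>d\<close> is its part of \<open>L\<close>-degree \<open>d\<close>, so that an element of \<open>S\<^sub>d\<close> is lifted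
  to \<open>L\<^sub>d\<close> by keeping its coefficients.
\<close>

definition gr_carrier :: "('a, 'b, 'm) module_scheme \<Rightarrow> (int \<Rightarrow> 'b set) \<Rightarrow> (int \<Rightarrow> 'b set) set" where
  "gr_carrier M F = {f. (\<forall>j. \<exists>x\<in>F j. f j = F (j - 1) +>\<^bsub>M\<^esub> x) \<and> finite {j. f j \<noteq> F (j - 1)}}"

definition gr_smult ::
  "('n::finite expo \<Rightarrow>\<^sub>0 'r::comm_ring_1, 'b, 'm) module_scheme \<Rightarrow> (int \<Rightarrow> 'b set)
     \<Rightarrow> ('n expo \<Rightarrow>\<^sub>0 'r) \<Rightarrow> (int \<Rightarrow> 'b set) \<Rightarrow> (int \<Rightarrow> 'b set)" where
  "gr_smult M F s f = (\<lambda>j. \<Union>x\<in>(\<Pi> i\<in>UNIV. f i).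
     F (j - 1) +>\<^bsub>M\<^esub> (\<Oplus>\<^bsub>M\<^esub>d\<in>(\<lambda>\<mu>. int (mdeg \<mu>)) ` Poly_Mapping.keys s. L_part d s \<odot>\<^bsub>M\<^esub> x (j - d)))"

definition gr_module ::
  "('n::finite expo \<Rightarrow>\<^sub>0 'r::comm_ring_1, 'b, 'm) module_scheme \<Rightarrow> (int \<Rightarrow> 'b set)
     \<Rightarrow> (int \<Rightarrow> (int \<Rightarrow> 'b set) set) \<Rightarrow> ('n expo \<Rightarrow>\<^sub>0 'r, int \<Rightarrow> 'b set) graded_module" where
  "gr_module M F G = \<lparr>carrier = gr_carrier M F, monoid.mult = undefined, one = undefined,
     zero = (\<lambda>j. F (j - 1)), add = (\<lambda>f g j. f j <+>\<^bsub>M\<^esub> g j), module.smult = gr_smult M F, mgrade = G\<rparr>"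

text \<open>The element of \<open>gr M\<close> given by the class of \<open>x\<close> in \<open>F\<^sub>d / F\<^sub>d\<^sub>-\<^sub>1\<close>.\<close>

definition gr_class ::
  "('a, 'b, 'm) module_scheme \<Rightarrow> (int \<Rightarrow> 'b set) \<Rightarrow> int \<Rightarrow> 'b \<Rightarrow> (int \<Rightarrow> 'b set)" where
  "gr_class M F d x = (\<lambda>j. if j = d then F (d - 1) +>\<^bsub>M\<^esub> x else F (j - 1))"

definition img_filt ::
  "('n::finite expo \<Rightarrow>\<^sub>0 'r::comm_ring_1, 'b, 'm) module_scheme \<Rightarrow> nat \<Rightarrow> (nat \<Rightarrow> int)
     \<Rightarrow> (nat \<Rightarrow> 'b) \<Rightarrow> int \<Rightarrow> 'b set" where
  "img_filt M r m e j = gen_map M r e ` L_filt r m j"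

text \<open>\<open>gr M\<close> over \<open>S\<close>, graded by the \<open>L\<close>-degree.\<close>

definition gr_D ::
  "('n::finite expo \<Rightarrow>\<^sub>0 'k::field_char_0, 'b, 'm) module_scheme \<Rightarrow> nat \<Rightarrow> (nat \<Rightarrow> int) \<Rightarrow> (nat \<Rightarrow> 'b)
     \<Rightarrow> ('n expo \<Rightarrow>\<^sub>0 'k, int \<Rightarrow> 'b set) graded_module" where
  "gr_D M r m e = (let F = img_filt M r m e in
     gr_module M F (\<lambda>d. {f \<in> gr_carrier M F. \<forall>j. j \<noteq> d \<longrightarrow> f j = F (j - 1)}))"

text \<open>
  The matrix of the map \<open>gr\<^sup>L[n]D\<^sup>r \<rightarrow> gr\<^sup>L[n']D\<^sup>s\<close> induced by \<open>A\<close>, in the bases given by the classes of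
  the basis vectors (see \<open>symbol_matrix_induced\<close> below).
\<close>

definition symbol_matrix ::
  "(nat \<Rightarrow> int) \<Rightarrow> (nat \<Rightarrow> int) \<Rightarrow> (nat \<Rightarrow> nat \<Rightarrow> ('n::finite expo \<Rightarrow>\<^sub>0 'r::comm_ring_1))
     \<Rightarrow> nat \<Rightarrow> nat \<Rightarrow> ('n expo \<Rightarrow>\<^sub>0 'r)" where
  "symbol_matrix n n' A a b = L_part (n a - n' b) (A a b)"

text \<open>
  \<open>\<phi>\<^sub>0\<close> and the matrices \<open>\<Phi>\<close> form a free resolution of \<open>M\<close> over \<open>D\<close>, adapted to the \<open>L\<close>-filtration
  with shifts \<open>n\<close>, and inducing a graded minimal free resolution of \<open>gr M\<close>.
\<close>

definition L_adapted_resolution ::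
  "('n::finite expo \<Rightarrow>\<^sub>0 'k::field_char_0, 'b, 'm) module_scheme \<Rightarrow> (nat \<Rightarrow> nat) \<Rightarrow> (nat \<Rightarrow> nat \<Rightarrow> int)
     \<Rightarrow> (nat \<Rightarrow> nat \<Rightarrow> nat \<Rightarrow> ('n expo \<Rightarrow>\<^sub>0 'k)) \<Rightarrow> (nat \<Rightarrow> 'b) \<Rightarrow> bool" where
  "L_adapted_resolution M r n \<Phi> e \<longleftrightarrow>
     free_resolution weyl_algebra M r \<Phi> e \<and>
     (\<forall>i j. mat_map weyl_algebra (r (Suc i)) (r i) (\<Phi> (Suc i)) ` L_filt (r (Suc i)) (n (Suc i)) j
        \<subseteq> L_filt (r i) (n i) j) \<and>
     graded_min_free_resolution poly_S (gr_D M (r 0) (n 0) e) r n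
       (\<lambda>i. symbol_matrix (n i) (n (i - 1)) (\<Phi> i))
       (\<lambda>a. gr_class M (img_filt M (r 0) (n 0) e) (n 0 a) (e a))"


section \<open>Homogenization\<close>

definition homogenize ::
  "int \<Rightarrow> ('n::finite expo \<Rightarrow>\<^sub>0 'k::field_char_0) \<Rightarrow> ('n expo \<Rightarrow>\<^sub>0 'k poly)" where
  "homogenize m P = (\<Sum>\<mu>\<in>Poly_Mapping.keys P. Poly_Mapping.single \<mu> (monom (Poly_Mapping.lookup P \<mu>) (nat (m - int (mdeg \<mu>)))))"

definition homogenize_matrix ::
  "(nat \<Rightarrow> int) \<Rightarrow> (nat \<Rightarrow> int) \<Rightarrow> (nat \<Rightarrow> nat \<Rightarrow> ('n::finite expo \<Rightarrow>\<^sub>0 'k::field_char_0))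
     \<Rightarrow> nat \<Rightarrow> nat \<Rightarrow> ('n expo \<Rightarrow>\<^sub>0 'k poly)" where
  "homogenize_matrix n n' A a b = homogenize (n a - n' b) (A a b)"

definition graded_free_module ::
  "('a, 'r) graded_ring_scheme \<Rightarrow> nat \<Rightarrow> (nat \<Rightarrow> int) \<Rightarrow> ('a, nat \<Rightarrow> 'a) graded_module" where
  "graded_free_module R r m = \<lparr>carrier = free_carrier R r, monoid.mult = undefined, one = undefined,
     zero = (\<lambda>_. \<zero>\<^bsub>R\<^esub>), add = (\<lambda>v w a. v a \<oplus>\<^bsub>R\<^esub> w a), module.smult = (\<lambda>c v a. c \<otimes>\<^bsub>R\<^esub> v a),
     mgrade = (\<lambda>d. {v \<in> free_carrier R r. \<forall>a<r. v a \<in> rgrade R (d - m a)})\<rparr>"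

definition quotient_module ::
  "('a, 'b, 'm) graded_module_scheme \<Rightarrow> 'b set \<Rightarrow> ('a, 'b set) graded_module" where
  "quotient_module N K = \<lparr>carrier = a_rcosets\<^bsub>N\<^esub> K, monoid.mult = undefined, one = undefined,
     zero = K, add = (\<lambda>C C'. C <+>\<^bsub>N\<^esub> C'), module.smult = (\<lambda>c C. \<Union>x\<in>C. K +>\<^bsub>N\<^esub> (c \<odot>\<^bsub>N\<^esub> x)),
     mgrade = (\<lambda>d. (\<lambda>x. K +>\<^bsub>N\<^esub> x) ` mgrade N d)\<rparr>"

text \<open>\<open>M\<^sup>(\<^sup>h\<^sup>)\<close> is the cokernel of \<open>\<psi>\<^sub>1\<close>; \<open>hom_proj\<close> is the projection \<open>(D\<^sup>(\<^sup>h\<^sup>))\<^bsup>r 0\<^esup> \<rightarrow> M\<^sup>(\<^sup>h\<^sup>)\<close>.\<close>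

definition hom_image ::
  "(nat \<Rightarrow> nat) \<Rightarrow> (nat \<Rightarrow> nat \<Rightarrow> int) \<Rightarrow> (nat \<Rightarrow> nat \<Rightarrow> nat \<Rightarrow> ('n::finite expo \<Rightarrow>\<^sub>0 'k::field_char_0))
     \<Rightarrow> (nat \<Rightarrow> ('n expo \<Rightarrow>\<^sub>0 'k poly)) set" where
  "hom_image r n \<Phi> = mat_map hom_weyl_algebra (r 1) (r 0) (homogenize_matrix (n 1) (n 0) (\<Phi> 1))
     ` free_carrier hom_weyl_algebra (r 1)"

definition hom_module ::
  "(nat \<Rightarrow> nat) \<Rightarrow> (nat \<Rightarrow> nat \<Rightarrow> int) \<Rightarrow> (nat \<Rightarrow> nat \<Rightarrow> nat \<Rightarrow> ('n::finite expo \<Rightarrow>\<^sub>0 'k::field_char_0))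
     \<Rightarrow> ('n expo \<Rightarrow>\<^sub>0 'k poly, (nat \<Rightarrow> ('n expo \<Rightarrow>\<^sub>0 'k poly)) set) graded_module" where
  "hom_module r n \<Phi> =
     quotient_module (graded_free_module hom_weyl_algebra (r 0) (n 0)) (hom_image r n \<Phi>)"

definition hom_proj ::
  "(nat \<Rightarrow> nat) \<Rightarrow> (nat \<Rightarrow> nat \<Rightarrow> int) \<Rightarrow> (nat \<Rightarrow> nat \<Rightarrow> nat \<Rightarrow> ('n::finite expo \<Rightarrow>\<^sub>0 'k::field_char_0))
     \<Rightarrow> (nat \<Rightarrow> ('n expo \<Rightarrow>\<^sub>0 'k poly)) \<Rightarrow> (nat \<Rightarrow> ('n expo \<Rightarrow>\<^sub>0 'k poly)) set" where
  "hom_proj r n \<Phi> v = hom_image r n \<Phi> +>\<^bsub>graded_free_module hom_weyl_algebra (r 0) (n 0)\<^esub> v"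

text \<open>
  \<open>gr M\<^sup>(\<^sup>h\<^sup>)\<close> over \<open>S[h]\<close>. It also carries the \<open>L\<close>-degree \<open>j\<close>, but is graded by total degree: an
  element is homogeneous of degree \<open>d\<close> if each component has a representative of degree \<open>d\<close> in \<open>M\<^sup>(\<^sup>h\<^sup>)\<close>.
\<close>

definition gr_hom_module ::
  "(nat \<Rightarrow> nat) \<Rightarrow> (nat \<Rightarrow> nat \<Rightarrow> int) \<Rightarrow> (nat \<Rightarrow> nat \<Rightarrow> nat \<Rightarrow> ('n::finite expo \<Rightarrow>\<^sub>0 'k::field_char_0))
     \<Rightarrow> ('n expo \<Rightarrow>\<^sub>0 'k poly, int \<Rightarrow> (nat \<Rightarrow> ('n expo \<Rightarrow>\<^sub>0 'k poly)) set set) graded_module" where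
  "gr_hom_module r n \<Phi> = (let M = hom_module r n \<Phi>; F = (\<lambda>j. hom_proj r n \<Phi> ` L_filt (r 0) (n 0) j) in
     gr_module M F (\<lambda>d. {f \<in> gr_carrier M F. \<forall>j. \<exists>x \<in> F j \<inter> mgrade M d. f j = F (j - 1) +>\<^bsub>M\<^esub> x}))"


section \<open>The product \<open>weyl_mult\<close>\<close>

context
  notes One_nat_def [simp del]
begin

abbreviation xvar :: "'n::finite \<Rightarrow> 'n expo" where
  "xvar i \<equiv> (Poly_Mapping.single i 1, 0)"

abbreviation dvar :: "'n::finite \<Rightarrow> 'n expo" where
  "dvar i \<equiv> (0, Poly_Mapping.single i 1)"

abbreviation mon :: "'n::finite expo \<Rightarrow> ('n expo \<Rightarrow>\<^sub>0 'r::comm_ring_1)" where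
  "mon p \<equiv> Poly_Mapping.single p 1"

definition cst :: "'r::comm_ring_1 \<Rightarrow> ('n::finite expo \<Rightarrow>\<^sub>0 'r)" where
  "cst c = Poly_Mapping.single 0 c"

lemma cst_mult: "cst (a * b) = cst a * cst b"
  by (simp add: cst_def mult_single)
lemma cst_add: "cst (a + b) = cst a + cst b"
  by (simp add: cst_def single_add)
lemma cst_0 [simp]: "cst 0 = 0"
  by (simp add: cst_def)
lemma cst_1 [simp]: "cst 1 = 1"
  by (simp add: cst_def)
lemma cst_single: "cst c * Poly_Mapping.single p d = Poly_Mapping.single p (c * d)"
  by (simp add: cst_def mult_single)
lemma single_cst: "Poly_Mapping.single p d = cst d * mon p"
  by (simp add: cst_single)
lemma mon_mult: "mon p * mon q = mon (p + q)"
  by (simp add: mult_single)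
lemma mon_cst: "mon p * (cst c * P) = cst c * (mon p * P)"
  by (rule mult.left_commute)

lemma lookup_cst_mult: "Poly_Mapping.lookup (cst c * P) p = c * Poly_Mapping.lookup P p"
  for P :: "'n::finite expo \<Rightarrow>\<^sub>0 'r::comm_ring_1"
proof -
  have "cst c * P = Poly_Mapping.map ((*) c) P"
    unfolding cst_def by (rule mult_map_scale_conv_mult[symmetric])
  then show ?thesis by (simp add: map.rep_eq when_def)
qed

lemma poly_expand:
  fixes P :: "'n::finite expo \<Rightarrow>\<^sub>0 'r::comm_ring_1"
  assumes "finite A" "Poly_Mapping.keys P \<subseteq> A"
  shows "P = (\<Sum>p\<in>A. cst (Poly_Mapping.lookup P p) * mon p)"
proof (rule poly_mapping_eqI)
  fix q
  have "Poly_Mapping.lookup (\<Sum>p\<in>A. cst (Poly_Mapping.lookup P p) * mon p) q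
      = (\<Sum>p\<in>A. Poly_Mapping.lookup P p when p = q)"
    by (simp add: lookup_sum cst_single lookup_single when_def)
  also have "\<dots> = (if q \<in> A then Poly_Mapping.lookup P q else 0)"
    using assms(1) by (simp add: when_def sum.delta)
  also have "\<dots> = Poly_Mapping.lookup P q"
    using assms(2) by (auto simp: in_keys_iff)
  finally show "Poly_Mapping.lookup P q
      = Poly_Mapping.lookup (\<Sum>p\<in>A. cst (Poly_Mapping.lookup P p) * mon p) q" ..
qed

definition mono_mult_weyl :: "'r::comm_ring_1 \<Rightarrow> 'n::finite expo \<Rightarrow> 'n expo \<Rightarrow> ('n expo \<Rightarrow>\<^sub>0 'r)" where
  "mono_mult_weyl t p q =
     (\<Sum>\<kappa> | \<forall>i. Poly_Mapping.lookup \<kappa> i \<le> Poly_Mapping.lookup (snd p) i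
           \<and> Poly_Mapping.lookup \<kappa> i \<le> Poly_Mapping.lookup (fst q) i.
        Poly_Mapping.single (fst p + (fst q - \<kappa>), (snd p - \<kappa>) + snd q) (weyl_coeff t (snd p) (fst q) \<kappa>))"

lemma weyl_mult_expand0:
  "weyl_mult t P Q = (\<Sum>p\<in>Poly_Mapping.keys P. \<Sum>q\<in>Poly_Mapping.keys Q.
     cst (Poly_Mapping.lookup P p) * (cst (Poly_Mapping.lookup Q q) * mono_mult_weyl t p q))"
  unfolding weyl_mult_def mono_mult_weyl_def
  by (simp add: case_prod_beta sum_distrib_left cst_single mult.assoc)

lemma weyl_mult_expand:
  assumes "finite A" "Poly_Mapping.keys P \<subseteq> A" "finite B" "Poly_Mapping.keys Q \<subseteq> B"
  shows "weyl_mult t P Q = (\<Sum>p\<in>A. \<Sum>q\<in>B.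
     cst (Poly_Mapping.lookup P p) * (cst (Poly_Mapping.lookup Q q) * mono_mult_weyl t p q))"
proof -
  have "weyl_mult t P Q = (\<Sum>p\<in>Poly_Mapping.keys P. \<Sum>q\<in>B.
     cst (Poly_Mapping.lookup P p) * (cst (Poly_Mapping.lookup Q q) * mono_mult_weyl t p q))"
    unfolding weyl_mult_expand0
    by (intro sum.cong refl sum.mono_neutral_left) (use assms in \<open>auto simp: in_keys_iff\<close>)
  also have "\<dots> = (\<Sum>p\<in>A. \<Sum>q\<in>B.
     cst (Poly_Mapping.lookup P p) * (cst (Poly_Mapping.lookup Q q) * mono_mult_weyl t p q))"
    by (intro sum.mono_neutral_left) (use assms in \<open>auto simp: in_keys_iff\<close>)
  finally show ?thesis .
qed

lemma weyl_mult_add_left: "weyl_mult t (P + P') Q = weyl_mult t P Q + weyl_mult t P' Q"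
proof -
  let ?A = "Poly_Mapping.keys P \<union> Poly_Mapping.keys P'" and ?B = "Poly_Mapping.keys Q"
  have "Poly_Mapping.keys (P + P') \<subseteq> ?A" by (rule keys_add)
  then show ?thesis
    using weyl_mult_expand[of ?A "P + P'" ?B Q t] weyl_mult_expand[of ?A P ?B Q t]
      weyl_mult_expand[of ?A P' ?B Q t]
    by (simp add: lookup_add cst_add distrib_right sum.distrib)
qed

lemma weyl_mult_add_right: "weyl_mult t P (Q + Q') = weyl_mult t P Q + weyl_mult t P Q'"
proof -
  let ?A = "Poly_Mapping.keys Q \<union> Poly_Mapping.keys Q'" and ?B = "Poly_Mapping.keys P"
  have "Poly_Mapping.keys (Q + Q') \<subseteq> ?A" by (rule keys_add)
  then show ?thesis
    using weyl_mult_expand[of ?B P ?A "Q + Q'" t] weyl_mult_expand[of ?B P ?A Q t]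
      weyl_mult_expand[of ?B P ?A Q' t]
    by (simp add: lookup_add cst_add distrib_right distrib_left sum.distrib)
qed

lemma weyl_mult_cst_left: "weyl_mult t (cst c * P) Q = cst c * weyl_mult t P Q"
proof -
  have "Poly_Mapping.keys (cst c * P) \<subseteq> Poly_Mapping.keys P"
    by (auto simp: in_keys_iff lookup_cst_mult)
  from weyl_mult_expand[OF _ this, of "Poly_Mapping.keys Q" Q t] show ?thesis
    by (simp add: weyl_mult_expand0 lookup_cst_mult cst_mult sum_distrib_left mult.assoc)
qed

lemma weyl_mult_cst_right: "weyl_mult t P (cst c * Q) = cst c * weyl_mult t P Q"
proof -
  have "Poly_Mapping.keys (cst c * Q) \<subseteq> Poly_Mapping.keys Q"
    by (auto simp: in_keys_iff lookup_cst_mult)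
  from weyl_mult_expand[OF _ _ _ this, of "Poly_Mapping.keys P" P t] show ?thesis
    by (simp only: weyl_mult_expand0[of t P Q] lookup_cst_mult cst_mult sum_distrib_left
        mult.assoc mult.left_commute[of "cst c"] finite_keys order_refl)
qed

lemma weyl_mult_0 [simp]: "weyl_mult t 0 Q = 0" "weyl_mult t P 0 = 0"
  by (simp_all add: weyl_mult_expand0)

lemma weyl_mult_sum_left: "weyl_mult t (\<Sum>a\<in>A. f a) Q = (\<Sum>a\<in>A. weyl_mult t (f a) Q)"
  by (induction A rule: infinite_finite_induct) (auto simp: weyl_mult_add_left)

lemma weyl_mult_sum_right: "weyl_mult t P (\<Sum>a\<in>A. f a) = (\<Sum>a\<in>A. weyl_mult t P (f a))"
  by (induction A rule: infinite_finite_induct) (auto simp: weyl_mult_add_right)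

lemma weyl_mult_mono: "weyl_mult t (mon p) (mon q) = mono_mult_weyl t p q"
  by (simp add: weyl_mult_expand0)

lemma linear_ext:
  fixes P :: "'n::finite expo \<Rightarrow>\<^sub>0 'r::comm_ring_1" and f g :: "('n expo \<Rightarrow>\<^sub>0 'r) \<Rightarrow> ('n expo \<Rightarrow>\<^sub>0 'r)"
  assumes "\<And>P Q. f (P + Q) = f P + f Q" "\<And>P Q. g (P + Q) = g P + g Q"
    and "\<And>c P. f (cst c * P) = cst c * f P" "\<And>c P. g (cst c * P) = cst c * g P"
    and "\<And>p. f (mon p) = g (mon p)"
  shows "f P = g P"
proof -
  have z: "f 0 = 0" "g 0 = 0" using assms(3)[of 0 0] assms(4)[of 0 0] by simp_all
  have s: "f (\<Sum>p\<in>A. h p) = (\<Sum>p\<in>A. f (h p)) \<and> g (\<Sum>p\<in>A. h p) = (\<Sum>p\<in>A. g (h p))"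
    for A and h :: "'n expo \<Rightarrow> _"
    by (induction A rule: infinite_finite_induct) (auto simp: z assms)
  have e: "P = (\<Sum>p\<in>Poly_Mapping.keys P. cst (Poly_Mapping.lookup P p) * mon p)"
    by (rule poly_expand) auto
  show ?thesis
    by (subst (1 2) e) (simp add: s assms)
qed

lemma finite_lookup_le: "finite {\<kappa> :: 'n::finite \<Rightarrow>\<^sub>0 nat. \<forall>i. Poly_Mapping.lookup \<kappa> i \<le> f i}"
proof (rule finite_imageD)
  let ?S = "{\<kappa> :: 'n::finite \<Rightarrow>\<^sub>0 nat. \<forall>i. Poly_Mapping.lookup \<kappa> i \<le> f i}"
  have "Poly_Mapping.lookup ` ?S \<subseteq> PiE UNIV (\<lambda>i. {..f i})"
    by (simp add: image_subset_iff PiE_iff)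
  moreover have "finite (PiE (UNIV :: 'n set) (\<lambda>i. {..f i}))"
    by (intro finite_PiE) simp_all
  ultimately show "finite (Poly_Mapping.lookup ` ?S)"
    by (rule finite_subset)
  show "inj_on Poly_Mapping.lookup ?S"
    by (rule inj_onI) (rule poly_mapping_eqI, simp)
qed

lemma weyl_coeff_eq_0:
  assumes "\<not> (\<forall>i. Poly_Mapping.lookup \<kappa> i \<le> Poly_Mapping.lookup \<gamma> i
     \<and> Poly_Mapping.lookup \<kappa> i \<le> Poly_Mapping.lookup \<beta> i)"
  shows "weyl_coeff t \<gamma> \<beta> \<kappa> = 0"
proof -
  from assms obtain i where "Poly_Mapping.lookup \<gamma> i < Poly_Mapping.lookup \<kappa> i
     \<or> Poly_Mapping.lookup \<beta> i < Poly_Mapping.lookup \<kappa> i" by (meson not_le)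
  then have "(\<Prod>i\<in>UNIV. fact (Poly_Mapping.lookup \<kappa> i) * (Poly_Mapping.lookup \<gamma> i choose Poly_Mapping.lookup \<kappa> i)
     * (Poly_Mapping.lookup \<beta> i choose Poly_Mapping.lookup \<kappa> i)) = (0::nat)"
    by (intro prod_zero) (auto intro!: bexI[of _ i])
  then show ?thesis by (simp only: weyl_coeff_def) simp
qed

lemma mono_mult_weyl_superset:
  assumes "finite A" "{\<kappa>. \<forall>i. Poly_Mapping.lookup \<kappa> i \<le> Poly_Mapping.lookup (snd p) i
     \<and> Poly_Mapping.lookup \<kappa> i \<le> Poly_Mapping.lookup (fst q) i} \<subseteq> A"
  shows "mono_mult_weyl t p q = (\<Sum>\<kappa>\<in>A. Poly_Mapping.single (fst p + (fst q - \<kappa>), (snd p - \<kappa>) + snd q)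
     (weyl_coeff t (snd p) (fst q) \<kappa>))"
  unfolding mono_mult_weyl_def
proof (rule sum.mono_neutral_left[OF assms], rule ballI)
  fix \<kappa> assume "\<kappa> \<in> A - {\<kappa>. \<forall>i. Poly_Mapping.lookup \<kappa> i \<le> Poly_Mapping.lookup (snd p) i
     \<and> Poly_Mapping.lookup \<kappa> i \<le> Poly_Mapping.lookup (fst q) i}"
  then have "weyl_coeff t (snd p) (fst q) \<kappa> = 0" by (intro weyl_coeff_eq_0) simp
  then show "Poly_Mapping.single (fst p + (fst q - \<kappa>), snd p - \<kappa> + snd q)
    (weyl_coeff t (snd p) (fst q) \<kappa>) = 0" by simp
qed

lemma mono_mult_weyl_shift: "mono_mult_weyl t ((\<alpha>, 0) + p) q = mon (\<alpha>, 0) * mono_mult_weyl t p q"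
  by (simp add: mono_mult_weyl_def sum_distrib_left mult_single add.assoc)

lemma mono_mult_weyl_zero: "mono_mult_weyl t (\<alpha>, 0) q = mon ((\<alpha>, 0) + q)"
proof -
  have "{\<kappa> :: 'a \<Rightarrow>\<^sub>0 nat. \<forall>i. Poly_Mapping.lookup \<kappa> i \<le> 0 \<and> Poly_Mapping.lookup \<kappa> i \<le> Poly_Mapping.lookup (fst q) i} = {0}"
    by (auto intro: poly_mapping_eqI)
  then show ?thesis
    by (simp add: mono_mult_weyl_def weyl_coeff_def vdeg_def plus_prod_def)
qed

lemma mono_mult_weyl_zero': "mono_mult_weyl t p (0, \<delta>) = mon (p + (0, \<delta>))"
proof -
  have "{\<kappa> :: 'a \<Rightarrow>\<^sub>0 nat. \<forall>i. Poly_Mapping.lookup \<kappa> i \<le> Poly_Mapping.lookup (snd p) i \<and> Poly_Mapping.lookup \<kappa> i \<le> 0} = {0}"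
    by (auto intro: poly_mapping_eqI)
  then show ?thesis
    by (simp add: mono_mult_weyl_def weyl_coeff_def vdeg_def plus_prod_def)
qed

lemma choose_step:
  "fact k * (Suc c choose k) * (b choose k) =
     fact k * (c choose k) * (b choose k)
     + (if k = 0 then 0 else (b - (k - 1)) * (fact (k - 1) * (c choose (k - 1)) * (b choose (k - 1))))"
  for k c b :: nat
proof (cases k)
  case (Suc l)
  have "Suc l * (b choose Suc l) = (b - l) * (b choose l)"
    by (metis binomial_absorb_comp binomial_absorption mult.commute)
  then have "fact (Suc l) * (c choose l) * (b choose Suc l) = (b - l) * (fact l * (c choose l) * (b choose l))"
    by (simp only: fact_Suc of_nat_id) (metis (no_types) mult.assoc mult.commute)
  then show ?thesis
    using Suc by (simp only: binomial_Suc_Suc) (simp add: distrib_left distrib_right)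
qed simp

lemma weyl_coeff_step:
  fixes \<gamma> \<beta> \<kappa> :: "'n::finite \<Rightarrow>\<^sub>0 nat"
  defines "E i \<equiv> Poly_Mapping.single i (1::nat)"
  shows "weyl_coeff t (E i + \<gamma>) \<beta> \<kappa> = weyl_coeff t \<gamma> \<beta> \<kappa>
     + (if Poly_Mapping.lookup \<kappa> i = 0 then 0 else
          t * of_nat (Poly_Mapping.lookup (\<beta> - (\<kappa> - E i)) i) * weyl_coeff t \<gamma> \<beta> (\<kappa> - E i))"
proof -
  define g :: "nat \<Rightarrow> nat \<Rightarrow> nat \<Rightarrow> nat" where "g k c b = fact k * (c choose k) * (b choose k)" for k c b
  let ?l = Poly_Mapping.lookup
  have split: "(\<Prod>j\<in>UNIV. h j) = h i * (\<Prod>j\<in>UNIV - {i}. h j)" for h :: "'n \<Rightarrow> nat"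
    by (simp add: prod.remove)
  have wc: "weyl_coeff t \<gamma> \<beta> \<kappa> = of_nat (g (?l \<kappa> i) (?l \<gamma> i) (?l \<beta> i) * (\<Prod>j\<in>UNIV - {i}. g (?l \<kappa> j) (?l \<gamma> j) (?l \<beta> j))) * t ^ vdeg \<kappa>"
    for \<gamma> \<kappa> :: "'n \<Rightarrow>\<^sub>0 nat"
    unfolding weyl_coeff_def split g_def ..
  have E: "?l (E i) j = (if j = i then 1 else 0)" for j by (simp add: E_def lookup_single when_def)
  have p1: "(\<Prod>j\<in>UNIV - {i}. g (?l \<kappa> j) (?l (E i + \<gamma>) j) (?l \<beta> j)) = (\<Prod>j\<in>UNIV - {i}. g (?l \<kappa> j) (?l \<gamma> j) (?l \<beta> j))"
    by (rule prod.cong) (auto simp: lookup_add E)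
  have p2: "(\<Prod>j\<in>UNIV - {i}. g (?l (\<kappa> - E i) j) (?l \<gamma> j) (?l \<beta> j)) = (\<Prod>j\<in>UNIV - {i}. g (?l \<kappa> j) (?l \<gamma> j) (?l \<beta> j))"
    by (rule prod.cong) (auto simp: lookup_minus E)
  have l1: "?l (E i + \<gamma>) i = Suc (?l \<gamma> i)" by (simp add: lookup_add E)
  have l2: "?l (\<kappa> - E i) i = ?l \<kappa> i - 1" by (simp add: lookup_minus E)
  have l3: "?l (\<beta> - (\<kappa> - E i)) i = ?l \<beta> i - (?l \<kappa> i - 1)" by (simp add: lookup_minus E)
  show ?thesis
  proof (cases "?l \<kappa> i = 0")
    case True
    then show ?thesis unfolding wc p1 l1 by (simp add: g_def)
  next
    case False
    have v: "vdeg \<kappa> = Suc (vdeg (\<kappa> - E i))"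
    proof -
      have "vdeg \<kappa> = (\<Sum>j\<in>UNIV. ?l (\<kappa> - E i) j + (if j = i then 1 else 0))"
        unfolding vdeg_def by (rule sum.cong) (use False in \<open>auto simp: lookup_minus E\<close>)
      also have "\<dots> = Suc (vdeg (\<kappa> - E i))" by (simp add: sum.distrib vdeg_def)
      finally show ?thesis .
    qed
    have st: "g (?l \<kappa> i) (Suc (?l \<gamma> i)) (?l \<beta> i) = g (?l \<kappa> i) (?l \<gamma> i) (?l \<beta> i)
       + (?l \<beta> i - (?l \<kappa> i - 1)) * g (?l \<kappa> i - 1) (?l \<gamma> i) (?l \<beta> i)"
      using choose_step[of "?l \<kappa> i" "?l \<gamma> i" "?l \<beta> i"] False unfolding g_def by simp
    show ?thesis using False
      unfolding wc p1 p2 l1 l2 l3 st of_nat_mult of_nat_add by (simp add: v distrib_left distrib_right mult_ac del: of_nat_diff)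
  qed
qed

text \<open>\<open>x\<close>-derivative of a normally ordered element.\<close>

definition xder :: "'n::finite \<Rightarrow> ('n expo \<Rightarrow>\<^sub>0 'r::comm_ring_1) \<Rightarrow> ('n expo \<Rightarrow>\<^sub>0 'r)" where
  "xder i P = (\<Sum>p\<in>Poly_Mapping.keys P. cst (Poly_Mapping.lookup P p) *
     Poly_Mapping.single (fst p - Poly_Mapping.single i 1, snd p) (of_nat (Poly_Mapping.lookup (fst p) i)))"

lemma xder_expand:
  assumes "finite A" "Poly_Mapping.keys P \<subseteq> A"
  shows "xder i P = (\<Sum>p\<in>A. cst (Poly_Mapping.lookup P p) *
     Poly_Mapping.single (fst p - Poly_Mapping.single i 1, snd p) (of_nat (Poly_Mapping.lookup (fst p) i)))"
  unfolding xder_def by (rule sum.mono_neutral_left) (use assms in \<open>auto simp: in_keys_iff\<close>)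

lemma xder_add: "xder i (P + Q) = xder i P + xder i Q"
proof -
  let ?A = "Poly_Mapping.keys P \<union> Poly_Mapping.keys Q"
  have "Poly_Mapping.keys (P + Q) \<subseteq> ?A" by (rule keys_add)
  then show ?thesis
    using xder_expand[of ?A "P + Q" i] xder_expand[of ?A P i] xder_expand[of ?A Q i]
    by (simp add: lookup_add cst_add distrib_right sum.distrib)
qed

lemma xder_cst: "xder i (cst c * P) = cst c * xder i P"
proof -
  have "Poly_Mapping.keys (cst c * P) \<subseteq> Poly_Mapping.keys P"
    by (auto simp: in_keys_iff lookup_cst_mult)
  from xder_expand[OF _ this, of i] show ?thesis
    by (simp add: xder_def lookup_cst_mult cst_mult sum_distrib_left mult.assoc)
qed

lemma xder_mono: "xder i (mon p) =
    Poly_Mapping.single (fst p - Poly_Mapping.single i 1, snd p) (of_nat (Poly_Mapping.lookup (fst p) i))"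
  by (simp add: xder_def)

lemma xder_single: "xder i (Poly_Mapping.single p c) =
    Poly_Mapping.single (fst p - Poly_Mapping.single i 1, snd p) (c * of_nat (Poly_Mapping.lookup (fst p) i))"
  by (subst single_cst, subst xder_cst, subst xder_mono) (simp add: cst_single)

lemma xder_0: "xder i 0 = 0"
  by (simp add: xder_def)

lemma xder_sum: "xder i (\<Sum>a\<in>A. f a) = (\<Sum>a\<in>A. xder i (f a))"
  by (induction A rule: infinite_finite_induct) (auto simp: xder_add xder_0)

lemma minus_single_shift:
  fixes \<alpha> \<beta> :: "'n::finite \<Rightarrow>\<^sub>0 nat"
  assumes "Poly_Mapping.lookup \<alpha> i \<noteq> 0"
  shows "\<alpha> + \<beta> - Poly_Mapping.single i 1 = (\<alpha> - Poly_Mapping.single i 1) + \<beta>"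
  by (rule poly_mapping_eqI) (use assms in \<open>auto simp: lookup_add lookup_minus lookup_single when_def\<close>)

lemma xder_leibniz:
  fixes P :: "'a::finite expo \<Rightarrow>\<^sub>0 'b::comm_ring_1"
  shows "xder i (mon (\<alpha>, 0) * P) = xder i (mon (\<alpha>, 0)) * P + mon (\<alpha>, 0) * xder i P"
proof (rule linear_ext[where P = P and f = "\<lambda>P. xder i (mon (\<alpha>, 0) * P)"
      and g = "\<lambda>P. xder i (mon (\<alpha>, 0)) * P + mon (\<alpha>, 0) * xder i P"])
  fix p :: "'a expo"
  let ?e = "Poly_Mapping.single i (1::nat)" and ?l = Poly_Mapping.lookup
  obtain \<beta> \<delta> where p: "p = (\<beta>, \<delta>)" by force
  have 1: "Poly_Mapping.single (\<alpha> + \<beta> - ?e, \<delta>) (of_nat (?l \<alpha> i) :: 'b)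
      = Poly_Mapping.single ((\<alpha> - ?e) + \<beta>, \<delta>) (of_nat (?l \<alpha> i))"
    by (cases "?l \<alpha> i = 0") (simp_all only: minus_single_shift of_nat_0 single_zero not_False_eq_True)
  have 2: "Poly_Mapping.single (\<alpha> + \<beta> - ?e, \<delta>) (of_nat (?l \<beta> i) :: 'b)
      = Poly_Mapping.single (\<alpha> + (\<beta> - ?e), \<delta>) (of_nat (?l \<beta> i))"
    by (cases "?l \<beta> i = 0")
      (simp_all only: minus_single_shift add.commute[of \<alpha>] of_nat_0 single_zero not_False_eq_True)
  have "xder i (mon (\<alpha>, 0) * mon p) = Poly_Mapping.single (\<alpha> + \<beta> - ?e, \<delta>) (of_nat (?l \<alpha> i) :: 'b)
      + Poly_Mapping.single (\<alpha> + \<beta> - ?e, \<delta>) (of_nat (?l \<beta> i))"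
    by (simp only: p mon_mult xder_mono) (simp add: lookup_add single_add)
  also have "\<dots> = xder i (mon (\<alpha>, 0)) * mon p + mon (\<alpha>, 0) * xder i (mon p)"
    unfolding 1 2 by (simp add: p xder_mono mult_single)
  finally show "xder i (mon (\<alpha>, 0) * mon p :: 'a expo \<Rightarrow>\<^sub>0 'b)
      = xder i (mon (\<alpha>, 0)) * mon p + mon (\<alpha>, 0) * xder i (mon p)" .
next
  fix c :: 'b and P :: "'a expo \<Rightarrow>\<^sub>0 'b"
  have "mon (\<alpha>, 0) * (cst c * P) = cst c * (mon (\<alpha>, 0) * P)" by (simp add: mult_ac)
  then show "xder i (mon (\<alpha>, 0) * (cst c * P)) = cst c * xder i (mon (\<alpha>, 0) * P)"
    by (simp only: xder_cst)
qed (simp_all add: distrib_left xder_add xder_cst mon_cst add_ac mult.left_commute[of _ "cst _"])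

lemma weyl_mult_x_left: "weyl_mult t (mon (\<alpha>, 0)) Q = mon (\<alpha>, 0) * Q"
  by (rule linear_ext[where f = "weyl_mult t (mon (\<alpha>, 0))"])
    (simp_all add: weyl_mult_add_right weyl_mult_cst_right distrib_left mon_cst weyl_mult_mono
      mono_mult_weyl_zero mon_mult)

lemma mono_mult_weyl_d_step:
  "mono_mult_weyl t (dvar i + (0, \<gamma>)) q
     = mon (dvar i) * mono_mult_weyl t (0, \<gamma>) q + cst t * xder i (mono_mult_weyl t (0, \<gamma>) q)"
proof -
  let ?l = Poly_Mapping.lookup
  let ?e = "Poly_Mapping.single i (1::nat)"
  obtain \<beta> \<delta> where q: "q = (\<beta>, \<delta>)" by force
  define A where "A = {\<kappa> :: 'a \<Rightarrow>\<^sub>0 nat. \<forall>j. ?l \<kappa> j \<le> ?l (?e + \<gamma>) j}"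
  define B where "B = (\<lambda>\<kappa>. \<kappa> + ?e) ` A"
  have fA: "finite A" unfolding A_def by (rule finite_lookup_le)
  have fB: "finite B" unfolding B_def using fA by simp
  define w where "w = weyl_coeff t \<gamma> \<beta>"
  define T where "T \<kappa> = Poly_Mapping.single (\<beta> - \<kappa>, \<gamma> - \<kappa> + \<delta>) (w \<kappa>)" for \<kappa>
  define u where "u \<kappa> = (if ?l \<kappa> i = 0 then 0 else t * of_nat (?l (\<beta> - (\<kappa> - ?e)) i) * w (\<kappa> - ?e))" for \<kappa>
  have K: "mono_mult_weyl t (0, \<gamma>) q = (\<Sum>\<kappa>\<in>A. T \<kappa>)"
    by (subst mono_mult_weyl_superset[of A])
      (use fA in \<open>auto simp: q T_def w_def A_def lookup_add intro: trans_le_add2\<close>)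
  have "mono_mult_weyl t (dvar i + (0, \<gamma>)) q
      = (\<Sum>\<kappa>\<in>A \<union> B. Poly_Mapping.single (\<beta> - \<kappa>, ?e + \<gamma> - \<kappa> + \<delta>) (weyl_coeff t (?e + \<gamma>) \<beta> \<kappa>))"
    by (subst mono_mult_weyl_superset[of "A \<union> B"]) (use fA fB in \<open>auto simp: q A_def\<close>)
  also have "\<dots> = (\<Sum>\<kappa>\<in>A \<union> B. Poly_Mapping.single (\<beta> - \<kappa>, ?e + \<gamma> - \<kappa> + \<delta>) (w \<kappa>))
      + (\<Sum>\<kappa>\<in>A \<union> B. Poly_Mapping.single (\<beta> - \<kappa>, ?e + \<gamma> - \<kappa> + \<delta>) (u \<kappa>))"
    unfolding weyl_coeff_step single_add sum.distrib u_def w_def ..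
  also have "(\<Sum>\<kappa>\<in>A \<union> B. Poly_Mapping.single (\<beta> - \<kappa>, ?e + \<gamma> - \<kappa> + \<delta>) (w \<kappa>))
      = (\<Sum>\<kappa>\<in>A. Poly_Mapping.single (\<beta> - \<kappa>, ?e + \<gamma> - \<kappa> + \<delta>) (w \<kappa>))"
  proof (rule sum.mono_neutral_right)
    show "\<forall>\<kappa>\<in>A \<union> B - A. Poly_Mapping.single (\<beta> - \<kappa>, ?e + \<gamma> - \<kappa> + \<delta>) (w \<kappa>) = 0"
    proof
      fix \<kappa> assume "\<kappa> \<in> A \<union> B - A"
      then obtain j where "?l (?e + \<gamma>) j < ?l \<kappa> j" unfolding A_def by (auto simp: not_le)
      then have "\<not> (?l \<kappa> j \<le> ?l \<gamma> j)" by (simp add: lookup_add)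
      then have "w \<kappa> = 0" unfolding w_def by (intro weyl_coeff_eq_0) auto
      then show "Poly_Mapping.single (\<beta> - \<kappa>, ?e + \<gamma> - \<kappa> + \<delta>) (w \<kappa>) = 0" by simp
    qed
  qed (use fA fB in auto)
  also have "\<dots> = (\<Sum>\<kappa>\<in>A. mon (dvar i) * T \<kappa>)"
  proof (rule sum.cong)
    fix \<kappa>
    show "Poly_Mapping.single (\<beta> - \<kappa>, ?e + \<gamma> - \<kappa> + \<delta>) (w \<kappa>) = mon (dvar i) * T \<kappa>"
    proof (cases "\<forall>j. ?l \<kappa> j \<le> ?l \<gamma> j")
      case True
      then have "?e + \<gamma> - \<kappa> = ?e + (\<gamma> - \<kappa>)"
        by (intro poly_mapping_eqI) (simp add: lookup_add lookup_minus)
      then show ?thesis by (simp add: T_def mult_single add.assoc)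
    next
      case False
      then have "w \<kappa> = 0" unfolding w_def by (intro weyl_coeff_eq_0) auto
      then show ?thesis by (simp add: T_def)
    qed
  qed simp
  also have "(\<Sum>\<kappa>\<in>A \<union> B. Poly_Mapping.single (\<beta> - \<kappa>, ?e + \<gamma> - \<kappa> + \<delta>) (u \<kappa>))
      = (\<Sum>\<kappa>\<in>B. Poly_Mapping.single (\<beta> - \<kappa>, ?e + \<gamma> - \<kappa> + \<delta>) (u \<kappa>))"
  proof (rule sum.mono_neutral_right)
    show "\<forall>\<kappa>\<in>A \<union> B - B. Poly_Mapping.single (\<beta> - \<kappa>, ?e + \<gamma> - \<kappa> + \<delta>) (u \<kappa>) = 0"
    proof
      fix \<kappa> assume k: "\<kappa> \<in> A \<union> B - B"
      have "?l \<kappa> i = 0"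
      proof (rule ccontr)
        assume "?l \<kappa> i \<noteq> 0"
        then have "\<kappa> = (\<kappa> - ?e) + ?e"
          by (intro poly_mapping_eqI) (auto simp: lookup_add lookup_minus lookup_single when_def)
        moreover have "\<kappa> - ?e \<in> A" using k
          by (auto simp: A_def lookup_minus intro: diff_le_self[THEN order_trans])
        ultimately have "\<kappa> \<in> B" unfolding B_def by blast
        with k show False by simp
      qed
      then show "Poly_Mapping.single (\<beta> - \<kappa>, ?e + \<gamma> - \<kappa> + \<delta>) (u \<kappa>) = 0" by (simp add: u_def)
    qed
  qed (use fA fB in auto)
  also have "\<dots> = (\<Sum>\<kappa>\<in>A. Poly_Mapping.single (\<beta> - (\<kappa> + ?e), ?e + \<gamma> - (\<kappa> + ?e) + \<delta>) (u (\<kappa> + ?e)))"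
    unfolding B_def by (subst sum.reindex) (auto simp: inj_on_def)
  also have "\<dots> = (\<Sum>\<kappa>\<in>A. cst t * xder i (T \<kappa>))"
  proof (rule sum.cong)
    fix \<kappa>
    have 1: "\<beta> - (\<kappa> + ?e) = \<beta> - \<kappa> - ?e" "?e + \<gamma> - (\<kappa> + ?e) = \<gamma> - \<kappa>" "\<kappa> + ?e - ?e = \<kappa>"
      by (rule poly_mapping_eqI, simp add: lookup_add lookup_minus)+
    have "u (\<kappa> + ?e) = t * (w \<kappa> * of_nat (?l (\<beta> - \<kappa>) i))"
      unfolding u_def 1 by (simp add: lookup_add lookup_single)
    then show "Poly_Mapping.single (\<beta> - (\<kappa> + ?e), ?e + \<gamma> - (\<kappa> + ?e) + \<delta>) (u (\<kappa> + ?e)) = cst t * xder i (T \<kappa>)"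
      unfolding 1 by (simp add: T_def xder_single cst_single)
  qed simp
  finally show ?thesis
    unfolding K xder_sum sum_distrib_left .
qed

lemma weyl_mult_d_left: "weyl_mult t (mon (dvar i)) Q = mon (dvar i) * Q + cst t * xder i Q"
proof (rule linear_ext[where f = "weyl_mult t (mon (dvar i))"])
  fix p :: "'a expo"
  have 0: "(0 :: 'a expo) = (0, 0)" by (simp add: zero_prod_def)
  show "weyl_mult t (mon (dvar i)) (mon p) = mon (dvar i) * mon p + cst t * xder i (mon p)"
    using mono_mult_weyl_d_step[of t i 0 p] mono_mult_weyl_zero[of t 0 p]
    by (simp add: weyl_mult_mono 0[symmetric])
qed (simp_all add: weyl_mult_add_right weyl_mult_cst_right distrib_left mon_cst xder_add xder_cst
  add_ac mult.left_commute[of "cst _" "cst _"])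

lemma weyl_mult_x_assoc:
  fixes P Q :: "'a::finite expo \<Rightarrow>\<^sub>0 'b::comm_ring_1"
  shows "weyl_mult t (mon (\<alpha>, 0) * P) Q = mon (\<alpha>, 0) * weyl_mult t P Q"
proof (rule linear_ext[where P = P and f = "\<lambda>P. weyl_mult t (mon (\<alpha>, 0) * P) Q"
      and g = "\<lambda>P. mon (\<alpha>, 0) * weyl_mult t P Q"])
  fix p :: "'a expo"
  show "weyl_mult t (mon (\<alpha>, 0) * mon p) Q = mon (\<alpha>, 0) * weyl_mult t (mon p) Q"
  proof (rule linear_ext[where f = "weyl_mult t (mon (\<alpha>, 0) * mon p)"])
    fix q
    show "weyl_mult t (mon (\<alpha>, 0) * mon p) (mon q) = mon (\<alpha>, 0) * weyl_mult t (mon p) (mon q)"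
      unfolding mon_mult weyl_mult_mono by (rule mono_mult_weyl_shift)
  qed (simp_all add: weyl_mult_add_right weyl_mult_cst_right distrib_left mon_cst)
next
  fix c :: 'b and P :: "'a expo \<Rightarrow>\<^sub>0 'b"
  have "mon (\<alpha>, 0) * (cst c * P) = cst c * (mon (\<alpha>, 0) * P)" by (simp add: mult_ac)
  then show "weyl_mult t (mon (\<alpha>, 0) * (cst c * P)) Q = cst c * weyl_mult t (mon (\<alpha>, 0) * P) Q"
    by (simp only: weyl_mult_cst_left)
qed (simp_all add: weyl_mult_add_left weyl_mult_cst_left distrib_left mon_cst)

lemma weyl_mult_d_assoc:
  fixes P Q :: "'a::finite expo \<Rightarrow>\<^sub>0 'b::comm_ring_1"
  shows "weyl_mult t (weyl_mult t (mon (dvar i)) P) Q = weyl_mult t (mon (dvar i)) (weyl_mult t P Q)"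
proof (rule linear_ext[where P = P and f = "\<lambda>P. weyl_mult t (weyl_mult t (mon (dvar i)) P) Q"])
  fix p :: "'a expo"
  obtain \<alpha> \<gamma> where p: "p = (\<alpha>, 0) + (0, \<gamma>)" by (cases p) auto
  show "weyl_mult t (weyl_mult t (mon (dvar i)) (mon p)) Q = weyl_mult t (mon (dvar i)) (weyl_mult t (mon p) Q)"
  proof (rule linear_ext[where f = "weyl_mult t (weyl_mult t (mon (dvar i)) (mon p))"])
    fix q
    let ?K = "mono_mult_weyl t (0, \<gamma>) q"
    define \<eta> where "\<eta> = \<alpha> - Poly_Mapping.single i 1"
    have x1: "xder i (mon (\<alpha>, 0) :: 'a expo \<Rightarrow>\<^sub>0 'b) = cst (of_nat (Poly_Mapping.lookup \<alpha> i)) * mon (\<eta>, 0)"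
      by (simp add: xder_mono cst_single \<eta>_def)
    have x2: "xder i (mon (0, \<gamma>) :: 'a expo \<Rightarrow>\<^sub>0 'b) = 0"
      by (simp add: xder_mono)
    have x3: "xder i (mon p :: 'a expo \<Rightarrow>\<^sub>0 'b) = cst (of_nat (Poly_Mapping.lookup \<alpha> i)) * (mon (\<eta>, 0) * mon (0, \<gamma>))"
      unfolding p mon_mult[symmetric] xder_leibniz x1 x2 by (simp only: mult_ac mult_zero_right mult_zero_left add_0_right)
    have m: "mon (dvar i) * mon p = mon (\<alpha>, 0) * mon (dvar i + (0, \<gamma>) :: 'a expo)"
      by (simp add: p mon_mult)
    have "weyl_mult t (weyl_mult t (mon (dvar i)) (mon p)) (mon q)
        = mon (\<alpha>, 0) * mono_mult_weyl t (dvar i + (0, \<gamma>)) q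
          + cst t * (cst (of_nat (Poly_Mapping.lookup \<alpha> i)) * (mon (\<eta>, 0) * ?K))"
      unfolding weyl_mult_d_left m x3 weyl_mult_add_left weyl_mult_cst_left weyl_mult_x_assoc
      unfolding weyl_mult_mono ..
    also have "\<dots> = mon (dvar i) * (mon (\<alpha>, 0) * ?K)
          + cst t * (xder i (mon (\<alpha>, 0)) * ?K + mon (\<alpha>, 0) * xder i ?K)"
      unfolding mono_mult_weyl_d_step x1 by (simp only: distrib_left mult_ac add_ac)
    also have "\<dots> = weyl_mult t (mon (dvar i)) (mon (\<alpha>, 0) * ?K)"
      by (simp only: weyl_mult_d_left xder_leibniz)
    also have "mon (\<alpha>, 0) * ?K = weyl_mult t (mon p) (mon q)"
      by (simp only: p weyl_mult_mono mono_mult_weyl_shift)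
    finally show "weyl_mult t (weyl_mult t (mon (dvar i)) (mon p)) (mon q)
        = weyl_mult t (mon (dvar i)) (weyl_mult t (mon p) (mon q))" .
  qed (simp_all only: weyl_mult_add_right weyl_mult_cst_right)
qed (simp_all only: weyl_mult_add_left weyl_mult_add_right weyl_mult_cst_left weyl_mult_cst_right)

lemma expo_induct:
  fixes \<alpha> :: "'n::finite \<Rightarrow>\<^sub>0 nat"
  assumes "P 0" "\<And>i \<alpha>. P \<alpha> \<Longrightarrow> P (Poly_Mapping.single i 1 + \<alpha>)"
  shows "P \<alpha>"
proof (induction "vdeg \<alpha>" arbitrary: \<alpha>)
  case 0
  then have "\<alpha> = 0" by (intro poly_mapping_eqI) (simp add: vdeg_def)
  with assms show ?case by simp
next
  case (Suc k)
  then have "\<exists>i. Poly_Mapping.lookup \<alpha> i \<noteq> 0" by (metis vdeg_def sum.neutral nat.simps(3))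
  then obtain i where i: "Poly_Mapping.lookup \<alpha> i \<noteq> 0" ..
  let ?b = "\<alpha> - Poly_Mapping.single i 1"
  have a: "\<alpha> = Poly_Mapping.single i 1 + ?b"
    by (intro poly_mapping_eqI) (use i in \<open>auto simp: lookup_add lookup_minus lookup_single when_def\<close>)
  have "vdeg \<alpha> = Suc (vdeg ?b)"
    by (subst a) (simp add: vdeg_def lookup_add sum.distrib lookup_single when_def)
  with Suc have "P ?b" by simp
  then show ?case by (subst a) (rule assms(2))
qed

lemma weyl_mult_assoc: "weyl_mult t (weyl_mult t P Q) R = weyl_mult t P (weyl_mult t Q R)"
proof (rule linear_ext[where P = P and f = "\<lambda>P. weyl_mult t (weyl_mult t P Q) R"])
  fix p :: "'a expo"
  obtain \<alpha> \<gamma> where p: "p = (\<alpha>, 0) + (0, \<gamma>)" by (cases p) auto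
  have d: "weyl_mult t (weyl_mult t (mon (0, \<gamma>)) Q) R = weyl_mult t (mon (0, \<gamma>)) (weyl_mult t Q R)"
  proof (induction \<gamma> rule: expo_induct)
    case 1
    show ?case by (simp only: weyl_mult_x_left weyl_mult_x_assoc)
  next
    case (2 i \<gamma>)
    have "mon (0, Poly_Mapping.single i 1 + \<gamma>) = weyl_mult t (mon (dvar i)) (mon (0, \<gamma>))"
      by (simp add: weyl_mult_d_left xder_mono mon_mult)
    with 2 show ?case by (simp only: weyl_mult_d_assoc)
  qed
  show "weyl_mult t (weyl_mult t (mon p) Q) R = weyl_mult t (mon p) (weyl_mult t Q R)"
    unfolding p mon_mult[symmetric] weyl_mult_x_assoc d ..
qed (simp_all only: weyl_mult_add_left weyl_mult_cst_left)

lemma weyl_mult_one: "weyl_mult t 1 P = P" "weyl_mult t P 1 = P"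
proof -
  have 1: "(1 :: 'a expo \<Rightarrow>\<^sub>0 'b) = mon (0, 0)" by (metis single_one zero_prod_def)
  show "weyl_mult t 1 P = P" unfolding 1 weyl_mult_x_left unfolding 1[symmetric] by simp
  show "weyl_mult t P 1 = P"
  proof (rule linear_ext[where f = "\<lambda>P. weyl_mult t P 1"])
    fix p :: "'a expo"
    show "weyl_mult t (mon p) 1 = mon p"
      unfolding 1 weyl_mult_mono mono_mult_weyl_zero' by (simp add: zero_prod_def[symmetric])
  qed (simp_all only: weyl_mult_add_left weyl_mult_cst_left)
qed

lemma weyl_ring: "ring \<lparr>carrier = UNIV, monoid.mult = weyl_mult t, one = 1, zero = 0, add = (+)\<rparr>"
proof (rule ringI)
  show "abelian_group \<lparr>carrier = UNIV, monoid.mult = weyl_mult t, one = 1, zero = 0, add = (+)\<rparr>"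
    by (rule abelian_groupI) (auto simp: add_ac intro: exI[of _ "- _"] left_minus)
  show "monoid \<lparr>carrier = UNIV, monoid.mult = weyl_mult t, one = 1, zero = 0, add = (+)\<rparr>"
    by (rule monoidI) (simp_all add: weyl_mult_assoc weyl_mult_one)
qed (simp_all add: weyl_mult_add_left weyl_mult_add_right)

lemma weyl_relations:
  "weyl_mult t (mon (xvar i)) (mon (xvar j)) = weyl_mult t (mon (xvar j)) (mon (xvar i))"
  "weyl_mult t (mon (dvar i)) (mon (dvar j)) = weyl_mult t (mon (dvar j)) (mon (dvar i))"
  "weyl_mult t (mon (dvar i)) (mon (xvar j)) - weyl_mult t (mon (xvar j)) (mon (dvar i))
     = (if i = j then cst t else 0)"
  "weyl_mult t (cst c) P = cst c * P" "weyl_mult t P (cst c) = cst c * P"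
proof -
  show "weyl_mult t (mon (xvar i)) (mon (xvar j)) = weyl_mult t (mon (xvar j)) (mon (xvar i))"
    by (simp add: weyl_mult_x_left mult.commute)
  show "weyl_mult t (mon (dvar i)) (mon (dvar j)) = weyl_mult t (mon (dvar j)) (mon (dvar i))"
    by (simp add: weyl_mult_d_left xder_mono mult.commute)
  have "Poly_Mapping.lookup (Poly_Mapping.single j (1::nat)) i = (if i = j then 1 else 0)"
    by (simp add: lookup_single when_def)
  then have "xder i (mon (xvar j)) = (if i = j then 1 else 0 :: 'a expo \<Rightarrow>\<^sub>0 'b)"
    by (auto simp: xder_mono zero_prod_def[symmetric])
  then show "weyl_mult t (mon (dvar i)) (mon (xvar j)) - weyl_mult t (mon (xvar j)) (mon (dvar i))
     = (if i = j then cst t else 0)"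
    by (simp add: weyl_mult_d_left weyl_mult_x_left mult.commute)
  show "weyl_mult t (cst c) P = cst c * P" "weyl_mult t P (cst c) = cst c * P"
    using weyl_mult_cst_left[of t c 1 P] weyl_mult_cst_right[of t P c 1] by (simp_all add: weyl_mult_one)
qed

lemma weyl_monomial_basis:
  "weyl_mult t (mon (\<alpha>, 0)) (mon (0, \<gamma>)) = mon (\<alpha>, \<gamma>)"
  "weyl_mult t (mon (xvar i)) (mon (\<alpha>, 0)) = mon (Poly_Mapping.single i 1 + \<alpha>, 0)"
  "weyl_mult t (mon (dvar i)) (mon (0, \<gamma>)) = mon (0, Poly_Mapping.single i 1 + \<gamma>)"
  by (simp_all add: weyl_mult_x_left weyl_mult_d_left xder_mono mon_mult)


lemma lookup_L_part:
  "Poly_Mapping.lookup (L_part d P) \<mu> = (if int (mdeg \<mu>) = d then Poly_Mapping.lookup P \<mu> else 0)"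
  by (auto simp: L_part_def lookup_sum lookup_single when_def sum.delta in_keys_iff)

lemma L_part_sum: "L_part d (\<Sum>a\<in>A. f a) = (\<Sum>a\<in>A. L_part d (f a))"
  by (rule poly_mapping_eqI) (simp add: lookup_L_part lookup_sum)

lemma L_part_cst: "L_part d (cst c * P) = cst c * L_part d P"
  by (rule poly_mapping_eqI) (simp add: lookup_L_part lookup_cst_mult)

lemma vdeg_plus: "vdeg (\<alpha> + \<beta>) = vdeg \<alpha> + vdeg \<beta>"
  by (simp add: vdeg_def lookup_add sum.distrib)

lemma mdeg_plus: "mdeg (p + q) = mdeg p + mdeg q"
  by (simp add: mdeg_def vdeg_plus)

lemma mono_mult_weyl_top:
  assumes "mdeg \<mu> \<ge> mdeg p + mdeg q"
  shows "Poly_Mapping.lookup (mono_mult_weyl t p q) \<mu> = Poly_Mapping.lookup (mon (p + q)) \<mu>"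
proof -
  let ?l = Poly_Mapping.lookup
  let ?K = "{\<kappa>. \<forall>i. ?l \<kappa> i \<le> ?l (snd p) i \<and> ?l \<kappa> i \<le> ?l (fst q) i}"
  have fin: "finite ?K"
    by (rule finite_subset[OF _ finite_lookup_le[of "?l (snd p)"]]) auto
  have "?l (mono_mult_weyl t p q) \<mu>
      = (\<Sum>\<kappa>\<in>?K. if \<kappa> = 0 then ?l (mon (p + q)) \<mu> else 0)"
    unfolding mono_mult_weyl_def lookup_sum
  proof (rule sum.cong)
    fix \<kappa> assume k: "\<kappa> \<in> ?K"
    show "?l (Poly_Mapping.single (fst p + (fst q - \<kappa>), snd p - \<kappa> + snd q) (weyl_coeff t (snd p) (fst q) \<kappa>)) \<mu>
       = (if \<kappa> = 0 then ?l (mon (p + q)) \<mu> else 0)"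
    proof (cases "\<kappa> = 0")
      case True
      then show ?thesis by (simp add: weyl_coeff_def vdeg_def plus_prod_def)
    next
      case False
      have v: "vdeg \<beta> = vdeg (\<beta> - \<kappa>) + vdeg \<kappa>" if "\<forall>i. ?l \<kappa> i \<le> ?l \<beta> i" for \<beta>
        using that by (simp add: vdeg_def lookup_minus sum.distrib[symmetric])
      from False have "vdeg \<kappa> \<noteq> 0" by (auto simp: vdeg_def intro: poly_mapping_eqI)
      then have "mdeg (fst p + (fst q - \<kappa>), snd p - \<kappa> + snd q) < mdeg p + mdeg q"
        using k v[of "snd p"] v[of "fst q"] by (simp add: mdeg_def vdeg_plus)
      with assms False show ?thesis by (auto simp: lookup_single when_def)
    qed
  qed simp
  also have "\<dots> = ?l (mon (p + q)) \<mu>"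
    using fin by (simp add: sum.delta)
  finally show ?thesis .
qed

lemma L_part_weyl_mult:
  assumes "\<forall>\<mu>\<in>Poly_Mapping.keys P. int (mdeg \<mu>) \<le> d" "\<forall>\<mu>\<in>Poly_Mapping.keys Q. int (mdeg \<mu>) \<le> d'"
  shows "L_part (d + d') (weyl_mult t P Q) = L_part d P * L_part d' Q"
proof -
  let ?l = Poly_Mapping.lookup
  have e: "L_part d P = (\<Sum>p\<in>Poly_Mapping.keys P. cst (?l P p) * L_part d (mon p))"
    for d and P :: "'a expo \<Rightarrow>\<^sub>0 'b"
    by (subst poly_expand[OF finite_keys order_refl, of P]) (simp only: L_part_sum L_part_cst)
  have m: "L_part d (mon p :: 'a expo \<Rightarrow>\<^sub>0 'b) = (if int (mdeg p) = d then mon p else 0)" for d and p :: "'a expo"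
    by (rule poly_mapping_eqI) (auto simp: lookup_L_part lookup_single when_def)
  have k: "L_part (d + d') (mono_mult_weyl t p q) = L_part d (mon p) * L_part d' (mon q)"
    if "p \<in> Poly_Mapping.keys P" "q \<in> Poly_Mapping.keys Q" for p q
  proof -
    from that assms have le: "int (mdeg p) \<le> d" "int (mdeg q) \<le> d'" by auto
    have "L_part (d + d') (mono_mult_weyl t p q) = L_part (d + d') (mon (p + q))"
    proof (rule poly_mapping_eqI)
      fix \<mu>
      show "?l (L_part (d + d') (mono_mult_weyl t p q)) \<mu> = ?l (L_part (d + d') (mon (p + q))) \<mu>"
        using le mono_mult_weyl_top[of p q \<mu> t] by (auto simp: lookup_L_part)
    qed
    also have "\<dots> = L_part d (mon p) * L_part d' (mon q)"
      using le by (auto simp: m mdeg_plus mon_mult)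
    finally show ?thesis .
  qed
  have "L_part (d + d') (weyl_mult t P Q) = (\<Sum>p\<in>Poly_Mapping.keys P. \<Sum>q\<in>Poly_Mapping.keys Q.
     cst (?l P p) * (cst (?l Q q) * L_part (d + d') (mono_mult_weyl t p q)))"
    unfolding weyl_mult_expand0 L_part_sum L_part_cst ..
  also have "\<dots> = (\<Sum>p\<in>Poly_Mapping.keys P. \<Sum>q\<in>Poly_Mapping.keys Q.
     (cst (?l P p) * L_part d (mon p)) * (cst (?l Q q) * L_part d' (mon q)))"
    by (intro sum.cong refl) (simp only: k mult_ac)
  also have "\<dots> = L_part d P * L_part d' Q"
    by (simp only: e[of d P] e[of d' Q] sum_product)
  finally show ?thesis .
qed

lemma finsum_UNIV:
  fixes R :: "('a::ab_group_add, 'r) ring_scheme"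
  assumes "carrier R = UNIV" "add R = (+)" "zero R = 0"
  shows "finsum R f A = sum f A"
proof -
  interpret abelian_monoid R
    by (rule abelian_monoidI) (simp_all add: assms add_ac)
  show ?thesis
    by (induction A rule: infinite_finite_induct) (simp_all add: assms)
qed

text \<open>
  On the class in \<open>gr\<^sub>j\<close> of an element \<open>v \<in> L\<^sub>j[n]D\<^sup>r\<close>, the map induced by \<open>A\<close> is given by \<open>symbol_matrix\<close>.
\<close>

lemma symbol_matrix_induced:
  assumes A: "\<forall>a<r. \<forall>b<s. \<forall>\<mu>\<in>Poly_Mapping.keys (A a b). int (mdeg \<mu>) \<le> n a - n' b"
    and v: "v \<in> L_filt r n j" and b: "b < s"
  shows "L_part (j - n' b) (mat_map weyl_algebra r s A v b)
     = mat_map poly_S r s (symbol_matrix n n' A) (\<lambda>a. L_part (j - n a) (v a)) b"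
proof -
  have "L_part (j - n' b) (weyl_mult 1 (v a) (A a b)) = L_part (j - n a) (v a) * symbol_matrix n n' A a b"
    if "a < r" for a
  proof -
    have "\<forall>\<mu>\<in>Poly_Mapping.keys (v a). int (mdeg \<mu>) \<le> j - n a"
      using v that by (auto simp: L_filt_def algebra_simps)
    from L_part_weyl_mult[OF this, of "A a b" "n a - n' b" 1] A b that show ?thesis
      by (simp add: symbol_matrix_def)
  qed
  then show ?thesis
    using b by (simp add: mat_map_def finsum_UNIV weyl_algebra_def poly_S_def L_part_sum)
qed

end

end

theory Submission
  imports Defs "HOL-Library.Function_Algebras"
begin

text \<open>
  Graded Betti numbers count the generators of \<^emph>\<open>any\<close> graded minimal free resolution, so it suffices
  to exhibit over each of the three rings such a resolution with the same ranks \<open>r\<close> and the same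
  shifts \<open>n\<close>. Over \<open>S\<close> the hypothesis provides the complex of symbols of \<open>\<Phi>\<close>. Over \<open>D\<^sup>(\<^sup>h\<^sup>)\<close> the
  homogenized matrices form a resolution of \<open>M\<^sup>(\<^sup>h\<^sup>)\<close>. Over \<open>S[h]\<close> the symbols of the homogenized matrices
  are the homogenized symbols (\<open>symbol_homogenize_matrix\<close>), and they form a resolution of \<open>gr M\<^sup>(\<^sup>h\<^sup>)\<close>.

  The exactness of the last two complexes rests on strictness (\<open>strict_lift\<close>): an element of \<open>L\<close>-degree
  at most \<open>j\<close> in the image of a matrix of the resolution is the image of an element of \<open>L\<close>-degree at
  most \<open>j\<close>. Indeed, if a preimage has larger degree, its leading symbol is a cycle of the complex of
  symbols; that complex is exact, so the leading symbol is a boundary, and subtracting a lift of this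
  boundary lowers the degree of the preimage without changing its image. Now setting \<open>h = 1\<close> identifies
  the homogeneous vectors of degree \<open>d\<close> over \<open>D\<^sup>(\<^sup>h\<^sup>)\<close> with the vectors in \<open>L\<^sub>d\<close> over \<open>D\<close>, and a strict lift
  over \<open>D\<close> homogenizes to a lift over \<open>D\<^sup>(\<^sup>h\<^sup>)\<close>; this is \<open>exact_hom\<close>. The argument applies to the relations
  \<open>\<partial>\<^sub>i x\<^sub>i - x\<^sub>i \<partial>\<^sub>i = c\<close> over \<open>k\<close> and \<open>\<partial>\<^sub>i x\<^sub>i - x\<^sub>i \<partial>\<^sub>i = c h\<^sup>2\<close> over \<open>k[h]\<close> for every \<open>c\<close>: the value \<open>c = 1\<close> gives
  \<open>D\<^sup>(\<^sup>h\<^sup>)\<close>, and the value \<open>c = 0\<close>, applied to the symbols, gives \<open>S[h]\<close>. At the end of the complex, the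
  strictness of the first homogenized matrix (\<open>strict_hom\<close>) shows that its symbols generate the
  relations of \<open>gr M\<^sup>(\<^sup>h\<^sup>)\<close>.

  The uniqueness of graded Betti numbers (\<open>graded_betti_eq\<close>) is the usual one. Two resolutions
  of the same module are compared by chain maps \<open>T\<close> and \<open>U\<close> whose composites are homotopic to the
  identity. By minimality the homotopy disappears modulo the augmentation ideal, so \<open>T\<close> and \<open>U\<close> become
  inverse to each other in each degree, and the traces of \<open>TU\<close> and \<open>UT\<close> compare the numbers of
  generators. Each module is presented for this purpose as the quotient of a graded free module by a graded
  submodule (\<open>graded_quotient\<close>).
\<close>

section \<open>Vectors and matrices over a ring\<close>

lemma sum_fun_apply: "(\<Sum>a\<in>A. f a) x = (\<Sum>a\<in>A. f a x)"
  for f :: "'i \<Rightarrow> 'b \<Rightarrow> 'c::comm_monoid_add"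
  by (induction A rule: infinite_finite_induct) auto

definition finvecs :: "nat \<Rightarrow> (nat \<Rightarrow> 'a::zero) set" where
  "finvecs r = {v. \<forall>a\<ge>r. v a = 0}"

lemma finvecs_closed [simp, intro]:
  "0 \<in> finvecs r"
  "v \<in> finvecs r \<Longrightarrow> w \<in> finvecs r \<Longrightarrow> v + w \<in> finvecs r"
  "v \<in> finvecs r \<Longrightarrow> w \<in> finvecs r \<Longrightarrow> v - w \<in> finvecs r"
  for v w :: "nat \<Rightarrow> 'a::ab_group_add"
  by (simp_all add: finvecs_def)

lemma finvecs_sum: "(\<And>a. a \<in> A \<Longrightarrow> f a \<in> finvecs r) \<Longrightarrow> (\<Sum>a\<in>A. f a) \<in> finvecs r"
  for f :: "'i \<Rightarrow> nat \<Rightarrow> 'a::ab_group_add"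
  by (simp add: finvecs_def sum_fun_apply)

text \<open>
  The rings of this development all have a whole type as carrier and its group structure as addition, so
  that vectors can be added as functions and \<open>\<Oplus>\<close> is an ordinary sum.
\<close>

locale total_ring =
  fixes R :: "('a::ab_group_add, 'r) ring_scheme" (structure)
  assumes ring_R: "ring R"
    and carrier_R: "carrier R = UNIV" and add_R: "add R = (+)" and zero_R: "\<zero> = 0"
begin

lemma mult_add_left: "(x + y) \<otimes> z = x \<otimes> z + y \<otimes> z"
  and mult_add_right: "z \<otimes> (x + y) = z \<otimes> x + z \<otimes> y"
  and mult_assoc: "(x \<otimes> y) \<otimes> z = x \<otimes> (y \<otimes> z)"
  and mult_one: "\<one> \<otimes> x = x" "x \<otimes> \<one> = x"
  and mult_0: "0 \<otimes> x = 0" "x \<otimes> 0 = 0"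
proof -
  interpret ring R by (rule ring_R)
  show "(x + y) \<otimes> z = x \<otimes> z + y \<otimes> z" "z \<otimes> (x + y) = z \<otimes> x + z \<otimes> y"
    using l_distr[of x y z] r_distr[of x y z] by (simp_all add: carrier_R add_R)
  show "(x \<otimes> y) \<otimes> z = x \<otimes> (y \<otimes> z)" using m_assoc[of x y z] by (simp add: carrier_R)
  show "\<one> \<otimes> x = x" "x \<otimes> \<one> = x" by (simp_all add: carrier_R)
  show "0 \<otimes> x = 0" "x \<otimes> 0 = 0" using l_null[of x] r_null[of x] by (simp_all add: carrier_R zero_R)
qed

lemma mult_diff_left: "(x - y) \<otimes> z = x \<otimes> z - y \<otimes> z"
  using mult_add_left[of "x - y" y z] by (simp add: algebra_simps)

lemma mult_sum_left: "(\<Sum>a\<in>A. f a) \<otimes> z = (\<Sum>a\<in>A. f a \<otimes> z)"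
  by (induction A rule: infinite_finite_induct) (simp_all add: mult_0 mult_add_left)

lemma mult_sum_right: "z \<otimes> (\<Sum>a\<in>A. f a) = (\<Sum>a\<in>A. z \<otimes> f a)"
  by (induction A rule: infinite_finite_induct) (simp_all add: mult_0 mult_add_right)

lemma free_carrier_eq: "free_carrier R r = finvecs r"
  by (simp add: free_carrier_def finvecs_def carrier_R zero_R)

lemma mat_map_apply: "mat_map R r s A v b = (if b < s then \<Sum>a<r. v a \<otimes> A a b else 0)"
  by (simp add: mat_map_def finsum_UNIV carrier_R add_R zero_R)

lemma mat_map_finvecs [simp]: "mat_map R r s A v \<in> finvecs s"
  by (simp add: finvecs_def mat_map_apply)

lemma mat_map_add: "mat_map R r s A (v + w) = mat_map R r s A v + mat_map R r s A w"
  by (rule ext) (simp add: mat_map_apply mult_add_left sum.distrib)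

lemma mat_map_diff: "mat_map R r s A (v - w) = mat_map R r s A v - mat_map R r s A w"
  by (rule ext) (simp add: mat_map_apply mult_diff_left sum_subtractf)

lemma mat_map_0: "mat_map R r s A 0 = 0"
  by (rule ext) (simp add: mat_map_apply mult_0)

lemma mat_map_sum: "mat_map R r s A (\<Sum>i\<in>I. f i) = (\<Sum>i\<in>I. mat_map R r s A (f i))"
proof
  fix b
  have "(\<Sum>a<r. (\<Sum>i\<in>I. f i a) \<otimes> A a b) = (\<Sum>i\<in>I. \<Sum>a<r. f i a \<otimes> A a b)"
    unfolding mult_sum_left by (rule sum.swap)
  then show "mat_map R r s A (\<Sum>i\<in>I. f i) b = (\<Sum>i\<in>I. mat_map R r s A (f i)) b"
    by (simp add: mat_map_apply sum_fun_apply)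
qed

lemma mat_map_rows_add: "mat_map R r s (\<lambda>a. A a + B a) v = mat_map R r s A v + mat_map R r s B v"
  by (rule ext) (simp add: mat_map_apply mult_add_right sum.distrib)

lemma mat_map_cong:
  assumes "\<And>a b. a < r \<Longrightarrow> b < s \<Longrightarrow> A a b = B a b" "\<And>a. a < r \<Longrightarrow> v a = w a"
  shows "mat_map R r s A v = mat_map R r s B w"
  using assms by (intro ext) (simp add: mat_map_apply)

lemma mat_map_comp:
  "mat_map R s u B (mat_map R r s A v) = mat_map R r u (\<lambda>a. mat_map R s u B (A a)) v"
proof
  fix c
  have "(\<Sum>b<s. (\<Sum>a<r. v a \<otimes> A a b) \<otimes> B b c) = (\<Sum>a<r. v a \<otimes> (\<Sum>b<s. A a b \<otimes> B b c))"
    unfolding mult_sum_left mult_sum_right mult_assoc by (rule sum.swap)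
  then show "mat_map R s u B (mat_map R r s A v) c = mat_map R r u (\<lambda>a. mat_map R s u B (A a)) v c"
    by (simp add: mat_map_apply)
qed

definition unitvec :: "nat \<Rightarrow> nat \<Rightarrow> 'a" where
  "unitvec a b = (if a = b then \<one> else 0)"

lemma unitvec_finvecs [simp]: "a < r \<Longrightarrow> unitvec a \<in> finvecs r"
  by (auto simp: unitvec_def finvecs_def)

lemma mat_map_identity: "v \<in> finvecs r \<Longrightarrow> mat_map R r r unitvec v = v"
proof
  fix b assume v: "v \<in> finvecs r"
  have "v a \<otimes> unitvec a b = (if a = b then v a else 0)" for a
    by (simp add: unitvec_def mult_one mult_0)
  then show "mat_map R r r unitvec v b = v b"
    using v by (simp add: mat_map_apply finvecs_def)
qed

lemma mat_map_unitvec: "a < r \<Longrightarrow> mat_map R r s A (unitvec a) b = (if b < s then A a b else 0)"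
proof -
  have "unitvec a c \<otimes> A c b = (if a = c then A c b else 0)" for c
    by (simp add: unitvec_def mult_one mult_0)
  then show "a < r \<Longrightarrow> ?thesis" by (simp add: mat_map_apply)
qed

end

section \<open>Comparison of graded complexes\<close>

text \<open>
  \<open>hp d\<close> is the homogeneous part of degree \<open>d\<close>, and \<open>eps\<close> is the augmentation to the ground field, whose
  kernel contains all homogeneous elements of nonzero degree.
\<close>

locale connected_graded_ring = total_ring R
  for R :: "('a::ab_group_add, 'r) graded_ring_scheme" (structure) +
  fixes hp :: "int \<Rightarrow> 'a \<Rightarrow> 'a"
    and eps :: "'a \<Rightarrow> 'k::field_char_0"
  assumes hp_mem: "hp d x \<in> rgrade R d"
    and hp_id: "x \<in> rgrade R d \<Longrightarrow> hp d x = x"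
    and hp_add: "hp d (x + y) = hp d x + hp d y"
    and hp_mult: "y \<in> rgrade R d' \<Longrightarrow> hp (d + d') (x \<otimes> y) = hp d x \<otimes> y"
    and eps_add: "eps (x + y) = eps x + eps y"
    and eps_mult: "eps (x \<otimes> y) = eps x * eps y"
    and eps_one: "eps \<one> = 1"
    and eps_graded: "x \<in> rgrade R d \<Longrightarrow> d \<noteq> 0 \<Longrightarrow> eps x = 0"
begin

lemma hp_0: "hp d 0 = 0"
  using hp_add[of d 0 0] by simp

lemma eps_0: "eps 0 = 0"
  using eps_add[of 0 0] by simp

lemma eps_diff: "eps (x - y) = eps x - eps y"
  using eps_add[of "x - y" y] by simp

lemma hp_sum: "hp d (\<Sum>a\<in>A. f a) = (\<Sum>a\<in>A. hp d (f a))"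
  by (induction A rule: infinite_finite_induct) (simp_all add: hp_0 hp_add)

lemma eps_sum: "eps (\<Sum>a\<in>A. f a) = (\<Sum>a\<in>A. eps (f a))"
  by (induction A rule: infinite_finite_induct) (simp_all add: eps_0 eps_add)

text \<open>
  Since the entries of a homogeneous matrix shift degrees, the homogeneous parts of a preimage are
  preimages of the homogeneous parts; this is why comparison maps can be chosen homogeneous.
\<close>

lemma mat_map_hp:
  assumes "\<And>a b. a < s \<Longrightarrow> b < r \<Longrightarrow> D a b \<in> rgrade R (n a - m b)"
  shows "mat_map R s r D (\<lambda>a. hp (d - n a) (y a)) b = (if b < r then hp (d - m b) (mat_map R s r D y b) else 0)"
proof -
  have "hp (d - n a) (y a) \<otimes> D a b = hp (d - m b) (y a \<otimes> D a b)" if "a < s" "b < r" for a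
    using hp_mult[OF assms[OF that], of "d - n a" "y a"] by simp
  then show ?thesis by (simp add: mat_map_apply hp_sum)
qed

lemma lift_homogeneous:
  assumes "\<And>a b. a < s \<Longrightarrow> b < r \<Longrightarrow> D a b \<in> rgrade R (n a - m b)"
    and "mat_map R s r D y = x" and "\<And>b. b < r \<Longrightarrow> x b \<in> rgrade R (d - m b)"
  shows "\<exists>y'\<in>finvecs s. (\<forall>a<s. y' a \<in> rgrade R (d - n a)) \<and> mat_map R s r D y' = x"
proof (intro bexI conjI allI impI)
  let ?y = "\<lambda>a. if a < s then hp (d - n a) (y a) else 0"
  show "?y \<in> finvecs s" by (simp add: finvecs_def)
  show "?y a \<in> rgrade R (d - n a)" if "a < s" for a using that by (simp add: hp_mem)
  have "mat_map R s r D ?y = mat_map R s r D (\<lambda>a. hp (d - n a) (y a))"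
    by (rule mat_map_cong) auto
  also have "\<dots> = x"
  proof
    fix b
    have "x b = 0" if "\<not> b < r" using assms(2) that by (auto simp: mat_map_apply)
    then show "mat_map R s r D (\<lambda>a. hp (d - n a) (y a)) b = x b"
      using mat_map_hp[of s r D n m d y b] assms by (simp add: hp_id)
  qed
  finally show "mat_map R s r D ?y = x" .
qed

definition homogeneous_matrix ::
  "nat \<Rightarrow> (nat \<Rightarrow> int) \<Rightarrow> nat \<Rightarrow> (nat \<Rightarrow> int) \<Rightarrow> (nat \<Rightarrow> nat \<Rightarrow> 'a) \<Rightarrow> bool" where
  "homogeneous_matrix r m s n T \<longleftrightarrow> (\<forall>a<r. T a \<in> finvecs s \<and> (\<forall>b<s. T a b \<in> rgrade R (m a - n b)))"

lemma homogeneous_mat_map: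
  assumes x: "\<And>a. a < r \<Longrightarrow> x a \<in> rgrade R (d - m a)" and T: "homogeneous_matrix r m s n T" and b: "b < s"
  shows "mat_map R r s T x b \<in> rgrade R (d - n b)"
proof -
  have "mat_map R r s T x b = mat_map R r s T (\<lambda>a. hp (d - m a) (x a)) b"
    using x by (simp add: mat_map_apply hp_id)
  also have "\<dots> = hp (d - n b) (mat_map R r s T x b)"
    using T b by (subst mat_map_hp[of r s T m n]) (auto simp: homogeneous_matrix_def)
  finally show ?thesis by (metis hp_mem)
qed

text \<open>
  A map between the free modules of two resolutions in the same homological position; \<open>Z\<close> and \<open>Z'\<close> are
  the syzygies in that position. Compatibility with the differentials enters only through the
  syzygies, which makes it possible to construct the maps one position at a time.
\<close>

definition comparison_map ::
  "nat \<Rightarrow> (nat \<Rightarrow> int) \<Rightarrow> (nat \<Rightarrow> 'a) set \<Rightarrow> nat \<Rightarrow> (nat \<Rightarrow> int) \<Rightarrow> (nat \<Rightarrow> 'a) set \<Rightarrow> (nat \<Rightarrow> nat \<Rightarrow> 'a) \<Rightarrow> bool" where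
  "comparison_map r m Z r' m' Z' T \<longleftrightarrow>
     homogeneous_matrix r m r' m' T \<and> (\<forall>v\<in>Z. mat_map R r r' T v \<in> Z')"

text \<open>
  On the syzygies \<open>Z\<close>, the composite \<open>UT\<close> is the identity up to a term that factors through the next
  differential \<open>D\<close>. The second conjunct is what remains of \<open>UT = id\<close> modulo the augmentation ideal; the
  diagonal entries suffice for computing traces.
\<close>

definition homotopy_inverse ::
  "nat \<Rightarrow> (nat \<Rightarrow> 'a) set \<Rightarrow> nat \<Rightarrow> (nat \<Rightarrow> nat \<Rightarrow> 'a) \<Rightarrow> nat \<Rightarrow> (nat \<Rightarrow> nat \<Rightarrow> 'a) \<Rightarrow> (nat \<Rightarrow> nat \<Rightarrow> 'a) \<Rightarrow> bool" where
  "homotopy_inverse r Z s D r' T U \<longleftrightarrow>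
     (\<exists>h. \<forall>v\<in>Z. mat_map R r' r U (mat_map R r r' T v) - v = mat_map R s r D (mat_map R r s h v)) \<and>
     (\<forall>a<r. (\<Sum>c<r'. eps (T a c) * eps (U c a)) = 1)"

text \<open>
  One step of the comparison theorem: the rows of \<open>D\<close> are syzygies, \<open>T\<close> maps them to syzygies of the other
  resolution, and by exactness these have homogeneous preimages under \<open>D'\<close>.
\<close>

lemma comparison_map_lift:
  assumes T: "comparison_map r m Z r' m' Z' T"
    and D: "homogeneous_matrix s n r m D" "\<And>a. a < s \<Longrightarrow> D a \<in> Z"
    and D': "homogeneous_matrix s' n' r' m' D'" "Z' \<subseteq> range (mat_map R s' r' D')"
  shows "\<exists>T'. comparison_map s n {v \<in> finvecs s. mat_map R s r D v = 0}
       s' n' {v \<in> finvecs s'. mat_map R s' r' D' v = 0} T' \<and>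
     (\<forall>a<s. mat_map R s' r' D' (T' a) = mat_map R r r' T (D a))"
proof -
  have hT: "homogeneous_matrix r m r' m' T" using T by (simp add: comparison_map_def)
  have "\<exists>y\<in>finvecs s'. (\<forall>b<s'. y b \<in> rgrade R (n a - n' b)) \<and> mat_map R s' r' D' y = mat_map R r r' T (D a)"
    if a: "a < s" for a
  proof -
    have "mat_map R r r' T (D a) \<in> Z'" using T D(2)[OF a] by (simp add: comparison_map_def)
    with D'(2) obtain y where y: "mat_map R s' r' D' y = mat_map R r r' T (D a)" by (metis rangeE subsetD)
    show ?thesis
    proof (rule lift_homogeneous[OF _ y])
      show "D' b c \<in> rgrade R (n' b - m' c)" if "b < s'" "c < r'" for b c
        using D' that by (simp add: homogeneous_matrix_def)
      show "mat_map R r r' T (D a) b \<in> rgrade R (n a - m' b)" if "b < r'" for b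
        by (rule homogeneous_mat_map[OF _ hT that]) (use D a in \<open>simp add: homogeneous_matrix_def\<close>)
    qed
  qed
  then obtain T' where T': "\<And>a. a < s \<Longrightarrow> T' a \<in> finvecs s' \<and> (\<forall>b<s'. T' a b \<in> rgrade R (n a - n' b))
     \<and> mat_map R s' r' D' (T' a) = mat_map R r r' T (D a)"
    by metis
  have "mat_map R s' r' D' (mat_map R s s' T' v) = 0" if v: "mat_map R s r D v = 0" for v
  proof -
    have "mat_map R s' r' D' (mat_map R s s' T' v) = mat_map R s r' (\<lambda>a. mat_map R r r' T (D a)) v"
      unfolding mat_map_comp by (rule mat_map_cong) (use T' in auto)
    also have "\<dots> = 0" unfolding mat_map_comp[symmetric] v by (rule mat_map_0)
    finally show ?thesis .
  qed
  with T' show ?thesis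
    by (intro exI[of _ T']) (auto simp: comparison_map_def homogeneous_matrix_def)
qed

text \<open>
  The homotopy passes to the next position: on the basis vectors, \<open>U'T' - id - hD\<close> is killed by
  \<open>D\<close>, hence by exactness it is \<open>Eg\<close> for the next part \<open>g\<close> of the homotopy. Since the entries of \<open>D\<close> and \<open>E\<close>
  have augmentation zero, \<open>U'T'\<close> is the identity modulo the augmentation ideal.
\<close>

lemma homotopy_inverse_step:
  assumes TU: "homotopy_inverse r Z s D r' T U"
    and D: "\<And>a. a < s \<Longrightarrow> D a \<in> Z" "Z \<subseteq> finvecs r" "\<And>a b. a < s \<Longrightarrow> b < r \<Longrightarrow> eps (D a b) = 0"
    and E: "{v \<in> finvecs s. mat_map R s r D v = 0} \<subseteq> mat_map R t s E ` finvecs t"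
      "\<And>a b. a < t \<Longrightarrow> b < s \<Longrightarrow> eps (E a b) = 0"
    and T': "\<And>a. a < s \<Longrightarrow> mat_map R s' r' D' (T' a) = mat_map R r r' T (D a)"
    and U': "\<And>a. a < s' \<Longrightarrow> mat_map R s r D (U' a) = mat_map R r' r U (D' a)"
  shows "homotopy_inverse s {v \<in> finvecs s. mat_map R s r D v = 0} t E s' T' U'"
proof -
  from TU obtain h where h: "\<And>v. v \<in> Z \<Longrightarrow>
     mat_map R r' r U (mat_map R r r' T v) - v = mat_map R s r D (mat_map R r s h v)"
    unfolding homotopy_inverse_def by blast
  have DU: "mat_map R s r D (mat_map R s' s U' v) = mat_map R r' r U (mat_map R s' r' D' v)" for v
    unfolding mat_map_comp by (rule mat_map_cong) (use U' in auto)
  have Du: "mat_map R s r D (unitvec a) = D a" if a: "a < s" for a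
  proof
    show "mat_map R s r D (unitvec a) b = D a b" for b
      using mat_map_unitvec[OF a, of r D b] D(1)[OF a] D(2) by (auto simp: finvecs_def)
  qed
  let ?k = "\<lambda>a. mat_map R s' s U' (T' a) - unitvec a - mat_map R r s h (D a)"
  have "\<exists>y\<in>finvecs t. mat_map R t s E y = ?k a" if a: "a < s" for a
  proof -
    have "mat_map R s r D (?k a)
        = mat_map R r' r U (mat_map R r r' T (D a)) - D a - mat_map R s r D (mat_map R r s h (D a))"
      by (simp add: mat_map_diff DU T' a Du)
    also have "\<dots> = 0" using h[OF D(1)[OF a]] by simp
    finally have "?k a \<in> {v \<in> finvecs s. mat_map R s r D v = 0}" using a by simp
    then show ?thesis using E(1) by (metis (no_types, lifting) imageE subsetD)
  qed
  then obtain g where g: "\<And>a. a < s \<Longrightarrow> mat_map R t s E (g a) = ?k a" by metis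
  have "mat_map R s' s U' (mat_map R s s' T' v) - v = mat_map R t s E (mat_map R s t g v)"
    if v: "v \<in> finvecs s" "mat_map R s r D v = 0" for v
  proof -
    have "mat_map R s' s U' (mat_map R s s' T' v)
       = mat_map R s s (\<lambda>a. mat_map R t s E (g a) + (unitvec a + mat_map R r s h (D a))) v"
      unfolding mat_map_comp by (rule mat_map_cong) (simp_all only: g, simp_all)
    also have "\<dots> = mat_map R t s E (mat_map R s t g v) + (v + mat_map R r s h (mat_map R s r D v))"
      unfolding mat_map_rows_add mat_map_comp[symmetric] mat_map_identity[OF v(1)] ..
    finally show ?thesis by (simp add: v(2) mat_map_0)
  qed
  moreover have "(\<Sum>c<s'. eps (T' a c) * eps (U' c a)) = 1" if a: "a < s" for a
  proof -
    have "eps (mat_map R t s E (g a) a) = 0" "eps (mat_map R r s h (D a) a) = 0"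
      using a E(2) D(3) by (simp_all add: mat_map_apply eps_sum eps_mult)
    then have "eps (mat_map R s' s U' (T' a) a) = eps (unitvec a a)"
      using g[OF a] by (simp add: eps_diff)
    then show ?thesis using a by (simp add: mat_map_apply eps_sum eps_mult unitvec_def eps_one)
  qed
  ultimately show ?thesis unfolding homotopy_inverse_def by blast
qed

text \<open>
  The augmentations of \<open>T\<close> and \<open>U\<close> vanish between generators of different degrees. So the numbers of
  generators of degree \<open>j\<close> are the traces of the two products of the degree-\<open>j\<close> blocks, which agree; in
  characteristic zero the numbers agree as well.
\<close>

lemma homotopy_inverse_count:
  assumes T: "comparison_map r m Z r' m' Z' T" "homotopy_inverse r Z s D r' T U"
    and U: "comparison_map r' m' Z' r m Z U" "homotopy_inverse r' Z' s' D' r U T"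
  shows "card {a. a < r \<and> m a = j} = card {b. b < r' \<and> m' b = j}"
proof -
  let ?A = "{a. a < r \<and> m a = j}" and ?B = "{b. b < r' \<and> m' b = j}"
  have z: "eps (T a b) = 0" if "a < r" "b < r'" "m a \<noteq> m' b" for a b
    using T(1) that eps_graded[of "T a b" "m a - m' b"] by (simp add: comparison_map_def homogeneous_matrix_def)
  have z': "eps (U b a) = 0" if "a < r" "b < r'" "m a \<noteq> m' b" for a b
    using U(1) that eps_graded[of "U b a" "m' b - m a"] by (simp add: comparison_map_def homogeneous_matrix_def)
  have A: "(\<Sum>b\<in>?B. eps (T a b) * eps (U b a)) = 1" if "a \<in> ?A" for a
  proof -
    have "(\<Sum>b\<in>?B. eps (T a b) * eps (U b a)) = (\<Sum>b<r'. eps (T a b) * eps (U b a))"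
    proof (rule sum.mono_neutral_left)
      show "\<forall>b\<in>{..<r'} - ?B. eps (T a b) * eps (U b a) = 0"
      proof
        fix b assume "b \<in> {..<r'} - ?B"
        then have "eps (T a b) = 0" using that by (intro z) auto
        then show "eps (T a b) * eps (U b a) = 0" by simp
      qed
    qed auto
    then show ?thesis using T(2) that by (simp add: homotopy_inverse_def)
  qed
  have B: "(\<Sum>a\<in>?A. eps (T a b) * eps (U b a)) = 1" if "b \<in> ?B" for b
  proof -
    have "(\<Sum>a\<in>?A. eps (T a b) * eps (U b a)) = (\<Sum>a<r. eps (U b a) * eps (T a b))"
      unfolding mult.commute[of "eps (T _ b)"]
    proof (rule sum.mono_neutral_left)
      show "\<forall>a\<in>{..<r} - ?A. eps (U b a) * eps (T a b) = 0" using z' that by auto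
    qed auto
    then show ?thesis using U(2) that by (simp add: homotopy_inverse_def)
  qed
  have "of_nat (card ?A) = (\<Sum>a\<in>?A. \<Sum>b\<in>?B. eps (T a b) * eps (U b a))" using A by simp
  also have "\<dots> = (\<Sum>b\<in>?B. \<Sum>a\<in>?A. eps (T a b) * eps (U b a))" by (rule sum.swap)
  also have "\<dots> = of_nat (card ?B)" using B by simp
  finally show ?thesis by simp
qed

end

section \<open>Uniqueness of graded Betti numbers\<close>

text \<open>
  A graded module \<open>N\<close> presented by a surjection \<open>q\<close> from the graded free module with generators in degrees
  \<open>\<mu>\<close>. The last assumption says that the kernel of \<open>q\<close> is a graded submodule. The module and grading
  axioms for \<open>N\<close> are inherited from the free module, so that they need not be checked for each \<open>N\<close>.
\<close>

locale graded_quotient = connected_graded_ring R hp eps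
  for R :: "('a::ab_group_add, 'r) graded_ring_scheme" (structure) and hp and eps :: "'a \<Rightarrow> 'k::field_char_0" +
  fixes N :: "('a, 'b, 'm) graded_module_scheme" and p :: nat and \<mu> :: "nat \<Rightarrow> int" and q :: "(nat \<Rightarrow> 'a) \<Rightarrow> 'b"
  assumes q_onto: "carrier N = q ` finvecs p"
    and q_add: "v \<in> finvecs p \<Longrightarrow> w \<in> finvecs p \<Longrightarrow> q (v + w) = q v \<oplus>\<^bsub>N\<^esub> q w"
    and q_smult: "v \<in> finvecs p \<Longrightarrow> q (\<lambda>b. c \<otimes> v b) = c \<odot>\<^bsub>N\<^esub> q v"
    and q_zero: "q 0 = \<zero>\<^bsub>N\<^esub>"
    and q_grade: "mgrade N d = q ` {v \<in> finvecs p. \<forall>b<p. v b \<in> rgrade R (d - \<mu> b)}"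
    and q_ker: "v \<in> finvecs p \<Longrightarrow> q v = \<zero>\<^bsub>N\<^esub> \<Longrightarrow> q (\<lambda>b. hp (d - \<mu> b) (v b)) = \<zero>\<^bsub>N\<^esub>"
begin

lemma abelian_monoid_N: "abelian_monoid N"
proof (rule abelian_monoidI)
  have c: "(\<forall>x\<in>carrier N. P x) \<longleftrightarrow> (\<forall>v\<in>finvecs p. P (q v))" for P by (simp add: q_onto)
  show "x \<oplus>\<^bsub>N\<^esub> y \<in> carrier N" if "x \<in> carrier N" "y \<in> carrier N" for x y
    using that by (auto simp: q_onto q_add[symmetric])
  show "\<zero>\<^bsub>N\<^esub> \<in> carrier N" by (auto simp: q_onto q_zero[symmetric])
  show "(x \<oplus>\<^bsub>N\<^esub> y) \<oplus>\<^bsub>N\<^esub> z = x \<oplus>\<^bsub>N\<^esub> (y \<oplus>\<^bsub>N\<^esub> z)" if "x \<in> carrier N" "y \<in> carrier N" "z \<in> carrier N" for x y z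
    using that by (auto simp: q_onto q_add[symmetric] add.assoc)
  show "\<zero>\<^bsub>N\<^esub> \<oplus>\<^bsub>N\<^esub> x = x" if "x \<in> carrier N" for x
    using that by (auto simp: q_onto q_add[symmetric] q_zero[symmetric])
  show "x \<oplus>\<^bsub>N\<^esub> y = y \<oplus>\<^bsub>N\<^esub> x" if "x \<in> carrier N" "y \<in> carrier N" for x y
    using that by (auto simp: q_onto q_add[symmetric] add.commute)
qed

lemma abelian_group_N: "abelian_group N"
proof -
  interpret abelian_monoid N by (rule abelian_monoid_N)
  have inv: "\<exists>y\<in>carrier N. y \<oplus>\<^bsub>N\<^esub> x = \<zero>\<^bsub>N\<^esub>" if x: "x \<in> carrier N" for x
  proof -
    from x obtain v where v: "v \<in> finvecs p" "x = q v" by (auto simp: q_onto)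
    have "q (0 - v) \<oplus>\<^bsub>N\<^esub> q v = q ((0 - v) + v)"
      using v(1) by (subst q_add) (auto simp: finvecs_def)
    then have "q (0 - v) \<oplus>\<^bsub>N\<^esub> x = \<zero>\<^bsub>N\<^esub>" by (simp add: v(2) q_zero)
    moreover have "q (0 - v) \<in> carrier N"
      unfolding q_onto using v(1) by (intro imageI finvecs_closed(3) finvecs_closed(1))
    ultimately show ?thesis by blast
  qed
  show ?thesis
    by (rule abelian_groupI[OF _ _ _ _ _ inv]) (auto simp: a_ac)
qed

lemma q_sum:
  assumes "\<And>a. a \<in> A \<Longrightarrow> f a \<in> finvecs p"
  shows "q (\<Sum>a\<in>A. f a) = (\<Oplus>\<^bsub>N\<^esub>a\<in>A. q (f a))"
  using assms
proof (induction A rule: infinite_finite_induct)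
  interpret abelian_monoid N by (rule abelian_monoid_N)
  {
    case (infinite A)
    then show ?case by (simp only: sum.infinite finsum_infinite q_zero not_False_eq_True)
  next
    case empty
    then show ?case by (simp only: sum.empty finsum_empty q_zero)
  next
    case (insert a A)
    have "q (f a + sum f A) = q (f a) \<oplus>\<^bsub>N\<^esub> q (sum f A)"
      using insert by (intro q_add finvecs_sum) auto
    with insert show ?case by (subst finsum_insert) (auto simp: q_onto)
  }
qed

lemma q_diff_eq_0:
  assumes "v \<in> finvecs p" "w \<in> finvecs p"
  shows "q (v - w) = \<zero>\<^bsub>N\<^esub> \<longleftrightarrow> q v = q w"
proof
  assume a: "q (v - w) = \<zero>\<^bsub>N\<^esub>"
  have "q v = q ((v - w) + w)" by simp
  also have "\<dots> = q (0 + w)" using assms by (subst (1 2) q_add) (auto simp: a q_zero)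
  finally show "q v = q w" by simp
next
  assume a: "q v = q w"
  have "q (v - w) = q (v + (0 - w))" by simp
  also have "\<dots> = q (w + (0 - w))" using assms by (subst (1 2) q_add) (auto simp: a intro: finvecs_closed(3)[OF finvecs_closed(1)] simp del: diff_0)
  finally show "q (v - w) = \<zero>\<^bsub>N\<^esub>" by (simp add: q_zero)
qed

text \<open>
  Linear combinations of elements of \<open>N\<close> are images of linear combinations of representatives, so that
  statements about \<open>gen_map\<close> reduce to matrix calculations.
\<close>

lemma gen_map_q:
  assumes "\<And>a. a < r \<Longrightarrow> W a \<in> finvecs p" "\<And>a. a < r \<Longrightarrow> q (W a) = e a"
  shows "gen_map N r e v = q (mat_map R r p W v)"
proof -
  interpret abelian_monoid N by (rule abelian_monoid_N)
  have W: "(\<lambda>b. c \<otimes> W a b) \<in> finvecs p" if "a < r" for a c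
    using assms(1)[OF that] by (simp add: finvecs_def mult_0)
  have "mat_map R r p W v = (\<Sum>a<r. (\<lambda>b. v a \<otimes> W a b))"
  proof
    fix b
    have "v a \<otimes> W a b = 0" if "a < r" "\<not> b < p" for a
      using assms(1)[OF that(1)] that(2) by (simp add: finvecs_def mult_0)
    then show "mat_map R r p W v b = (\<Sum>a<r. (\<lambda>b. v a \<otimes> W a b)) b"
      by (simp add: mat_map_apply sum_fun_apply)
  qed
  then have "q (mat_map R r p W v) = (\<Oplus>\<^bsub>N\<^esub>a\<in>{..<r}. q (\<lambda>b. v a \<otimes> W a b))"
    using q_sum[of "{..<r}" "\<lambda>a b. v a \<otimes> W a b"] W by simp
  also have "\<dots> = gen_map N r e v" unfolding gen_map_def
  proof (rule finsum_cong')
    show "(\<lambda>a. v a \<odot>\<^bsub>N\<^esub> e a) \<in> {..<r} \<rightarrow> carrier N"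
    proof
      fix a assume "a \<in> {..<r}"
      then have "v a \<odot>\<^bsub>N\<^esub> e a = q (\<lambda>b. v a \<otimes> W a b)" using assms by (simp add: q_smult)
      then show "v a \<odot>\<^bsub>N\<^esub> e a \<in> carrier N" using W \<open>a \<in> _\<close> by (simp add: q_onto)
    qed
  qed (use assms in \<open>simp_all add: q_smult\<close>)
  finally show ?thesis ..
qed

lemma homogeneous_representatives:
  assumes "\<And>a. a < r \<Longrightarrow> e a \<in> mgrade N (m a)"
  shows "\<exists>W. \<forall>a<r. W a \<in> finvecs p \<and> q (W a) = e a \<and> (\<forall>b<p. W a b \<in> rgrade R (m a - \<mu> b))"
proof -
  have e: "e a \<in> q ` {v \<in> finvecs p. \<forall>b<p. v b \<in> rgrade R (m a - \<mu> b)}" if "a < r" for a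
    using that assms by (simp only: q_grade)
  define W where "W a = inv_into {v \<in> finvecs p. \<forall>b<p. v b \<in> rgrade R (m a - \<mu> b)} q (e a)" for a
  have "W a \<in> {v \<in> finvecs p. \<forall>b<p. v b \<in> rgrade R (m a - \<mu> b)} \<and> q (W a) = e a" if "a < r" for a
    using inv_into_into[OF e[OF that]] f_inv_into_f[OF e[OF that]] by (simp only: W_def simp_thms)
  then show ?thesis by (intro exI[of _ W]) simp
qed

text \<open>
  A homogeneous element of \<open>N\<close> is a linear combination of homogeneous generators with homogeneous
  coefficients of the right degrees: the homogeneous parts of arbitrary coefficients work, because
  passing to homogeneous parts preserves the kernel of \<open>q\<close>.
\<close>

lemma gen_map_lift_homogeneous:
  assumes e: "\<And>a. a < r \<Longrightarrow> e a \<in> mgrade N (m a)" and onto: "gen_map N r e ` finvecs r = carrier N"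
    and x: "x \<in> mgrade N d"
  shows "\<exists>y\<in>finvecs r. (\<forall>a<r. y a \<in> rgrade R (d - m a)) \<and> gen_map N r e y = x"
proof -
  obtain W where W: "\<And>a. a < r \<Longrightarrow> W a \<in> finvecs p" "\<And>a. a < r \<Longrightarrow> q (W a) = e a"
    "\<And>a b. a < r \<Longrightarrow> b < p \<Longrightarrow> W a b \<in> rgrade R (m a - \<mu> b)"
    using homogeneous_representatives[of r e m, OF e] by auto
  note gen = gen_map_q[of r W e, OF W(1,2)]
  from x obtain u where u: "u \<in> finvecs p" "\<And>b. b < p \<Longrightarrow> u b \<in> rgrade R (d - \<mu> b)" "x = q u"
    by (auto simp: q_grade)
  then have "x \<in> gen_map N r e ` finvecs r" by (simp add: onto q_onto)
  then obtain v where v: "q (mat_map R r p W v) = q u" by (auto simp: gen u)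
  let ?y = "\<lambda>a. if a < r then hp (d - m a) (v a) else 0"
  have "(\<lambda>b. hp (d - \<mu> b) ((mat_map R r p W v - u) b)) = mat_map R r p W ?y - u"
  proof
    fix b
    have h: "hp d (x - y) = hp d x - hp d y" for d x y using hp_add[of d "x - y" y] by simp
    have "mat_map R r p W ?y b = mat_map R r p W (\<lambda>a. hp (d - m a) (v a)) b"
      by (simp add: mat_map_apply)
    also have "\<dots> = (if b < p then hp (d - \<mu> b) (mat_map R r p W v b) else 0)"
      by (rule mat_map_hp) (rule W)
    finally show "hp (d - \<mu> b) ((mat_map R r p W v - u) b) = (mat_map R r p W ?y - u) b"
      using u by (cases "b < p") (auto simp: h hp_id finvecs_def mat_map_apply hp_0)
  qed
  moreover have "q (mat_map R r p W v - u) = \<zero>\<^bsub>N\<^esub>"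
    using q_diff_eq_0[OF mat_map_finvecs u(1)] v by blast
  then have "q (\<lambda>b. hp (d - \<mu> b) ((mat_map R r p W v - u) b)) = \<zero>\<^bsub>N\<^esub>"
    by (rule q_ker[OF finvecs_closed(3)[OF mat_map_finvecs u(1)]])
  ultimately have "q (mat_map R r p W ?y) = q u"
    using u by (simp only: q_diff_eq_0 mat_map_finvecs)
  then show ?thesis
    by (intro bexI[of _ ?y]) (simp_all add: gen u finvecs_def hp_mem)
qed

lemma gen_map_comp:
  assumes e: "\<And>a. a < r' \<Longrightarrow> e' a \<in> carrier N"
    and T: "\<And>a. a < r \<Longrightarrow> gen_map N r' e' (T a) = e a"
  shows "gen_map N r' e' (mat_map R r r' T v) = gen_map N r e v"
proof -
  define W where "W a = inv_into (finvecs p) q (e' a)" for a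
  have W: "\<And>a. a < r' \<Longrightarrow> W a \<in> finvecs p" "\<And>a. a < r' \<Longrightarrow> q (W a) = e' a"
    using e by (simp_all add: W_def q_onto inv_into_into f_inv_into_f)
  note gen = gen_map_q[of r' W e', OF W]
  have "gen_map N r e v = q (mat_map R r p (\<lambda>a. mat_map R r' p W (T a)) v)"
    by (rule gen_map_q) (use T in \<open>simp_all add: gen\<close>)
  then show ?thesis by (simp add: gen mat_map_comp)
qed

lemma gen_map_diff_eq_0:
  assumes e: "\<And>a. a < r \<Longrightarrow> e a \<in> carrier N"
  shows "gen_map N r e (v - w) = \<zero>\<^bsub>N\<^esub> \<longleftrightarrow> gen_map N r e v = gen_map N r e w"
proof -
  define W where "W a = inv_into (finvecs p) q (e a)" for a
  have W: "\<And>a. a < r \<Longrightarrow> W a \<in> finvecs p" "\<And>a. a < r \<Longrightarrow> q (W a) = e a"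
    using e by (simp_all add: W_def q_onto inv_into_into f_inv_into_f)
  note gen = gen_map_q[of r W e, OF W]
  show ?thesis by (simp add: gen mat_map_diff q_diff_eq_0)
qed

lemma gen_map_unitvec:
  assumes "\<And>a. a < r \<Longrightarrow> e a \<in> carrier N" "a < r"
  shows "gen_map N r e (unitvec a) = e a"
proof -
  define W where "W a = inv_into (finvecs p) q (e a)" for a
  have W: "\<And>a. a < r \<Longrightarrow> W a \<in> finvecs p" "\<And>a. a < r \<Longrightarrow> q (W a) = e a"
    using assms(1) by (simp_all add: W_def q_onto inv_into_into f_inv_into_f)
  have "mat_map R r p W (unitvec a) = W a"
    using W(1)[OF assms(2)] by (intro ext) (auto simp: mat_map_unitvec[OF assms(2)] finvecs_def)
  then show ?thesis using W assms by (simp add: gen_map_q[of r W e, OF W])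
qed

fun syz :: "(nat \<Rightarrow> nat) \<Rightarrow> (nat \<Rightarrow> nat \<Rightarrow> nat \<Rightarrow> 'a) \<Rightarrow> (nat \<Rightarrow> 'b) \<Rightarrow> nat \<Rightarrow> (nat \<Rightarrow> 'a) set" where
  "syz r \<Phi> e 0 = {v \<in> finvecs (r 0). gen_map N (r 0) e v = \<zero>\<^bsub>N\<^esub>}"
| "syz r \<Phi> e (Suc i) = {v \<in> finvecs (r (Suc i)). mat_map R (r (Suc i)) (r i) (\<Phi> (Suc i)) v = 0}"

text \<open>
  Comparison of two resolutions of \<open>N\<close>, by induction on the homological position. The rows
  of the differentials are assumed to vanish beyond the ranks, so that they are vectors of the free modules.
\<close>

lemma comparison_exists:
  assumes res: "graded_min_free_resolution R N r m \<Phi> e" and res': "graded_min_free_resolution R N r' m' \<Phi>' e'"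
    and trim: "\<And>i a. a < r (Suc i) \<Longrightarrow> \<Phi> (Suc i) a \<in> finvecs (r i)" "\<And>i a. a < r' (Suc i) \<Longrightarrow> \<Phi>' (Suc i) a \<in> finvecs (r' i)"
  shows "\<exists>T U. comparison_map (r i) (m i) (syz r \<Phi> e i) (r' i) (m' i) (syz r' \<Phi>' e' i) T \<and>
     comparison_map (r' i) (m' i) (syz r' \<Phi>' e' i) (r i) (m i) (syz r \<Phi> e i) U \<and>
     homotopy_inverse (r i) (syz r \<Phi> e i) (r (Suc i)) (\<Phi> (Suc i)) (r' i) T U \<and>
     homotopy_inverse (r' i) (syz r' \<Phi>' e' i) (r' (Suc i)) (\<Phi>' (Suc i)) (r i) U T"
proof -
  have fz: "(\<lambda>_. 0) = (0 :: nat \<Rightarrow> 'a)" by (simp add: zero_fun_def)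
  have facts: "\<And>a. a < r 0 \<Longrightarrow> e a \<in> mgrade N (m 0 a)" "\<And>a. a < r 0 \<Longrightarrow> e a \<in> carrier N"
    "gen_map N (r 0) e ` finvecs (r 0) = carrier N"
    "\<And>i. homogeneous_matrix (r (Suc i)) (m (Suc i)) (r i) (m i) (\<Phi> (Suc i))"
    "\<And>i. syz r \<Phi> e i = mat_map R (r (Suc i)) (r i) (\<Phi> (Suc i)) ` finvecs (r (Suc i))"
    "\<And>i a. a < r (Suc i) \<Longrightarrow> \<Phi> (Suc i) a \<in> syz r \<Phi> e i"
    "\<And>i a b. a < r (Suc i) \<Longrightarrow> b < r i \<Longrightarrow> eps (\<Phi> (Suc i) a b) = 0"
    "\<And>i. syz r \<Phi> e i \<subseteq> finvecs (r i)"
    if res: "graded_min_free_resolution R N r m \<Phi> e" and trim: "\<And>i a. a < r (Suc i) \<Longrightarrow> \<Phi> (Suc i) a \<in> finvecs (r i)"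
    for r m \<Phi> e
  proof -
    show "e a \<in> mgrade N (m 0 a)" if "a < r 0" for a using res that by (simp add: graded_min_free_resolution_def)
    show "e a \<in> carrier N" if "a < r 0" for a
      using res that by (simp add: graded_min_free_resolution_def free_resolution_def)
    show "gen_map N (r 0) e ` finvecs (r 0) = carrier N"
      using res by (simp add: graded_min_free_resolution_def free_resolution_def free_carrier_eq)
    show "homogeneous_matrix (r (Suc i)) (m (Suc i)) (r i) (m i) (\<Phi> (Suc i))" for i
      using res trim by (simp add: graded_min_free_resolution_def homogeneous_matrix_def)
    show s: "syz r \<Phi> e i = mat_map R (r (Suc i)) (r i) (\<Phi> (Suc i)) ` finvecs (r (Suc i))" for i
      by (cases i) (use res in \<open>simp_all add: graded_min_free_resolution_def free_resolution_def free_carrier_eq zero_R fz\<close>)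
    show "\<Phi> (Suc i) a \<in> syz r \<Phi> e i" if "a < r (Suc i)" for i a
    proof -
      have "\<Phi> (Suc i) a = mat_map R (r (Suc i)) (r i) (\<Phi> (Suc i)) (unitvec a)"
        using trim[OF that] by (intro ext) (auto simp: mat_map_unitvec[OF that] finvecs_def)
      then show ?thesis using that by (simp add: s)
    qed
    show "eps (\<Phi> (Suc i) a b) = 0" if "a < r (Suc i)" "b < r i" for i a b
    proof (cases "m (Suc i) a = m i b")
      case True
      have "\<Phi> (Suc i) a b \<in> rgrade R (m (Suc i) a - m i b)"
        and "\<Phi> (Suc i) a b \<in> rgrade R 0 \<longrightarrow> \<Phi> (Suc i) a b = \<zero>"
        using res that unfolding graded_min_free_resolution_def by blast+
      then have "\<Phi> (Suc i) a b = 0" by (simp add: True zero_R)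
      then show ?thesis by (simp add: eps_0)
    next
      case False
      then show ?thesis using res that eps_graded[of "\<Phi> (Suc i) a b" "m (Suc i) a - m i b"]
        by (simp add: graded_min_free_resolution_def)
    qed
    show "syz r \<Phi> e i \<subseteq> finvecs (r i)" for i by (cases i) auto
  qed
  note f = facts[OF res trim(1), simplified] and f' = facts[OF res' trim(2), simplified]
  have base: "\<exists>T. homogeneous_matrix (r 0) (m 0) (r' 0) (m' 0) T \<and> (\<forall>a<r 0. gen_map N (r' 0) e' (T a) = e a)"
    if f: "\<And>a. a < r 0 \<Longrightarrow> e a \<in> mgrade N (m 0 a)"
      and f': "\<And>a. a < r' 0 \<Longrightarrow> e' a \<in> mgrade N (m' 0 a)" "gen_map N (r' 0) e' ` finvecs (r' 0) = carrier N"
    for r m e r' m' e'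
  proof -
    have "\<forall>a. a < r 0 \<longrightarrow> (\<exists>y\<in>finvecs (r' 0). (\<forall>b<r' 0. y b \<in> rgrade R (m 0 a - m' 0 b)) \<and> gen_map N (r' 0) e' y = e a)"
      using gen_map_lift_homogeneous[OF f' f] by blast
    then obtain T where "\<forall>a. a < r 0 \<longrightarrow> T a\<in>finvecs (r' 0) \<and> (\<forall>b<r' 0. T a b \<in> rgrade R (m 0 a - m' 0 b)) \<and> gen_map N (r' 0) e' (T a) = e a"
      by metis
    then show ?thesis by (auto simp: homogeneous_matrix_def)
  qed
  have base_homotopy: "homotopy_inverse (r 0) (syz r \<Phi> e 0) (r 1) (\<Phi> 1) (r' 0) T U"
    if e: "\<And>a. a < r 0 \<Longrightarrow> e a \<in> carrier N" and e': "\<And>a. a < r' 0 \<Longrightarrow> e' a \<in> carrier N"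
      and ex: "syz r \<Phi> e 0 = mat_map R (r 1) (r 0) (\<Phi> 1) ` finvecs (r 1)"
      and min: "\<And>a b. a < r 1 \<Longrightarrow> b < r 0 \<Longrightarrow> eps (\<Phi> 1 a b) = 0"
      and T: "\<And>a. a < r 0 \<Longrightarrow> gen_map N (r' 0) e' (T a) = e a"
      and U: "\<And>a. a < r' 0 \<Longrightarrow> gen_map N (r 0) e (U a) = e' a"
    for r \<Phi> e r' e' T U
  proof -
    let ?U = "mat_map R (r' 0) (r 0) U" and ?D = "mat_map R (r 1) (r 0) (\<Phi> 1)"
    have "\<exists>y. ?D y = ?U (T a) - unitvec a" if a: "a < r 0" for a
    proof -
      have "gen_map N (r 0) e (?U (T a)) = gen_map N (r 0) e (unitvec a)"
        using gen_map_comp[of "r 0" e "r' 0" U e' "T a"] e U T a by (simp add: gen_map_unitvec)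
      then have "?U (T a) - unitvec a \<in> syz r \<Phi> e 0"
        using a e by (simp add: gen_map_diff_eq_0)
      then show ?thesis unfolding ex by (auto simp del: One_nat_def)
    qed
    then obtain h where h: "\<And>a. a < r 0 \<Longrightarrow> ?D (h a) = ?U (T a) - unitvec a" by metis
    have "?U (mat_map R (r 0) (r' 0) T v) - v = ?D (mat_map R (r 0) (r 1) h v)" if v: "v \<in> finvecs (r 0)" for v
    proof -
      have "?U (mat_map R (r 0) (r' 0) T v) = mat_map R (r 0) (r 0) (\<lambda>a. ?D (h a) + unitvec a) v"
        unfolding mat_map_comp by (rule mat_map_cong) (simp_all only: h, simp_all)
      also have "\<dots> = ?D (mat_map R (r 0) (r 1) h v) + v"
        unfolding mat_map_rows_add mat_map_comp[symmetric] mat_map_identity[OF v] ..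
      finally show ?thesis by simp
    qed
    moreover have "(\<Sum>c<r' 0. eps (T a c) * eps (U c a)) = 1" if a: "a < r 0" for a
    proof -
      have "eps (?D (h a) a) = 0" using a min by (simp add: mat_map_apply eps_sum eps_mult)
      then have "eps (?U (T a) a) = eps (unitvec a a)" using h[OF a] by (simp add: eps_diff)
      then show ?thesis using a by (simp add: mat_map_apply eps_sum eps_mult unitvec_def eps_one)
    qed
    ultimately show ?thesis unfolding homotopy_inverse_def by auto
  qed
  show ?thesis
  proof (induction i)
    case 0
    obtain T where T: "homogeneous_matrix (r 0) (m 0) (r' 0) (m' 0) T" "\<And>a. a < r 0 \<Longrightarrow> gen_map N (r' 0) e' (T a) = e a"
      using base[of r e m r' e' m'] f f' by blast
    obtain U where U: "homogeneous_matrix (r' 0) (m' 0) (r 0) (m 0) U" "\<And>a. a < r' 0 \<Longrightarrow> gen_map N (r 0) e (U a) = e' a"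
      using base[of r' e' m' r e m] f f' by blast
    have "comparison_map (r 0) (m 0) (syz r \<Phi> e 0) (r' 0) (m' 0) (syz r' \<Phi>' e' 0) T"
      using T f'(2) by (simp add: comparison_map_def gen_map_comp)
    moreover have "comparison_map (r' 0) (m' 0) (syz r' \<Phi>' e' 0) (r 0) (m 0) (syz r \<Phi> e 0) U"
      using U f(2) by (simp add: comparison_map_def gen_map_comp)
    moreover have "homotopy_inverse (r 0) (syz r \<Phi> e 0) (r 1) (\<Phi> 1) (r' 0) T U"
      using f(5)[of 0] f(7)[of _ 0] by (intro base_homotopy[of r e r' e']) (use f f' T U in \<open>simp_all\<close>)
    moreover have "homotopy_inverse (r' 0) (syz r' \<Phi>' e' 0) (r' 1) (\<Phi>' 1) (r 0) U T"
      using f'(5)[of 0] f'(7)[of _ 0] by (intro base_homotopy[of r' e' r e]) (use f f' T U in \<open>simp_all\<close>)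
    ultimately show ?case by auto
  next
    case (Suc i)
    then obtain T U where
      T: "comparison_map (r i) (m i) (syz r \<Phi> e i) (r' i) (m' i) (syz r' \<Phi>' e' i) T" and
      U: "comparison_map (r' i) (m' i) (syz r' \<Phi>' e' i) (r i) (m i) (syz r \<Phi> e i) U" and
      TU: "homotopy_inverse (r i) (syz r \<Phi> e i) (r (Suc i)) (\<Phi> (Suc i)) (r' i) T U" and
      UT: "homotopy_inverse (r' i) (syz r' \<Phi>' e' i) (r' (Suc i)) (\<Phi>' (Suc i)) (r i) U T"
      by blast
    obtain T' where T': "comparison_map (r (Suc i)) (m (Suc i)) (syz r \<Phi> e (Suc i)) (r' (Suc i)) (m' (Suc i)) (syz r' \<Phi>' e' (Suc i)) T'"
      "\<And>a. a < r (Suc i) \<Longrightarrow> mat_map R (r' (Suc i)) (r' i) (\<Phi>' (Suc i)) (T' a) = mat_map R (r i) (r' i) T (\<Phi> (Suc i) a)"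
      using comparison_map_lift[OF T f(4) _ f'(4)] f(6) f'(5) by auto
    obtain U' where U': "comparison_map (r' (Suc i)) (m' (Suc i)) (syz r' \<Phi>' e' (Suc i)) (r (Suc i)) (m (Suc i)) (syz r \<Phi> e (Suc i)) U'"
      "\<And>a. a < r' (Suc i) \<Longrightarrow> mat_map R (r (Suc i)) (r i) (\<Phi> (Suc i)) (U' a) = mat_map R (r' i) (r i) U (\<Phi>' (Suc i) a)"
      using comparison_map_lift[OF U f'(4) _ f(4)] f'(6) f(5) by auto
    have "homotopy_inverse (r (Suc i)) (syz r \<Phi> e (Suc i)) (r (Suc (Suc i))) (\<Phi> (Suc (Suc i))) (r' (Suc i)) T' U'"
      using f(5)[of "Suc i"] homotopy_inverse_step[OF TU f(6) f(8) f(7) _ f(7) T'(2) U'(2)] by auto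
    moreover have "homotopy_inverse (r' (Suc i)) (syz r' \<Phi>' e' (Suc i)) (r' (Suc (Suc i))) (\<Phi>' (Suc (Suc i))) (r (Suc i)) U' T'"
      using f'(5)[of "Suc i"] homotopy_inverse_step[OF UT f'(6) f'(8) f'(7) _ f'(7) U'(2) T'(2)] by auto
    ultimately show ?case using T'(1) U'(1) by blast
  qed
qed

text \<open>
  A resolution does not restrict the matrix entries beyond the ranks; they can be replaced by zero.
\<close>

lemma graded_min_free_resolution_trim:
  assumes "graded_min_free_resolution R N r m \<Phi> e"
  shows "graded_min_free_resolution R N r m (\<lambda>i a b. if b < r (i - 1) then \<Phi> i a b else 0) e"
proof -
  have "mat_map R (r (Suc i)) (r i) (\<lambda>a b. if b < r i then \<Phi> (Suc i) a b else 0)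
      = mat_map R (r (Suc i)) (r i) (\<Phi> (Suc i))" for i
    by (intro ext) (simp add: mat_map_apply)
  note m = this
  have "mat_map R (r 1) (r 0) (\<lambda>a b. if b < r 0 then \<Phi> 1 a b else 0) = mat_map R (r 1) (r 0) (\<Phi> 1)"
    unfolding One_nat_def by (rule m)
  with m assms show ?thesis
    by (simp add: graded_min_free_resolution_def free_resolution_def del: One_nat_def)
qed

lemma gen_map_basis:
  assumes "v \<in> finvecs p"
  shows "gen_map N p (\<lambda>a. q (unitvec a)) v = q v"
  by (subst gen_map_q[where W = unitvec]) (simp_all add: mat_map_identity[OF assms])

theorem graded_betti_eq:
  assumes "graded_min_free_resolution R N r m \<Phi> e"
  shows "graded_betti R N i j = card {a. a < r i \<and> m i a = j}"
  unfolding graded_betti_def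
proof (rule the_equality)
  show "\<exists>r' m' \<Phi> e. graded_min_free_resolution R N r' m' \<Phi> e \<and>
     card {a. a < r i \<and> m i a = j} = card {a. a < r' i \<and> m' i a = j}"
    using assms by blast
next
  fix c
  assume "\<exists>r m \<Phi> e. graded_min_free_resolution R N r m \<Phi> e \<and> c = card {a. a < r i \<and> m i a = j}"
  then obtain r' m' \<Phi>' e' where res': "graded_min_free_resolution R N r' m' \<Phi>' e'"
    and c: "c = card {a. a < r' i \<and> m' i a = j}" by blast
  let ?trim = "\<lambda>r (\<Phi> :: nat \<Rightarrow> nat \<Rightarrow> nat \<Rightarrow> 'a) i a b. if b < (r (i - 1) :: nat) then \<Phi> i a b else 0"
  have "\<exists>T U. comparison_map (r' i) (m' i) (syz r' (?trim r' \<Phi>') e' i) (r i) (m i) (syz r (?trim r \<Phi>) e i) T \<and>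
     comparison_map (r i) (m i) (syz r (?trim r \<Phi>) e i) (r' i) (m' i) (syz r' (?trim r' \<Phi>') e' i) U \<and>
     homotopy_inverse (r' i) (syz r' (?trim r' \<Phi>') e' i) (r' (Suc i)) (?trim r' \<Phi>' (Suc i)) (r i) T U \<and>
     homotopy_inverse (r i) (syz r (?trim r \<Phi>) e i) (r (Suc i)) (?trim r \<Phi> (Suc i)) (r' i) U T"
    by (rule comparison_exists[OF graded_min_free_resolution_trim[OF res'] graded_min_free_resolution_trim[OF assms]])
      (simp_all add: finvecs_def)
  then show "c = card {a. a < r i \<and> m i a = j}"
    unfolding c by (elim exE conjE) (rule homotopy_inverse_count)
qed

end

section \<open>Cokernels of homogeneous matrices\<close>

context connected_graded_ring
begin

lemma coset_graded_free:
  "K +>\<^bsub>graded_free_module R r m\<^esub> v = (\<lambda>k. k + v) ` K"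
  unfolding a_r_coset_def' by (auto simp: graded_free_module_def add_R plus_fun_def)

lemma graded_quotient_cokernel:
  assumes A: "\<And>a b. a < s \<Longrightarrow> b < r \<Longrightarrow> A a b \<in> rgrade R (l a - m b)"
  defines "K \<equiv> mat_map R s r A ` free_carrier R s"
  shows "graded_quotient R hp eps (quotient_module (graded_free_module R r m) K) r m
    (\<lambda>v. K +>\<^bsub>graded_free_module R r m\<^esub> v)"
    and "v \<in> finvecs r \<Longrightarrow> K +>\<^bsub>graded_free_module R r m\<^esub> v = K \<longleftrightarrow> v \<in> K"
proof -
  let ?G = "graded_free_module R r m"
  have K_def': "K = mat_map R s r A ` finvecs s" by (simp add: K_def free_carrier_eq)
  have K0: "0 \<in> K" unfolding K_def' using mat_map_0 by (metis finvecs_closed(1) imageI)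
  have Kadd: "v + w \<in> K" if "v \<in> K" "w \<in> K" for v w
    using that unfolding K_def' by (auto simp: mat_map_add[symmetric])
  have Kdiff: "v - w \<in> K" if "v \<in> K" "w \<in> K" for v w
    using that unfolding K_def' by (auto simp: mat_map_diff[symmetric])
  have Ksm: "(\<lambda>b. c \<otimes> v b) \<in> K" if v: "v \<in> K" for c v
  proof -
    from v obtain y where y: "y \<in> finvecs s" "v = mat_map R s r A y" unfolding K_def' by blast
    have "(\<lambda>b. c \<otimes> v b) = mat_map R s r A (\<lambda>a. c \<otimes> y a)"
      by (rule ext) (simp add: y(2) mat_map_apply mult_sum_right mult_assoc mult_0)
    moreover have "(\<lambda>a. c \<otimes> y a) \<in> finvecs s" using y(1) by (simp add: finvecs_def mult_0)
    ultimately show ?thesis unfolding K_def' by blast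
  qed
  have mem: "x \<in> K +>\<^bsub>?G\<^esub> v \<longleftrightarrow> x - v \<in> K" for x v
    unfolding coset_graded_free by (metis (no_types, lifting) add_diff_cancel diff_add_cancel imageE imageI)
  have eq: "K +>\<^bsub>?G\<^esub> v = K +>\<^bsub>?G\<^esub> w" if "v - w \<in> K" for v w
  proof (rule Set.set_eqI)
    fix x
    have "x - v \<in> K \<longleftrightarrow> x - w \<in> K"
      using Kadd[OF _ that, of "x - v"] Kdiff[OF _ that, of "x - w"] by (auto simp: algebra_simps)
    then show "x \<in> K +>\<^bsub>?G\<^esub> v \<longleftrightarrow> x \<in> K +>\<^bsub>?G\<^esub> w" by (simp only: mem)
  qed
  have addG: "y \<oplus>\<^bsub>?G\<^esub> z = y + z" for y z
    by (simp add: graded_free_module_def add_R fun_eq_iff)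
  have q0: "K +>\<^bsub>?G\<^esub> 0 = K" by (rule Set.set_eqI) (simp only: mem diff_0_right)
  show *: "K +>\<^bsub>?G\<^esub> v = K \<longleftrightarrow> v \<in> K" for v
  proof
    assume "K +>\<^bsub>?G\<^esub> v = K"
    moreover have "v \<in> K +>\<^bsub>?G\<^esub> v" unfolding mem using K0 by simp
    ultimately show "v \<in> K" by simp
  next
    assume "v \<in> K"
    then show "K +>\<^bsub>?G\<^esub> v = K" using eq[of v 0] q0 by simp
  qed
  show "graded_quotient R hp eps (quotient_module ?G K) r m (\<lambda>v. K +>\<^bsub>?G\<^esub> v)"
  proof (rule graded_quotient.intro[OF connected_graded_ring_axioms], unfold_locales)
    show "carrier (quotient_module ?G K) = (\<lambda>v. K +>\<^bsub>?G\<^esub> v) ` finvecs r"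
      by (auto simp: quotient_module_def A_RCOSETS_def' graded_free_module_def[of R r m] free_carrier_eq)
  next
    fix v w :: "nat \<Rightarrow> 'a"
    have "(K +>\<^bsub>?G\<^esub> v) <+>\<^bsub>?G\<^esub> (K +>\<^bsub>?G\<^esub> w) = K +>\<^bsub>?G\<^esub> (v + w)"
    proof (intro equalityI subsetI)
      fix x assume "x \<in> (K +>\<^bsub>?G\<^esub> v) <+>\<^bsub>?G\<^esub> (K +>\<^bsub>?G\<^esub> w)"
      then obtain y z where "y \<in> K +>\<^bsub>?G\<^esub> v" "z \<in> K +>\<^bsub>?G\<^esub> w" "x = y + z"
        unfolding set_add_def' addG UN_iff singleton_iff by blast
      then have yz: "y - v \<in> K" "z - w \<in> K" "x = y + z" by (simp_all only: mem)
      have e: "x - (v + w) = (y - v) + (z - w)" by (simp add: yz(3) algebra_simps)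
      show "x \<in> K +>\<^bsub>?G\<^esub> (v + w)" unfolding mem e by (rule Kadd[OF yz(1,2)])
    next
      fix x assume "x \<in> K +>\<^bsub>?G\<^esub> (v + w)"
      then have "x - w \<in> K +>\<^bsub>?G\<^esub> v" unfolding mem by (simp add: algebra_simps)
      moreover have "w \<in> K +>\<^bsub>?G\<^esub> w" unfolding mem using K0 by simp
      moreover have "x = (x - w) \<oplus>\<^bsub>?G\<^esub> w" by (simp add: addG)
      ultimately show "x \<in> (K +>\<^bsub>?G\<^esub> v) <+>\<^bsub>?G\<^esub> (K +>\<^bsub>?G\<^esub> w)" unfolding set_add_def' by blast
    qed
    then show "K +>\<^bsub>?G\<^esub> (v + w) = (K +>\<^bsub>?G\<^esub> v) \<oplus>\<^bsub>quotient_module ?G K\<^esub> (K +>\<^bsub>?G\<^esub> w)"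
      by (simp add: quotient_module_def)
  next
    fix v :: "nat \<Rightarrow> 'a" and c
    have "K +>\<^bsub>?G\<^esub> (c \<odot>\<^bsub>?G\<^esub> x) = K +>\<^bsub>?G\<^esub> (\<lambda>b. c \<otimes> v b)" if x: "x \<in> K +>\<^bsub>?G\<^esub> v" for x
    proof -
      have "c \<odot>\<^bsub>?G\<^esub> x - (\<lambda>b. c \<otimes> v b) = (\<lambda>b. c \<otimes> (x - v) b)"
      proof
        fix b
        show "(c \<odot>\<^bsub>?G\<^esub> x - (\<lambda>b. c \<otimes> v b)) b = c \<otimes> (x - v) b"
          using mult_add_right[of c "x b - v b" "v b"] by (simp add: graded_free_module_def)
      qed
      then show ?thesis using Ksm[of "x - v" c] x unfolding mem by (intro eq) simp
    qed
    moreover have "v \<in> K +>\<^bsub>?G\<^esub> v" unfolding mem using K0 by simp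
    ultimately have "(\<Union>x\<in>K +>\<^bsub>?G\<^esub> v. K +>\<^bsub>?G\<^esub> (c \<odot>\<^bsub>?G\<^esub> x)) = K +>\<^bsub>?G\<^esub> (\<lambda>b. c \<otimes> v b)" by blast
    then show "K +>\<^bsub>?G\<^esub> (\<lambda>b. c \<otimes> v b) = c \<odot>\<^bsub>quotient_module ?G K\<^esub> (K +>\<^bsub>?G\<^esub> v)"
      by (simp add: quotient_module_def)
  next
    show "K +>\<^bsub>?G\<^esub> 0 = \<zero>\<^bsub>quotient_module ?G K\<^esub>" by (simp add: quotient_module_def q0)
  next
    show "mgrade (quotient_module ?G K) d = (\<lambda>v. K +>\<^bsub>?G\<^esub> v) ` {v \<in> finvecs r. \<forall>b<r. v b \<in> rgrade R (d - m b)}" for d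
      by (simp add: quotient_module_def graded_free_module_def[of R r m] free_carrier_eq)
  next
    fix v d assume "K +>\<^bsub>?G\<^esub> v = \<zero>\<^bsub>quotient_module ?G K\<^esub>"
    then have "v \<in> K" by (simp add: quotient_module_def *)
    then obtain y where y: "y \<in> finvecs s" "v = mat_map R s r A y" unfolding K_def' by blast
    have "mat_map R s r A (\<lambda>a. hp (d - l a) (y a)) = (\<lambda>b. hp (d - m b) (v b))"
    proof
      fix b
      have "mat_map R s r A (\<lambda>a. hp (d - l a) (y a)) b = (if b < r then hp (d - m b) (mat_map R s r A y b) else 0)"
        by (rule mat_map_hp) (rule A)
      moreover have "v b = 0" if "\<not> b < r" unfolding y(2) mat_map_apply using that by simp
      ultimately show "mat_map R s r A (\<lambda>a. hp (d - l a) (y a)) b = hp (d - m b) (v b)"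
        unfolding y(2)[symmetric] using hp_0 by presburger
    qed
    moreover have "(\<lambda>a. hp (d - l a) (y a)) \<in> finvecs s" using y(1) by (simp add: finvecs_def hp_0)
    ultimately have "(\<lambda>b. hp (d - m b) (v b)) \<in> K" unfolding K_def' by (rule image_eqI[OF sym])
    then show "K +>\<^bsub>?G\<^esub> (\<lambda>b. hp (d - m b) (v b)) = \<zero>\<^bsub>quotient_module ?G K\<^esub>"
      by (simp add: quotient_module_def *)
  qed
qed

end

section \<open>The rings as deformations of polynomial rings\<close>

abbreviation lk where "lk \<equiv> Poly_Mapping.lookup"

(* Exponents are pairs; statements about all exponents are used for a whole pair at a time. *)
declare split_paired_All [simp del] split_paired_Ex [simp del]

lemma lookup_mapp_zero: "f \<mu> 0 = 0 \<Longrightarrow> lk (Poly_Mapping.mapp f P) \<mu> = f \<mu> (lk P \<mu>)"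
  by (simp add: lookup_mapp when_def in_keys_iff)

text \<open>
  The commutator \<open>t = \<partial>\<^sub>i x\<^sub>i - x\<^sub>i \<partial>\<^sub>i\<close> is kept as a parameter: \<open>t = 1\<close> is the Weyl algebra and \<open>t = 0\<close> the
  polynomial ring, and for \<open>t = c h\<^sup>2\<close> over \<open>k[h]\<close> the values \<open>c = 1\<close> and \<open>c = 0\<close> give \<open>D\<^sup>(\<^sup>h\<^sup>)\<close> and \<open>S[h]\<close>. Statements
  about \<open>weyl_at\<close> and \<open>hom_weyl_at\<close> therefore cover the noncommutative and the commutative case together.
\<close>

definition weyl_at :: "'r::comm_ring_1 \<Rightarrow> ('n::finite expo \<Rightarrow>\<^sub>0 'r) ring" where
  "weyl_at t = \<lparr>carrier = UNIV, monoid.mult = weyl_mult t, one = 1, zero = 0, add = (+)\<rparr>"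

definition hgrade :: "int \<Rightarrow> ('n::finite expo \<Rightarrow>\<^sub>0 'k::field_char_0 poly) set" where
  "hgrade d = {P. \<forall>\<mu> l. coeff (lk P \<mu>) l \<noteq> 0 \<longrightarrow> int (l + mdeg \<mu>) = d}"

definition hom_weyl_at :: "'k::field_char_0 \<Rightarrow> ('n::finite expo \<Rightarrow>\<^sub>0 'k poly) graded_ring" where
  "hom_weyl_at c = \<lparr>carrier = UNIV, monoid.mult = weyl_mult (monom c 2), one = 1, zero = 0, add = (+), rgrade = hgrade\<rparr>"

lemma mono_mult_weyl_0_t: "mono_mult_weyl 0 p q = mon (p + q)"
proof -
  let ?K = "{\<kappa>. \<forall>i. lk \<kappa> i \<le> lk (snd p) i \<and> lk \<kappa> i \<le> lk (fst q) i}"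
  have fin: "finite ?K"
    by (rule finite_subset[OF _ finite_lookup_le[of "lk (snd p)"]]) auto
  have z: "vdeg \<kappa> \<noteq> 0" if "\<kappa> \<noteq> 0" for \<kappa> :: "'a \<Rightarrow>\<^sub>0 nat"
    using that by (auto simp: vdeg_def intro: poly_mapping_eqI)
  have "mono_mult_weyl 0 p q = (\<Sum>\<kappa>\<in>?K. if \<kappa> = 0 then mon (p + q) else (0 :: 'a expo \<Rightarrow>\<^sub>0 'b))"
    unfolding mono_mult_weyl_def
  proof (rule sum.cong)
    fix \<kappa>
    show "Poly_Mapping.single (fst p + (fst q - \<kappa>), snd p - \<kappa> + snd q) (weyl_coeff 0 (snd p) (fst q) \<kappa>)
       = (if \<kappa> = 0 then mon (p + q) else (0 :: 'a expo \<Rightarrow>\<^sub>0 'b))"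
      using z[of \<kappa>] by (cases "\<kappa> = 0") (simp_all add: weyl_coeff_def vdeg_def[of 0] plus_prod_def power_0_left)
  qed simp
  then show ?thesis using fin by (simp add: sum.delta)
qed

lemma weyl_mult_0_t: "weyl_mult 0 P Q = P * Q"
proof (rule linear_ext[where P = P and f = "\<lambda>P. weyl_mult 0 P Q"])
  fix p :: "'a expo"
  show "weyl_mult 0 (mon p) Q = mon p * Q"
    by (rule linear_ext[where f = "weyl_mult 0 (mon p)"])
      (simp_all add: weyl_mult_add_right weyl_mult_cst_right distrib_left mon_cst weyl_mult_mono mono_mult_weyl_0_t mon_mult)
qed (simp_all add: weyl_mult_add_left weyl_mult_cst_left distrib_right mult.assoc)

lemma weyl_algebra_eq: "weyl_algebra = weyl_at 1"
  by (simp add: weyl_algebra_def weyl_at_def)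

lemma hom_weyl_algebra_eq: "hom_weyl_algebra = hom_weyl_at 1"
  by (simp add: hom_weyl_algebra_def hom_weyl_at_def hgrade_def fun_eq_iff)

lemma poly_Sh_eq: "(poly_Sh :: ('n::finite expo \<Rightarrow>\<^sub>0 'k::field_char_0 poly) graded_ring) = hom_weyl_at 0"
proof -
  have "(*) = (weyl_mult (monom 0 2) :: ('n expo \<Rightarrow>\<^sub>0 'k poly) \<Rightarrow> _)" by (simp add: fun_eq_iff weyl_mult_0_t)
  then show ?thesis by (simp add: poly_Sh_def hom_weyl_at_def hgrade_def fun_eq_iff)
qed

lemma total_ring_weyl:
  fixes R :: "('n::finite expo \<Rightarrow>\<^sub>0 'r::comm_ring_1, 'b) ring_scheme"
  assumes R: "carrier R = UNIV" "monoid.mult R = weyl_mult t" "one R = 1" "zero R = 0" "add R = (+)"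
  shows "total_ring R"
proof (rule total_ring.intro)
  show "ring R"
  proof (rule ringI)
    show "abelian_group R"
      by (rule abelian_groupI) (auto simp: R add_ac intro: exI[of _ "- _"] left_minus)
    show "monoid R"
      by (rule monoidI) (simp_all add: R weyl_mult_assoc weyl_mult_one)
  qed (simp_all add: R weyl_mult_add_left weyl_mult_add_right)
qed (use R in simp_all)

lemma total_ring_weyl_at: "total_ring (weyl_at t)"
  by (rule total_ring_weyl[of _ t]) (simp_all add: weyl_at_def)

lemma total_ring_poly_S: "total_ring poly_S"
  by (rule total_ring_weyl[of _ 0]) (simp_all add: poly_S_def weyl_mult_0_t fun_eq_iff)

lemma total_ring_hom_weyl_at: "total_ring (hom_weyl_at c)"
  by (rule total_ring_weyl[of _ "monom c 2"]) (simp_all add: hom_weyl_at_def)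

lemma mult_weyl_at: "x \<otimes>\<^bsub>weyl_at t\<^esub> y = weyl_mult t x y" "\<one>\<^bsub>weyl_at t\<^esub> = 1"
  by (simp_all add: weyl_at_def)

lemma mult_hom_weyl_at: "x \<otimes>\<^bsub>hom_weyl_at c\<^esub> y = weyl_mult (monom c 2) x y" "\<one>\<^bsub>hom_weyl_at c\<^esub> = 1"
  "rgrade (hom_weyl_at c) = hgrade"
  by (simp_all add: hom_weyl_at_def)

lemma mult_poly_S: "x \<otimes>\<^bsub>poly_S\<^esub> y = x * y" "\<one>\<^bsub>poly_S\<^esub> = 1"
  by (simp_all add: poly_S_def)

lemma mat_map_poly_S: "mat_map poly_S r s A v = mat_map (weyl_at 0) r s A v"
  by (rule ext) (simp only: total_ring.mat_map_apply[OF total_ring_poly_S]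
    total_ring.mat_map_apply[OF total_ring_weyl_at] mult_poly_S mult_weyl_at weyl_mult_0_t)

section \<open>The total degree\<close>

lemma coeff_sum_lookup: "coeff (lk (\<Sum>a\<in>A. f a) \<mu>) l = (\<Sum>a\<in>A. coeff (lk (f a) \<mu>) l)"
  by (simp add: lookup_sum coeff_sum)

lemma coeff_eqI: "(\<And>\<mu> l. coeff (lk P \<mu>) l = coeff (lk Q \<mu>) l) \<Longrightarrow> P = Q"
  by (intro poly_mapping_eqI poly_eqI)

definition hpart :: "int \<Rightarrow> ('n::finite expo \<Rightarrow>\<^sub>0 'k::field_char_0 poly) \<Rightarrow> ('n expo \<Rightarrow>\<^sub>0 'k poly)" where
  "hpart d = Poly_Mapping.mapp (\<lambda>\<mu> c. if int (mdeg \<mu>) \<le> d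
     then monom (coeff c (nat (d - int (mdeg \<mu>)))) (nat (d - int (mdeg \<mu>))) else 0)"

lemma coeff_hpart:
  "coeff (lk (hpart d P) \<mu>) l = (if int (l + mdeg \<mu>) = d then coeff (lk P \<mu>) l else 0)"
  unfolding hpart_def by (subst lookup_mapp_zero) auto

lemma hgradeD: "P \<in> hgrade d \<Longrightarrow> coeff (lk P \<mu>) l \<noteq> 0 \<Longrightarrow> int (l + mdeg \<mu>) = d"
  by (simp add: hgrade_def)

lemma hgrade_sum: "(\<And>a. a \<in> A \<Longrightarrow> f a \<in> hgrade d) \<Longrightarrow> (\<Sum>a\<in>A. f a) \<in> hgrade d"
  unfolding hgrade_def mem_Collect_eq coeff_sum_lookup by (meson sum.not_neutral_contains_not_neutral)

lemma hgrade_single: "Poly_Mapping.single \<mu> (monom a l) \<in> hgrade (int (l + mdeg \<mu>))"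
  by (auto simp: hgrade_def lookup_single when_def split: if_splits)

lemma hpart_mem: "hpart d P \<in> hgrade d"
  by (simp add: hgrade_def coeff_hpart)

lemma hpart_hgrade: "P \<in> hgrade d' \<Longrightarrow> hpart d P = (if d = d' then P else 0)"
  by (rule coeff_eqI) (auto simp: coeff_hpart dest: hgradeD)

lemma hpart_add: "hpart d (P + Q) = hpart d P + hpart d Q"
  by (rule coeff_eqI) (simp add: coeff_hpart lookup_add)

lemma hpart_decomposition: "\<exists>D. finite D \<and> (\<forall>d. d \<notin> D \<longrightarrow> hpart d P = 0) \<and> P = (\<Sum>d\<in>D. hpart d P)"
proof (intro exI conjI)
  let ?D = "(\<lambda>(\<mu>, l). int (l + mdeg \<mu>)) ` (SIGMA \<mu>:Poly_Mapping.keys P. {..degree (lk P \<mu>)})"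
  show "finite ?D" by auto
  have D: "int (l + mdeg \<mu>) \<in> ?D" if "coeff (lk P \<mu>) l \<noteq> 0" for \<mu> l
    using that by (intro image_eqI[of _ _ "(\<mu>, l)"]) (auto simp: in_keys_iff le_degree)
  show "\<forall>d. d \<notin> ?D \<longrightarrow> hpart d P = 0"
  proof (intro allI impI coeff_eqI)
    fix d \<mu> l assume "d \<notin> ?D"
    then show "coeff (lk (hpart d P) \<mu>) l = coeff (lk 0 \<mu>) l"
      using D[of \<mu> l] by (simp only: coeff_hpart) (auto simp del: of_nat_add)
  qed
  show "P = (\<Sum>d\<in>?D. hpart d P)"
  proof (rule coeff_eqI)
    fix \<mu> l
    have "coeff (lk (\<Sum>d\<in>?D. hpart d P) \<mu>) l = (\<Sum>d\<in>?D. if int (l + mdeg \<mu>) = d then coeff (lk P \<mu>) l else 0)"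
      unfolding coeff_sum_lookup coeff_hpart ..
    also have "\<dots> = coeff (lk P \<mu>) l"
      using \<open>finite ?D\<close> D[of \<mu> l] by (subst sum.delta') auto
    finally show "coeff (lk P \<mu>) l = coeff (lk (\<Sum>d\<in>?D. hpart d P) \<mu>) l" ..
  qed
qed

text \<open>
  Each application of the relation \<open>\<partial>\<^sub>i x\<^sub>i = x\<^sub>i \<partial>\<^sub>i + c h\<^sup>2\<close> trades two variables for \<open>h\<^sup>2\<close>, so the
  normally ordered product of monomials stays homogeneous.
\<close>

lemma mono_mult_weyl_hgrade: "mono_mult_weyl (monom c 2) p q \<in> hgrade (int (mdeg p + mdeg q))"
  unfolding mono_mult_weyl_def
proof (rule hgrade_sum)
  fix \<kappa> :: "'a \<Rightarrow>\<^sub>0 nat"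
  assume k: "\<kappa> \<in> {\<kappa>. \<forall>i. lk \<kappa> i \<le> lk (snd p) i \<and> lk \<kappa> i \<le> lk (fst q) i}"
  have v: "vdeg \<beta> = vdeg (\<beta> - \<kappa>) + vdeg \<kappa>" if "\<forall>i. lk \<kappa> i \<le> lk \<beta> i" for \<beta>
    using that by (simp add: vdeg_def lookup_minus sum.distrib[symmetric])
  have "\<exists>a. weyl_coeff (monom c 2) (snd p) (fst q) \<kappa> = monom a (2 * vdeg \<kappa>)"
    unfolding weyl_coeff_def monom_power by (simp add: of_nat_poly smult_monom del: of_nat_prod of_nat_mult)
  then obtain a where a: "weyl_coeff (monom c 2) (snd p) (fst q) \<kappa> = monom a (2 * vdeg \<kappa>)" ..
  have "mdeg p + mdeg q = 2 * vdeg \<kappa> + mdeg (fst p + (fst q - \<kappa>), snd p - \<kappa> + snd q)"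
    using k v[of "snd p"] v[of "fst q"] by (simp add: mdeg_def vdeg_plus)
  then show "Poly_Mapping.single (fst p + (fst q - \<kappa>), snd p - \<kappa> + snd q) (weyl_coeff (monom c 2) (snd p) (fst q) \<kappa>)
      \<in> hgrade (int (mdeg p + mdeg q))"
    unfolding a by (metis hgrade_single)
qed

lemma hgrade_cst_mult:
  assumes "\<And>l. coeff a l \<noteq> 0 \<Longrightarrow> int l = e" "P \<in> hgrade d"
  shows "cst a * P \<in> hgrade (e + d)"
proof -
  have "int (l + mdeg \<mu>) = e + d" if "coeff (a * lk P \<mu>) l \<noteq> 0" for \<mu> l
  proof -
    from that obtain i where "i \<le> l" "coeff a i * coeff (lk P \<mu>) (l - i) \<noteq> 0"
      unfolding coeff_mult by (meson atMost_iff sum.not_neutral_contains_not_neutral)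
    then show ?thesis using assms(1)[of i] hgradeD[OF assms(2), of \<mu> "l - i"] by auto
  qed
  then show ?thesis by (simp add: hgrade_def lookup_cst_mult)
qed

lemma weyl_mult_hgrade:
  assumes "P \<in> hgrade d" "Q \<in> hgrade d'"
  shows "weyl_mult (monom c 2) P Q \<in> hgrade (d + d')"
  unfolding weyl_mult_expand0
proof (intro hgrade_sum)
  fix p q
  have "cst (lk P p) * (cst (lk Q q) * mono_mult_weyl (monom c 2) p q)
      \<in> hgrade ((d - int (mdeg p)) + ((d' - int (mdeg q)) + int (mdeg p + mdeg q)))"
    by (intro hgrade_cst_mult mono_mult_weyl_hgrade) (use assms in \<open>auto dest: hgradeD\<close>)
  then show "cst (lk P p) * (cst (lk Q q) * mono_mult_weyl (monom c 2) p q) \<in> hgrade (d + d')" by simp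
qed

lemma hpart_weyl_mult:
  assumes "Q \<in> hgrade d'"
  shows "hpart (d + d') (weyl_mult (monom c 2) P Q) = weyl_mult (monom c 2) (hpart d P) Q"
proof -
  obtain D where D: "finite D" "\<And>d. d \<notin> D \<Longrightarrow> hpart d P = 0" "P = (\<Sum>d\<in>D. hpart d P)"
    using hpart_decomposition[of P] by blast
  have s: "hpart d (\<Sum>a\<in>A. f a) = (\<Sum>a\<in>A. hpart d (f a))" for d and A :: "int set" and f :: "_ \<Rightarrow> ('a expo \<Rightarrow>\<^sub>0 'b poly)"
    by (rule coeff_eqI) (simp add: coeff_hpart coeff_sum_lookup)
  have "hpart (d + d') (weyl_mult (monom c 2) P Q)
      = (\<Sum>i\<in>D. hpart (d + d') (weyl_mult (monom c 2) (hpart i P) Q))"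
    by (subst D(3)) (simp only: weyl_mult_sum_left s)
  also have "\<dots> = (\<Sum>i\<in>D. if d = i then weyl_mult (monom c 2) (hpart d P) Q else 0)"
    by (intro sum.cong refl) (simp add: hpart_hgrade[OF weyl_mult_hgrade[OF hpart_mem assms]])
  also have "\<dots> = weyl_mult (monom c 2) (hpart d P) Q"
    using D by (simp add: sum.delta)
  finally show ?thesis .
qed

text \<open>
  Taking the constant coefficient is multiplicative once \<open>t\<close> is sent to zero, because every correction term
  of the normally ordered product is divisible by \<open>t\<close>.
\<close>

lemma augmentation_weyl_mult:
  fixes f :: "'r::comm_ring_1 \<Rightarrow> 'k::comm_ring_1" and P Q :: "'n::finite expo \<Rightarrow>\<^sub>0 'r"
  assumes f: "\<And>x y. f (x + y) = f x + f y" "\<And>x y. f (x * y) = f x * f y" "f 1 = 1" "f t = 0"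
  shows "f (lk (weyl_mult t P Q) 0) = f (lk P 0) * f (lk Q 0)"
proof -
  have f0: "f 0 = 0" using f(1)[of 0 0] by simp
  have fs: "f (sum g A) = (\<Sum>a\<in>A. f (g a))" for g :: "'c \<Rightarrow> 'r" and A
    by (induction A rule: infinite_finite_induct) (simp_all add: f0 f(1))
  have fp: "f (x ^ n) = f x ^ n" for x n by (induction n) (simp_all add: f)
  have m: "f (lk (mono_mult_weyl t p q) 0) = (if p = 0 \<and> q = 0 then 1 else 0)" for p q :: "'n expo"
  proof -
    let ?K = "{\<kappa>. \<forall>i. lk \<kappa> i \<le> lk (snd p) i \<and> lk \<kappa> i \<le> lk (fst q) i}"
    have fin: "finite ?K"
      by (rule finite_subset[OF _ finite_lookup_le[of "lk (snd p)"]]) auto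
    have "f (lk (Poly_Mapping.single (fst p + (fst q - \<kappa>), snd p - \<kappa> + snd q) (weyl_coeff t (snd p) (fst q) \<kappa>)) 0)
       = (if \<kappa> = 0 then f (lk (mon (p + q)) 0) else 0)" for \<kappa>
    proof (cases "\<kappa> = 0")
      case True
      then show ?thesis by (simp add: weyl_coeff_def vdeg_def plus_prod_def)
    next
      case False
      then have v: "vdeg \<kappa> \<noteq> 0" by (auto simp: vdeg_def intro: poly_mapping_eqI)
      have "f (weyl_coeff t (snd p) (fst q) \<kappa>) = 0"
        unfolding weyl_coeff_def f(2) fp f(4) power_0_left using v by simp
      with False show ?thesis by (simp add: lookup_single when_def f0)
    qed
    then have "f (lk (mono_mult_weyl t p q) 0) = f (lk (mon (p + q) :: 'n expo \<Rightarrow>\<^sub>0 'r) 0)"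
      using fin by (simp add: mono_mult_weyl_def lookup_sum fs sum.delta)
    moreover have "p + q = 0 \<longleftrightarrow> p = 0 \<and> q = 0"
    proof
      assume "p + q = 0"
      then have "lk (fst p + fst q) i = 0" "lk (snd p + snd q) i = 0" for i by (simp_all add: plus_prod_def zero_prod_def)
      then show "p = 0 \<and> q = 0" by (auto simp: lookup_add prod_eq_iff zero_prod_def intro!: poly_mapping_eqI)
    qed simp
    ultimately show ?thesis by (auto simp: lookup_single when_def f f0)
  qed
  have z: "f (lk X 0) = 0" if "0 \<notin> Poly_Mapping.keys X" for X :: "'n expo \<Rightarrow>\<^sub>0 'r" using that by (simp add: in_keys_iff f0)
  have "f (lk (weyl_mult t P Q) 0) = (\<Sum>p\<in>Poly_Mapping.keys P. \<Sum>q\<in>Poly_Mapping.keys Q.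
      if p = 0 then (if q = 0 then f (lk P 0) * f (lk Q 0) else 0) else 0)"
    unfolding weyl_mult_expand0 lookup_sum fs lookup_cst_mult f(2) m by (intro sum.cong refl) auto
  also have "\<dots> = (\<Sum>p\<in>Poly_Mapping.keys P. if p = 0 then f (lk P 0) * f (lk Q 0) else 0)"
    using z[of Q] by (intro sum.cong refl) (auto simp: sum.delta)
  also have "\<dots> = f (lk P 0) * f (lk Q 0)" using z[of P] by (auto simp: sum.delta)
  finally show ?thesis .
qed

lemma mdeg_0: "mdeg 0 = 0"
  by (simp add: mdeg_def vdeg_def zero_prod_def)

lemma connected_graded_hom_weyl_at:
  "connected_graded_ring (hom_weyl_at c) hpart (\<lambda>P. poly (lk P 0) 0)"
proof (rule connected_graded_ring.intro[OF total_ring_hom_weyl_at], unfold_locales)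
  fix d d' and x y :: "'a expo \<Rightarrow>\<^sub>0 'b poly"
  show "hpart d x \<in> rgrade (hom_weyl_at c) d" by (simp add: mult_hom_weyl_at hpart_mem)
  show "hpart d x = x" if "x \<in> rgrade (hom_weyl_at c) d"
    using that by (simp add: mult_hom_weyl_at hpart_hgrade)
  show "hpart (d + d') (x \<otimes>\<^bsub>hom_weyl_at c\<^esub> y) = hpart d x \<otimes>\<^bsub>hom_weyl_at c\<^esub> y" if "y \<in> rgrade (hom_weyl_at c) d'"
    using that by (simp add: mult_hom_weyl_at hpart_weyl_mult)
  show "poly (lk (x \<otimes>\<^bsub>hom_weyl_at c\<^esub> y) 0) 0 = poly (lk x 0) 0 * poly (lk y 0) 0"
    unfolding mult_hom_weyl_at by (rule augmentation_weyl_mult) (simp_all add: poly_monom)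
  show "poly (lk x 0) 0 = 0" if "x \<in> rgrade (hom_weyl_at c) d" "d \<noteq> 0"
    using that hgradeD[of x d 0 0] by (auto simp: mult_hom_weyl_at poly_0_coeff_0 mdeg_0)
qed (simp_all add: hpart_add lookup_add mult_hom_weyl_at)

section \<open>The L-degree\<close>

definition L_le :: "int \<Rightarrow> ('n::finite expo \<Rightarrow>\<^sub>0 'r::zero) set" where
  "L_le d = {P. \<forall>\<mu>. lk P \<mu> \<noteq> 0 \<longrightarrow> int (mdeg \<mu>) \<le> d}"

lemma L_filt_eq: "L_filt r m j = {v \<in> finvecs r. \<forall>b<r. v b \<in> L_le (j - m b)}"
  by (auto simp: L_filt_def finvecs_def L_le_def in_keys_iff algebra_simps)

lemma L_part_add: "L_part d (P + Q) = L_part d P + L_part d Q"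
  by (rule poly_mapping_eqI) (simp add: lookup_L_part lookup_add)

lemma L_part_diff: "L_part d (P - Q) = L_part d P - L_part d Q"
  for P Q :: "'n::finite expo \<Rightarrow>\<^sub>0 'r::ab_group_add"
  by (rule poly_mapping_eqI) (simp add: lookup_L_part lookup_minus)

lemma L_part_0 [simp]: "L_part d 0 = 0"
  by (rule poly_mapping_eqI) (simp add: lookup_L_part)

lemma L_part_L_part: "L_part d (L_part d' P) = (if d = d' then L_part d P else 0)"
  by (rule poly_mapping_eqI) (simp add: lookup_L_part)

lemma L_part_L_le: "P \<in> L_le d \<Longrightarrow> d < d' \<Longrightarrow> L_part d' P = 0"
  by (rule poly_mapping_eqI) (auto simp: lookup_L_part L_le_def)

lemma L_part_in_L_le: "d \<le> d' \<Longrightarrow> L_part d P \<in> L_le d'"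
  by (auto simp: lookup_L_part L_le_def)

lemma L_le_pred: "P \<in> L_le d \<Longrightarrow> L_part d P = 0 \<Longrightarrow> P \<in> L_le (d - 1)"
  unfolding L_le_def mem_Collect_eq
proof (intro allI impI)
  fix \<mu> assume "\<forall>\<mu>. lk P \<mu> \<noteq> 0 \<longrightarrow> int (mdeg \<mu>) \<le> d" "L_part d P = 0" "lk P \<mu> \<noteq> 0"
  then have "int (mdeg \<mu>) \<le> d" "int (mdeg \<mu>) \<noteq> d" using lookup_L_part[of d P \<mu>] by auto
  then show "int (mdeg \<mu>) \<le> d - 1" by simp
qed

lemma L_le_mono: "P \<in> L_le d \<Longrightarrow> d \<le> d' \<Longrightarrow> P \<in> L_le d'"
  by (force simp: L_le_def)

lemma L_le_0 [simp]: "0 \<in> L_le d" by (simp add: L_le_def)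

lemma L_le_add: "P \<in> L_le d \<Longrightarrow> Q \<in> L_le d \<Longrightarrow> P + Q \<in> L_le d"
  unfolding L_le_def by (auto simp: lookup_add) (metis add.right_neutral)

lemma L_le_diff: "P \<in> L_le d \<Longrightarrow> Q \<in> L_le d \<Longrightarrow> P - Q \<in> L_le d"
  for P Q :: "'n::finite expo \<Rightarrow>\<^sub>0 'r::ab_group_add"
  unfolding L_le_def by (auto simp: lookup_minus) (metis diff_0_right)

lemma L_le_sum: "(\<And>a. a \<in> A \<Longrightarrow> f a \<in> L_le d) \<Longrightarrow> (\<Sum>a\<in>A. f a) \<in> L_le d"
  by (induction A rule: infinite_finite_induct) (auto intro: L_le_add)

lemma L_le_exists: "\<exists>d. P \<in> L_le d"
proof
  show "P \<in> L_le (Max (insert 0 ((\<lambda>\<mu>. int (mdeg \<mu>)) ` Poly_Mapping.keys P)))"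
    by (auto simp: L_le_def in_keys_iff intro!: Max_ge)
qed

lemma L_part_mult_L_le:
  assumes "P \<in> L_le d" "Q \<in> L_le d'"
  shows "L_part (d + d') (weyl_mult t P Q) = L_part d P * L_part d' Q"
  by (rule L_part_weyl_mult) (use assms in \<open>auto simp: L_le_def in_keys_iff\<close>)

lemma weyl_mult_L_le:
  assumes "P \<in> L_le d" "Q \<in> L_le d'"
  shows "weyl_mult t P Q \<in> L_le (d + d')"
proof -
  have "int (mdeg \<mu>) \<le> d + d'" if nz: "lk (weyl_mult t P Q) \<mu> \<noteq> 0" for \<mu>
  proof (rule ccontr)
    assume "\<not> int (mdeg \<mu>) \<le> d + d'"
    then have lt: "d' < int (mdeg \<mu>) - d" by simp
    \<comment> \<open>Regarding Q as an element of larger L-degree makes its leading part, and hence the part of the product in degree mdeg \<mu>, vanish.\<close>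
    have "L_part (d + (int (mdeg \<mu>) - d)) (weyl_mult t P Q) = L_part d P * L_part (int (mdeg \<mu>) - d) Q"
      by (rule L_part_mult_L_le[OF assms(1) L_le_mono[OF assms(2)]]) (use lt in simp)
    also have "\<dots> = 0" using L_part_L_le[OF assms(2) lt] by simp
    finally show False using nz lookup_L_part[of "int (mdeg \<mu>)" "weyl_mult t P Q" \<mu>] by simp
  qed
  then show ?thesis by (simp add: L_le_def)
qed

lemma sum_L_part:
  assumes "finite D" "(\<lambda>\<mu>. int (mdeg \<mu>)) ` Poly_Mapping.keys P \<subseteq> D"
  shows "P = (\<Sum>d\<in>D. L_part d P)"
proof (rule poly_mapping_eqI)
  fix \<mu>
  have "lk (\<Sum>d\<in>D. L_part d P) \<mu> = (\<Sum>d\<in>D. if int (mdeg \<mu>) = d then lk P \<mu> else 0)"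
    unfolding lookup_sum lookup_L_part ..
  also have "\<dots> = lk P \<mu>"
    using assms by (cases "\<mu> \<in> Poly_Mapping.keys P") (auto simp: sum.delta' in_keys_iff)
  finally show "lk P \<mu> = lk (\<Sum>d\<in>D. L_part d P) \<mu>" ..
qed

lemma L_part_decomposition: "\<exists>D. finite D \<and> (\<forall>d. d \<notin> D \<longrightarrow> L_part d P = 0) \<and> P = (\<Sum>d\<in>D. L_part d P)"
proof (intro exI conjI)
  let ?D = "(\<lambda>\<mu>. int (mdeg \<mu>)) ` Poly_Mapping.keys P"
  show "P = (\<Sum>d\<in>?D. L_part d P)" by (rule sum_L_part) auto
  show "\<forall>d. d \<notin> ?D \<longrightarrow> L_part d P = 0"
  proof (intro allI impI poly_mapping_eqI)
    fix d \<mu> assume "d \<notin> ?D"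
    then show "lk (L_part d P) \<mu> = lk 0 \<mu>"
      by (cases "\<mu> \<in> Poly_Mapping.keys P") (auto simp: lookup_L_part in_keys_iff)
  qed
qed simp

lemma rgrade_poly_S: "P \<in> rgrade poly_S d \<longleftrightarrow> L_part d P = P"
proof
  assume "L_part d P = P"
  then have "lk P \<mu> = (if int (mdeg \<mu>) = d then lk P \<mu> else 0)" for \<mu>
    by (metis lookup_L_part)
  then show "P \<in> rgrade poly_S d" by (simp add: poly_S_def) meson
qed (auto simp: poly_S_def lookup_L_part intro!: poly_mapping_eqI)

lemma L_part_mult:
  fixes P Q :: "'n::finite expo \<Rightarrow>\<^sub>0 'r::comm_ring_1"
  assumes Q: "L_part d' Q = Q"
  shows "L_part (d + d') (P * Q) = L_part d P * Q"
proof -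
  obtain D where D: "finite D" "\<And>d. d \<notin> D \<Longrightarrow> L_part d P = 0" "P = (\<Sum>d\<in>D. L_part d P)"
    using L_part_decomposition[of P] by blast
  have Q': "Q \<in> L_le d'" using L_part_in_L_le[of d' d' Q] Q by simp
  have i: "L_part (i + d') (L_part i P * Q) = L_part i P * Q" for i
    using L_part_mult_L_le[OF L_part_in_L_le Q', of i i 0 P] by (simp add: weyl_mult_0_t Q L_part_L_part)
  have "L_part (d + d') (P * Q) = (\<Sum>i\<in>D. L_part (d + d') (L_part (i + d') (L_part i P * Q)))"
    by (subst D(3)) (simp only: sum_distrib_right L_part_sum i)
  also have "\<dots> = (\<Sum>i\<in>D. if d = i then L_part d P * Q else 0)"
  proof (intro sum.cong refl)
    fix x
    show "L_part (d + d') (L_part (x + d') (L_part x P * Q)) = (if d = x then L_part d P * Q else 0)"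
      by (simp only: L_part_L_part) (simp add: i)
  qed
  also have "\<dots> = L_part d P * Q"
    using D by (simp add: sum.delta)
  finally show ?thesis .
qed

lemma connected_graded_poly_S: "connected_graded_ring poly_S L_part (\<lambda>P. lk P 0)"
proof (rule connected_graded_ring.intro[OF total_ring_poly_S], unfold_locales)
  fix d d' and x y :: "'a expo \<Rightarrow>\<^sub>0 'b"
  show "L_part d x \<in> rgrade poly_S d" by (simp add: rgrade_poly_S L_part_L_part)
  show "L_part d x = x" if "x \<in> rgrade poly_S d" using that by (simp add: rgrade_poly_S)
  show "L_part (d + d') (x \<otimes>\<^bsub>poly_S\<^esub> y) = L_part d x \<otimes>\<^bsub>poly_S\<^esub> y" if "y \<in> rgrade poly_S d'"
    using that by (simp add: mult_poly_S rgrade_poly_S L_part_mult)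
  show "lk (x \<otimes>\<^bsub>poly_S\<^esub> y) 0 = lk x 0 * lk y 0"
    unfolding mult_poly_S weyl_mult_0_t[symmetric] by (rule augmentation_weyl_mult) simp_all
  show "lk x 0 = 0" if "x \<in> rgrade poly_S d" "d \<noteq> 0"
    using that by (auto simp: poly_S_def mdeg_0)
qed (simp_all add: L_part_add lookup_add mult_poly_S)

interpretation weyl: total_ring "weyl_at t" for t
  by (rule total_ring_weyl_at)

interpretation hweyl: connected_graded_ring "hom_weyl_at c" hpart "\<lambda>P. poly (lk P 0) 0" for c
  by (rule connected_graded_hom_weyl_at)

interpretation polyS: connected_graded_ring poly_S L_part "\<lambda>P. lk P 0"
  by (rule connected_graded_poly_S)

lemma mat_map_hom_weyl_at: "mat_map (hom_weyl_at c) r s A v = mat_map (weyl_at (monom c 2)) r s A v"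
  by (rule ext) (simp only: hweyl.mat_map_apply weyl.mat_map_apply mult_hom_weyl_at mult_weyl_at)

section \<open>Setting h to 1\<close>

lemma map_coeffs_weyl_mult:
  fixes f :: "'r::comm_ring_1 \<Rightarrow> 's::comm_ring_1" and P Q :: "'n::finite expo \<Rightarrow>\<^sub>0 'r"
  assumes f: "\<And>x y. f (x + y) = f x + f y" "\<And>x y. f (x * y) = f x * f y" "f 1 = 1"
  shows "Poly_Mapping.mapp (\<lambda>_. f) (weyl_mult t P Q)
    = weyl_mult (f t) (Poly_Mapping.mapp (\<lambda>_. f) P) (Poly_Mapping.mapp (\<lambda>_. f) Q)"
proof -
  let ?m = "Poly_Mapping.mapp (\<lambda>_. f) :: ('n expo \<Rightarrow>\<^sub>0 'r) \<Rightarrow> _"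
  have f0: "f 0 = 0" using f(1)[of 0 0] by simp
  have fn: "f (of_nat n) = of_nat n" for n by (induction n) (simp_all add: f0 f)
  have fp: "f (x ^ n) = f x ^ n" for x n by (induction n) (simp_all add: f)
  have lkm: "lk (?m X) \<mu> = f (lk X \<mu>)" for X \<mu> by (rule lookup_mapp_zero) (rule f0)
  have ms: "?m (sum g A) = (\<Sum>a\<in>A. ?m (g a))" for g :: "'i \<Rightarrow> _" and A
  proof (induction A rule: infinite_finite_induct)
    case (insert a A)
    have "?m (X + Y) = ?m X + ?m Y" for X Y
      by (rule poly_mapping_eqI) (simp add: lkm lookup_add f)
    with insert show ?case by simp
  qed (auto intro: poly_mapping_eqI simp: lkm f0)
  have mc: "?m (cst a * X) = cst (f a) * ?m X" for a X
    by (rule poly_mapping_eqI) (simp add: lkm lookup_cst_mult f)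
  have m1: "?m (Poly_Mapping.single \<mu> a) = Poly_Mapping.single \<mu> (f a)" for \<mu> a
    by (rule poly_mapping_eqI) (simp add: lkm lookup_single when_def f0)
  have mm: "?m (mono_mult_weyl t p q) = mono_mult_weyl (f t) p q" for p q
    unfolding mono_mult_weyl_def ms m1 weyl_coeff_def f(2) fn fp ..
  have k: "Poly_Mapping.keys (?m X) \<subseteq> Poly_Mapping.keys X" for X by (rule keys_mapp_subset)
  show ?thesis
    unfolding weyl_mult_expand0[of t P Q] ms mc mm weyl_mult_expand[OF finite_keys k finite_keys k] lkm ..
qed

definition dehomogenize :: "('n::finite expo \<Rightarrow>\<^sub>0 'k::field_char_0 poly) \<Rightarrow> ('n expo \<Rightarrow>\<^sub>0 'k)" where
  "dehomogenize = Poly_Mapping.mapp (\<lambda>_ c. poly c 1)"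

lemma lookup_dehomogenize: "lk (dehomogenize P) \<mu> = poly (lk P \<mu>) 1"
  unfolding dehomogenize_def by (rule lookup_mapp_zero) simp

lemma dehomogenize_weyl_mult: "dehomogenize (weyl_mult (monom c 2) P Q) = weyl_mult c (dehomogenize P) (dehomogenize Q)"
  unfolding dehomogenize_def by (subst map_coeffs_weyl_mult) (simp_all add: poly_monom)

lemma dehomogenize_0: "dehomogenize 0 = 0"
  by (rule poly_mapping_eqI) (simp add: lookup_dehomogenize)

lemma dehomogenize_sum: "dehomogenize (\<Sum>a\<in>A. f a) = (\<Sum>a\<in>A. dehomogenize (f a))"
  by (rule poly_mapping_eqI) (simp add: lookup_dehomogenize lookup_sum poly_sum)

lemma lookup_homogenize: "lk (homogenize m P) \<mu> = monom (lk P \<mu>) (nat (m - int (mdeg \<mu>)))"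
  by (auto simp: homogenize_def lookup_sum lookup_single when_def in_keys_iff)

lemma dehomogenize_homogenize: "dehomogenize (homogenize m P) = P"
  by (rule poly_mapping_eqI) (simp add: lookup_dehomogenize lookup_homogenize poly_monom)

lemma homogenize_0: "homogenize m 0 = 0"
  by (simp add: homogenize_def)

lemma homogenize_mem: "P \<in> L_le m \<Longrightarrow> homogenize m P \<in> hgrade m"
  by (auto simp: hgrade_def lookup_homogenize L_le_def split: if_splits)

lemma homogenize_L_le: "P \<in> L_le d \<Longrightarrow> homogenize m P \<in> L_le d"
  by (simp add: lookup_homogenize L_le_def)

lemma dehomogenize_L_le: "P \<in> L_le d \<Longrightarrow> dehomogenize P \<in> L_le d"
  unfolding L_le_def mem_Collect_eq lookup_dehomogenize by (metis poly_0)

lemma hpart_L_le: "P \<in> L_le d \<Longrightarrow> hpart d' P \<in> L_le d"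
  unfolding L_le_def hpart_def by (auto simp: lookup_mapp in_keys_iff)

lemma hgrade_L_le:
  assumes P: "P \<in> hgrade d"
  shows "P \<in> L_le d"
proof -
  have "int (mdeg \<mu>) \<le> d" if "lk P \<mu> \<noteq> 0" for \<mu>
    using hgradeD[OF P, of \<mu> "degree (lk P \<mu>)"] that by simp
  then show ?thesis by (simp add: L_le_def)
qed

text \<open>
  In a homogeneous element, the exponent of \<open>h\<close> in front of a monomial is determined by the degree of the
  monomial, and so it can be recovered after setting \<open>h = 1\<close>.
\<close>

lemma homogenize_dehomogenize:
  fixes P :: "'n::finite expo \<Rightarrow>\<^sub>0 'k::field_char_0 poly"
  assumes P: "P \<in> hgrade m"
  shows "homogenize m (dehomogenize P) = P"
proof (rule poly_mapping_eqI)
  fix \<mu> :: "'n expo"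
  let ?l = "nat (m - int (mdeg \<mu>))"
  have "coeff (lk P \<mu>) l = 0" if "l \<noteq> ?l" for l
  proof (rule ccontr)
    assume "coeff (lk P \<mu>) l \<noteq> 0"
    then have "int (l + mdeg \<mu>) = m" by (rule hgradeD[OF P])
    with that show False by simp
  qed
  then have e: "lk P \<mu> = monom (coeff (lk P \<mu>) ?l) ?l"
    by (intro poly_eqI) auto
  show "lk (homogenize m (dehomogenize P)) \<mu> = lk P \<mu>"
    unfolding lookup_homogenize lookup_dehomogenize by (subst (1 2) e) (simp add: poly_monom)
qed

section \<open>Strictness and homogenization\<close>

text \<open>
  The suffix \<open>_vec\<close> marks the entrywise operations on a free module with shifts \<open>m\<close>: the class of a vector
  of \<open>L\<^sub>j\<close> in the associated graded module, the homogeneous part of degree \<open>d\<close>, and the two mutually inverse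
  maps between \<open>L\<^sub>d\<close> over \<open>k\<close> and the homogeneous vectors of degree \<open>d\<close> over \<open>k[h]\<close>.
\<close>

definition symbol_vec :: "(nat \<Rightarrow> int) \<Rightarrow> int \<Rightarrow> (nat \<Rightarrow> ('n::finite expo \<Rightarrow>\<^sub>0 'r::comm_monoid_add)) \<Rightarrow> nat \<Rightarrow> ('n expo \<Rightarrow>\<^sub>0 'r)" where
  "symbol_vec m j v = (\<lambda>a. L_part (j - m a) (v a))"

definition hpart_vec :: "(nat \<Rightarrow> int) \<Rightarrow> int \<Rightarrow> (nat \<Rightarrow> ('n::finite expo \<Rightarrow>\<^sub>0 'k::field_char_0 poly)) \<Rightarrow> nat \<Rightarrow> ('n expo \<Rightarrow>\<^sub>0 'k poly)" where
  "hpart_vec m d v = (\<lambda>a. hpart (d - m a) (v a))"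

definition dehomogenize_vec :: "(nat \<Rightarrow> ('n::finite expo \<Rightarrow>\<^sub>0 'k::field_char_0 poly)) \<Rightarrow> nat \<Rightarrow> ('n expo \<Rightarrow>\<^sub>0 'k)" where
  "dehomogenize_vec v = (\<lambda>a. dehomogenize (v a))"

definition homogenize_vec :: "(nat \<Rightarrow> int) \<Rightarrow> int \<Rightarrow> (nat \<Rightarrow> ('n::finite expo \<Rightarrow>\<^sub>0 'k::field_char_0)) \<Rightarrow> nat \<Rightarrow> ('n expo \<Rightarrow>\<^sub>0 'k poly)" where
  "homogenize_vec m d u = (\<lambda>a. homogenize (d - m a) (u a))"

definition hgrade_vec :: "nat \<Rightarrow> (nat \<Rightarrow> int) \<Rightarrow> int \<Rightarrow> (nat \<Rightarrow> ('n::finite expo \<Rightarrow>\<^sub>0 'k::field_char_0 poly)) set" where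
  "hgrade_vec r m d = {v \<in> finvecs r. \<forall>a<r. v a \<in> hgrade (d - m a)}"

definition filtered_matrix ::
  "nat \<Rightarrow> (nat \<Rightarrow> int) \<Rightarrow> nat \<Rightarrow> (nat \<Rightarrow> int) \<Rightarrow> (nat \<Rightarrow> nat \<Rightarrow> ('n::finite expo \<Rightarrow>\<^sub>0 'r::zero)) \<Rightarrow> bool" where
  "filtered_matrix r n s m A \<longleftrightarrow> (\<forall>a<r. \<forall>b<s. A a b \<in> L_le (n a - m b))"

lemma L_filt_finvecs: "v \<in> L_filt r m j \<Longrightarrow> v \<in> finvecs r"
  by (simp add: L_filt_eq)

lemma L_filt_mono: "v \<in> L_filt r m j \<Longrightarrow> j \<le> j' \<Longrightarrow> v \<in> L_filt r m j'"
  by (auto simp: L_filt_eq intro: L_le_mono[of _ "j - m _"])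

lemma L_filt_diff: "v \<in> L_filt r m j \<Longrightarrow> w \<in> L_filt r m j \<Longrightarrow> v - w \<in> L_filt r m j"
  for v w :: "nat \<Rightarrow> ('n::finite expo \<Rightarrow>\<^sub>0 'r::ab_group_add)"
  by (auto simp: L_filt_eq finvecs_def intro: L_le_diff)

lemma L_filt_add: "v \<in> L_filt r m j \<Longrightarrow> w \<in> L_filt r m j \<Longrightarrow> v + w \<in> L_filt r m j"
  for v w :: "nat \<Rightarrow> ('n::finite expo \<Rightarrow>\<^sub>0 'r::ab_group_add)"
  by (auto simp: L_filt_eq finvecs_def intro: L_le_add)

lemma L_filt_sum: "(\<And>i. i \<in> I \<Longrightarrow> v i \<in> L_filt r m j) \<Longrightarrow> (\<Sum>i\<in>I. v i) \<in> L_filt r m j"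
  for v :: "'i \<Rightarrow> nat \<Rightarrow> ('n::finite expo \<Rightarrow>\<^sub>0 'r::ab_group_add)"
  by (auto simp: L_filt_eq finvecs_def sum_fun_apply intro!: L_le_sum)

lemma L_filt_0: "0 \<in> L_filt r m j"
  by (simp add: L_filt_eq finvecs_def)

lemma L_filt_pred: "v \<in> L_filt r m j \<Longrightarrow> symbol_vec m j v = 0 \<Longrightarrow> v \<in> L_filt r m (j - 1)"
proof -
  assume v: "v \<in> L_filt r m j" "symbol_vec m j v = 0"
  have "v b \<in> L_le (j - 1 - m b)" if "b < r" for b
  proof -
    have "L_part (j - m b) (v b) = 0" using fun_cong[OF v(2), of b] by (simp add: symbol_vec_def)
    then show ?thesis
      using L_le_pred[of "v b" "j - m b"] v(1) that by (simp add: L_filt_eq algebra_simps)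
  qed
  with v show ?thesis by (simp add: L_filt_eq)
qed

lemma symbol_vec_L_filt: "v \<in> finvecs r \<Longrightarrow> symbol_vec m j v \<in> L_filt r m j"
  by (auto simp: L_filt_eq finvecs_def symbol_vec_def intro: L_part_in_L_le)

lemma symbol_vec_eq_0: "v \<in> L_filt r m j \<Longrightarrow> j < d \<Longrightarrow> symbol_vec m d v = 0"
proof
  fix b assume "v \<in> L_filt r m j" "j < d"
  then show "symbol_vec m d v b = 0 b"
    using L_part_L_le[of "v b" "j - m b" "d - m b"]
    by (cases "b < r") (simp_all add: symbol_vec_def L_filt_eq finvecs_def)
qed

lemma symbol_vec_symbol_vec: "symbol_vec m d (symbol_vec m j v) = (if d = j then symbol_vec m j v else 0)"
  by (auto simp: symbol_vec_def fun_eq_iff L_part_L_part)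

lemma symbol_vec_diff: "symbol_vec m d (v - w) = symbol_vec m d v - symbol_vec m d w"
  for v w :: "nat \<Rightarrow> ('n::finite expo \<Rightarrow>\<^sub>0 'r::ab_group_add)"
  by (auto simp: symbol_vec_def fun_eq_iff L_part_diff)

lemma symbol_vec_add: "symbol_vec m d (v + w) = symbol_vec m d v + symbol_vec m d w"
  for v w :: "nat \<Rightarrow> ('n::finite expo \<Rightarrow>\<^sub>0 'r::ab_group_add)"
  by (auto simp: symbol_vec_def fun_eq_iff L_part_add)

lemma L_filt_exists: "v \<in> finvecs r \<Longrightarrow> \<exists>j. v \<in> L_filt r m j"
proof -
  assume v: "v \<in> finvecs r"
  have "\<forall>a. \<exists>d. v a \<in> L_le d" by (simp add: L_le_exists)
  then obtain d where d: "\<And>a. v a \<in> L_le (d a)" by metis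
  have "v a \<in> L_le (Max ((\<lambda>a. d a + m a) ` {..<r}) - m a)" if "a < r" for a
  proof -
    have "d a + m a \<le> Max ((\<lambda>a. d a + m a) ` {..<r})" using that by (intro Max_ge) auto
    then show ?thesis using d[of a] by (elim L_le_mono) simp
  qed
  with v show ?thesis by (auto simp: L_filt_eq)
qed

text \<open>
  With shifts, the parts of the different entries that belong to the same degree of the vector have
  different degrees; hence the reindexing of the finite sums.
\<close>

lemma vec_decomposition:
  fixes hp :: "int \<Rightarrow> 'a::ab_group_add \<Rightarrow> 'a"
  assumes hp: "\<And>P. \<exists>D. finite D \<and> (\<forall>d. d \<notin> D \<longrightarrow> hp d P = 0) \<and> P = (\<Sum>d\<in>D. hp d P)"
    and v: "v \<in> finvecs r" and hp0: "\<And>d. hp d 0 = 0"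
  shows "\<exists>D. finite D \<and> (\<forall>d. d \<notin> D \<longrightarrow> (\<lambda>a. hp (d - m a) (v a)) = (0 :: nat \<Rightarrow> 'a)) \<and>
    v = (\<Sum>d\<in>D. (\<lambda>a. hp (d - m a) (v a)))"
proof -
  from hp have "\<forall>a. \<exists>D. finite D \<and> (\<forall>d. d \<notin> D \<longrightarrow> hp d (v a) = 0) \<and> v a = (\<Sum>d\<in>D. hp d (v a))"
    by blast
  then obtain D where D: "\<And>a. finite (D a)" "\<And>a d. d \<notin> D a \<Longrightarrow> hp d (v a) = 0"
    "\<And>a. v a = (\<Sum>d\<in>D a. hp d (v a))" by metis
  let ?D = "\<Union>a<r. (\<lambda>d. d + m a) ` D a"
  show ?thesis
  proof (intro exI[of _ ?D] conjI allI impI)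
    show fin: "finite ?D" using D(1) by auto
    show "(\<lambda>a. hp (d - m a) (v a)) = (0 :: nat \<Rightarrow> 'a)" if d: "d \<notin> ?D" for d
    proof
      fix a
      show "hp (d - m a) (v a) = 0 a"
      proof (cases "a < r")
        case True
        have "d - m a \<notin> D a"
        proof
          assume "d - m a \<in> D a"
          then have "d \<in> (\<lambda>d. d + m a) ` D a" by (intro image_eqI[of _ _ "d - m a"]) simp_all
          with d True show False by blast
        qed
        then show ?thesis by (simp add: D(2))
      next
        case False
        then have "v a = 0" using v by (simp add: finvecs_def)
        then show ?thesis by (simp add: hp0)
      qed
    qed
    show "v = (\<Sum>d\<in>?D. (\<lambda>a. hp (d - m a) (v a)))"
    proof
      fix a
      show "v a = (\<Sum>d\<in>?D. (\<lambda>a. hp (d - m a) (v a))) a"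
      proof (cases "a < r")
        case True
        have "v a = (\<Sum>d\<in>D a. hp d (v a))" by (rule D(3))
        also have "\<dots> = (\<Sum>d\<in>(\<lambda>d. d + m a) ` D a. hp (d - m a) (v a))"
          by (subst sum.reindex) (auto simp: inj_on_def)
        also have "\<dots> = (\<Sum>d\<in>?D. hp (d - m a) (v a))"
        proof (rule sum.mono_neutral_left[OF fin])
          show "\<forall>d\<in>?D - (\<lambda>d. d + m a) ` D a. hp (d - m a) (v a) = 0"
          proof
            fix d assume "d \<in> ?D - (\<lambda>d. d + m a) ` D a"
            then have d: "d \<notin> (\<lambda>d. d + m a) ` D a" by simp
            have "d - m a \<notin> D a"
            proof
              assume "d - m a \<in> D a"
              then have "d \<in> (\<lambda>d. d + m a) ` D a" by (intro image_eqI[of _ _ "d - m a"]) simp_all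
              with d show False ..
            qed
            then show "hp (d - m a) (v a) = 0" by (rule D(2))
          qed
        qed (use True in auto)
        finally show ?thesis by (simp add: sum_fun_apply)
      next
        case False
        then have "v a = 0" using v by (simp add: finvecs_def)
        then show ?thesis by (simp add: hp0 sum_fun_apply)
      qed
    qed
  qed
qed

lemma hpart_vec_decomposition:
  "v \<in> finvecs r \<Longrightarrow> \<exists>D. finite D \<and> v = (\<Sum>d\<in>D. hpart_vec m d v)"
  using vec_decomposition[of hpart v r m, OF hpart_decomposition] by (auto simp: hpart_vec_def hweyl.hp_0)

lemma hpart_vec_0: "hpart_vec m d 0 = 0"
  by (rule ext) (simp add: hpart_vec_def hweyl.hp_0)

lemma hpart_vec_hgrade_vec: "v \<in> finvecs r \<Longrightarrow> hpart_vec m d v \<in> hgrade_vec r m d"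
  by (simp add: hpart_vec_def hgrade_vec_def finvecs_def hpart_mem hweyl.hp_0)

lemma hgrade_vec_L_filt: "v \<in> hgrade_vec r m d \<Longrightarrow> v \<in> L_filt r m d"
  by (auto simp: hgrade_vec_def L_filt_eq intro: hgrade_L_le)

lemma dehomogenize_vec_L_filt: "v \<in> L_filt r m d \<Longrightarrow> dehomogenize_vec v \<in> L_filt r m d"
  by (auto simp: dehomogenize_vec_def L_filt_eq finvecs_def dehomogenize_0 intro: dehomogenize_L_le)

lemma hpart_vec_L_filt: "v \<in> L_filt r m d \<Longrightarrow> hpart_vec m d' v \<in> L_filt r m d"
  by (auto simp: hpart_vec_def L_filt_eq finvecs_def hweyl.hp_0 intro: hpart_L_le)

lemma homogenize_vec_L_filt: "v \<in> L_filt r m d \<Longrightarrow> homogenize_vec m d' v \<in> L_filt r m d"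
  by (auto simp: homogenize_vec_def L_filt_eq finvecs_def homogenize_0 intro: homogenize_L_le)

lemma homogenize_vec_hgrade_vec: "u \<in> L_filt r m d \<Longrightarrow> homogenize_vec m d u \<in> hgrade_vec r m d"
  by (simp add: homogenize_vec_def hgrade_vec_def L_filt_eq finvecs_def homogenize_0 homogenize_mem)

lemma homogenize_vec_dehomogenize_vec: "v \<in> hgrade_vec r m d \<Longrightarrow> homogenize_vec m d (dehomogenize_vec v) = v"
proof
  fix a assume "v \<in> hgrade_vec r m d"
  then show "homogenize_vec m d (dehomogenize_vec v) a = v a"
    by (cases "a < r") (simp_all add: homogenize_vec_def dehomogenize_vec_def hgrade_vec_def homogenize_dehomogenize finvecs_def dehomogenize_0 homogenize_0)
qed

lemma dehomogenize_vec_homogenize_vec: "dehomogenize_vec (homogenize_vec m d u) = u"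
  by (simp add: dehomogenize_vec_def homogenize_vec_def dehomogenize_homogenize)

lemma dehomogenize_vec_0: "dehomogenize_vec 0 = 0"
  by (simp add: dehomogenize_vec_def fun_eq_iff dehomogenize_0)

lemma homogenize_vec_0: "homogenize_vec m d 0 = 0"
  by (simp add: homogenize_vec_def fun_eq_iff homogenize_0)

lemma dehomogenize_vec_mat_map:
  "dehomogenize_vec (mat_map (hom_weyl_at c) r s (homogenize_matrix n m A) v) = mat_map (weyl_at c) r s A (dehomogenize_vec v)"
  by (rule ext) (simp add: dehomogenize_vec_def hweyl.mat_map_apply weyl.mat_map_apply dehomogenize_sum mult_hom_weyl_at
      mult_weyl_at dehomogenize_weyl_mult homogenize_matrix_def dehomogenize_homogenize dehomogenize_0)

lemma mat_map_L_filt: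
  assumes "filtered_matrix r n s m A" "u \<in> L_filt r n d"
  shows "mat_map (weyl_at t) r s A u \<in> L_filt s m d"
proof -
  have "weyl_mult t (u a) (A a b) \<in> L_le (d - m b)" if "a < r" "b < s" for a b
    using weyl_mult_L_le[of "u a" "d - n a" "A a b" "n a - m b" t] assms that
    by (simp add: filtered_matrix_def L_filt_eq)
  then show ?thesis
    by (auto simp: L_filt_eq finvecs_def weyl.mat_map_apply mult_weyl_at intro!: L_le_sum)
qed

lemma symbol_vec_mat_map:
  assumes "filtered_matrix r n s m A" "v \<in> L_filt r n j"
  shows "symbol_vec m j (mat_map (weyl_at t) r s A v) = mat_map (weyl_at 0) r s (symbol_matrix n m A) (symbol_vec n j v)"
proof
  fix b
  have "L_part (j - m b) (weyl_mult t (v a) (A a b)) = L_part (j - n a) (v a) * symbol_matrix n m A a b"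
    if "a < r" "b < s" for a
    using L_part_mult_L_le[of "v a" "j - n a" "A a b" "n a - m b" t] assms that
    by (simp add: filtered_matrix_def L_filt_eq symbol_matrix_def)
  then show "symbol_vec m j (mat_map (weyl_at t) r s A v) b
      = mat_map (weyl_at 0) r s (symbol_matrix n m A) (symbol_vec n j v) b"
    by (simp add: symbol_vec_def weyl.mat_map_apply mult_weyl_at L_part_sum weyl_mult_0_t)
qed

lemma homogenize_matrix_hgrade:
  "filtered_matrix r n s m A \<Longrightarrow> a < r \<Longrightarrow> b < s \<Longrightarrow> homogenize_matrix n m A a b \<in> hgrade (n a - m b)"
  by (simp add: filtered_matrix_def homogenize_matrix_def homogenize_mem)

lemma mat_map_hpart_vec:
  assumes "filtered_matrix r n s m A"
  shows "mat_map (hom_weyl_at c) r s (homogenize_matrix n m A) (hpart_vec n d v)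
    = hpart_vec m d (mat_map (hom_weyl_at c) r s (homogenize_matrix n m A) v)"
proof
  fix b
  show "mat_map (hom_weyl_at c) r s (homogenize_matrix n m A) (hpart_vec n d v) b
    = hpart_vec m d (mat_map (hom_weyl_at c) r s (homogenize_matrix n m A) v) b"
    unfolding hpart_vec_def
    by (subst hweyl.mat_map_hp[where n = n and m = m])
      (use homogenize_matrix_hgrade[OF assms] in \<open>auto simp: mult_hom_weyl_at hweyl.mat_map_apply hweyl.hp_0\<close>)
qed

text \<open>
  Homogenization commutes with the matrices: both sides are homogeneous of degree \<open>d\<close>, and they agree
  after setting \<open>h = 1\<close>.
\<close>

lemma mat_map_homogenize_vec:
  assumes A: "filtered_matrix r n s m A" and u: "u \<in> L_filt r n d"
  shows "mat_map (hom_weyl_at c) r s (homogenize_matrix n m A) (homogenize_vec n d u) = homogenize_vec m d (mat_map (weyl_at c) r s A u)"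
proof -
  let ?v = "mat_map (hom_weyl_at c) r s (homogenize_matrix n m A) (homogenize_vec n d u)"
  have "homogenize_vec n d u = hpart_vec n d (homogenize_vec n d u)"
  proof
    fix a
    show "homogenize_vec n d u a = hpart_vec n d (homogenize_vec n d u) a"
      using homogenize_vec_hgrade_vec[OF u] by (cases "a < r") (auto simp: hpart_vec_def hgrade_vec_def hpart_hgrade finvecs_def hweyl.hp_0)
  qed
  then have "?v = hpart_vec m d ?v" using mat_map_hpart_vec[OF A] by metis
  then have "?v \<in> hgrade_vec s m d" by (metis hpart_vec_hgrade_vec hweyl.mat_map_finvecs)
  then have "?v = homogenize_vec m d (dehomogenize_vec ?v)" by (rule homogenize_vec_dehomogenize_vec[symmetric])
  then show ?thesis by (simp add: dehomogenize_vec_mat_map dehomogenize_vec_homogenize_vec)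
qed

text \<open>
  Strictness of a matrix \<open>A\<close> with respect to the \<open>L\<close>-filtrations. If \<open>w\<close> has degree \<open>j + k\<close> with \<open>k > 0\<close>
  while its image has degree at most \<open>j\<close>, then the leading symbol of \<open>w\<close> is a cycle for the symbols of
  \<open>A\<close>, hence a boundary; subtracting from \<open>w\<close> the image under \<open>C\<close> of a lift of the bounding element
  decreases \<open>k\<close>.
\<close>

lemma strict_lift:
  assumes A: "filtered_matrix r n s m A" and C: "filtered_matrix t l r n C"
    and exact: "\<And>w. w \<in> finvecs r \<Longrightarrow> mat_map poly_S r s (symbol_matrix n m A) w = 0
      \<Longrightarrow> \<exists>z. mat_map poly_S t r (symbol_matrix l n C) z = w"
    and cpx: "\<And>z. z \<in> finvecs t \<Longrightarrow> mat_map (weyl_at c) r s A (mat_map (weyl_at c) t r C z) = 0"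
    and w: "w \<in> finvecs r" and u: "mat_map (weyl_at c) r s A w \<in> L_filt s m j"
  shows "\<exists>w'\<in>L_filt r n j. mat_map (weyl_at c) r s A w' = mat_map (weyl_at c) r s A w"
proof -
  have main: "\<exists>w'\<in>L_filt r n j. mat_map (weyl_at c) r s A w' = mat_map (weyl_at c) r s A w"
    if "w \<in> L_filt r n (j + int k)" "mat_map (weyl_at c) r s A w \<in> L_filt s m j" for k w
    using that
  proof (induction k arbitrary: w)
    case 0
    then show ?case by auto
  next
    case (Suc k)
    let ?d = "j + int (Suc k)"
    have "mat_map poly_S r s (symbol_matrix n m A) (symbol_vec n ?d w) = symbol_vec m ?d (mat_map (weyl_at c) r s A w)"
      using symbol_vec_mat_map[OF A Suc.prems(1)] by (simp only: mat_map_poly_S)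
    also have "\<dots> = 0" by (rule symbol_vec_eq_0[OF Suc.prems(2)]) simp
    finally obtain z where z: "mat_map poly_S t r (symbol_matrix l n C) z = symbol_vec n ?d w"
      using exact L_filt_finvecs[OF symbol_vec_L_filt[OF L_filt_finvecs[OF Suc.prems(1)]]] by blast
    \<comment> \<open>Only the part of z of degree j + k + 1 contributes, and it is its own lift to the filtered module.\<close>
    have "\<exists>y\<in>finvecs t. (\<forall>a<t. y a \<in> rgrade poly_S (?d - l a)) \<and>
      mat_map poly_S t r (symbol_matrix l n C) y = symbol_vec n ?d w"
      by (rule polyS.lift_homogeneous[where m = n, OF _ z]) (simp_all add: rgrade_poly_S symbol_matrix_def symbol_vec_def L_part_L_part)
    then obtain y where y: "y \<in> finvecs t" "\<And>a. a < t \<Longrightarrow> L_part (?d - l a) (y a) = y a"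
      "mat_map poly_S t r (symbol_matrix l n C) y = symbol_vec n ?d w"
      by (auto simp: rgrade_poly_S)
    have sy: "symbol_vec l ?d y = y"
    proof
      show "symbol_vec l ?d y a = y a" for a
        using y(1,2) by (cases "a < t") (simp_all add: symbol_vec_def finvecs_def)
    qed
    then have yL: "y \<in> L_filt t l ?d" using symbol_vec_L_filt[OF y(1), of l ?d] by simp
    let ?w = "w - mat_map (weyl_at c) t r C y"
    have "symbol_vec n ?d (mat_map (weyl_at c) t r C y) = symbol_vec n ?d w"
      using symbol_vec_mat_map[OF C yL, of c] y(3) by (simp only: mat_map_poly_S sy)
    then have "symbol_vec n ?d ?w = 0" by (simp add: symbol_vec_diff)
    moreover have "?w \<in> L_filt r n ?d"
      by (intro L_filt_diff Suc.prems mat_map_L_filt[OF C yL])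
    ultimately have "?w \<in> L_filt r n (?d - 1)" by (rule L_filt_pred[rotated])
    moreover have "mat_map (weyl_at c) r s A ?w = mat_map (weyl_at c) r s A w"
      unfolding weyl.mat_map_diff cpx[OF y(1)] by simp
    moreover have "?d - 1 = j + int k" by simp
    ultimately show ?case using Suc.IH[of ?w] Suc.prems(2) by metis
  qed
  obtain K where K: "w \<in> L_filt r n K" using L_filt_exists[OF w] by blast
  then have "w \<in> L_filt r n (j + int (nat (K - j)))" by (rule L_filt_mono) simp
  then show ?thesis using main u by blast
qed

text \<open>
  Each homogeneous part of \<open>w\<close> is the homogenization of a vector over \<open>k\<close>, for which the claim holds by
  assumption.
\<close>

lemma complex_hom:
  assumes A: "filtered_matrix r n s m A" and C: "filtered_matrix t l r n C"
    and cpx: "\<And>z. z \<in> finvecs t \<Longrightarrow> mat_map (weyl_at c) r s A (mat_map (weyl_at c) t r C z) = 0"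
    and w: "w \<in> finvecs t"
  shows "mat_map (hom_weyl_at c) r s (homogenize_matrix n m A)
    (mat_map (hom_weyl_at c) t r (homogenize_matrix l n C) w) = 0"
proof -
  let ?A = "mat_map (hom_weyl_at c) r s (homogenize_matrix n m A)"
  let ?C = "mat_map (hom_weyl_at c) t r (homogenize_matrix l n C)"
  obtain D where D: "w = (\<Sum>d\<in>D. hpart_vec l d w)" using hpart_vec_decomposition[OF w, of l] by blast
  have "?A (?C (hpart_vec l d w)) = 0" for d
  proof -
    let ?u = "dehomogenize_vec (hpart_vec l d w)"
    have v: "hpart_vec l d w \<in> hgrade_vec t l d" by (rule hpart_vec_hgrade_vec[OF w])
    then have u: "?u \<in> L_filt t l d" by (intro dehomogenize_vec_L_filt hgrade_vec_L_filt)
    have "?A (?C (homogenize_vec l d ?u)) = homogenize_vec m d (mat_map (weyl_at c) r s A (mat_map (weyl_at c) t r C ?u))"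
      by (simp only: mat_map_homogenize_vec[OF C u] mat_map_homogenize_vec[OF A mat_map_L_filt[OF C u]])
    then show ?thesis by (simp only: homogenize_vec_dehomogenize_vec[OF v] cpx[OF L_filt_finvecs[OF u]] homogenize_vec_0)
  qed
  then show ?thesis by (subst D) (simp only: hweyl.mat_map_sum sum.neutral_const)
qed

text \<open>
  A homogeneous cycle \<open>v\<close> of degree \<open>d\<close> becomes a cycle in \<open>L\<^sub>d\<close> for \<open>h = 1\<close>. By exactness it is a boundary there,
  by strictness it is the image of an element of \<open>L\<^sub>d\<close>, and the homogenization of this element in degree \<open>d\<close>
  is a preimage of \<open>v\<close>.
\<close>

lemma exact_hom:
  assumes A: "filtered_matrix r n s m A" and C: "filtered_matrix t l r n C" and E: "filtered_matrix t' l' t l E"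
    and exact: "\<And>w. w \<in> finvecs t \<Longrightarrow> mat_map poly_S t r (symbol_matrix l n C) w = 0
      \<Longrightarrow> \<exists>z. mat_map poly_S t' t (symbol_matrix l' l E) z = w"
    and cpx: "\<And>z. z \<in> finvecs t' \<Longrightarrow> mat_map (weyl_at c) t r C (mat_map (weyl_at c) t' t E z) = 0"
    and exact_A: "\<And>w. w \<in> finvecs r \<Longrightarrow> mat_map (weyl_at c) r s A w = 0
      \<Longrightarrow> \<exists>z\<in>finvecs t. mat_map (weyl_at c) t r C z = w"
    and v: "v \<in> finvecs r" "mat_map (hom_weyl_at c) r s (homogenize_matrix n m A) v = 0"
  shows "\<exists>w\<in>finvecs t. mat_map (hom_weyl_at c) t r (homogenize_matrix l n C) w = v"
proof -
  let ?A = "mat_map (hom_weyl_at c) r s (homogenize_matrix n m A)"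
  let ?C = "mat_map (hom_weyl_at c) t r (homogenize_matrix l n C)"
  obtain D where D: "v = (\<Sum>d\<in>D. hpart_vec n d v)" using hpart_vec_decomposition[OF v(1), of n] by blast
  have "\<exists>w\<in>finvecs t. ?C w = hpart_vec n d v" for d
  proof -
    let ?u = "dehomogenize_vec (hpart_vec n d v)"
    have h: "hpart_vec n d v \<in> hgrade_vec r n d" by (rule hpart_vec_hgrade_vec[OF v(1)])
    then have u: "?u \<in> L_filt r n d" by (intro dehomogenize_vec_L_filt hgrade_vec_L_filt)
    have "mat_map (weyl_at c) r s A ?u = dehomogenize_vec (?A (hpart_vec n d v))" by (rule dehomogenize_vec_mat_map[symmetric])
    also have "?A (hpart_vec n d v) = 0"
      unfolding mat_map_hpart_vec[OF A] v(2) hpart_vec_0 ..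
    finally have "mat_map (weyl_at c) r s A ?u = 0" by (simp only: dehomogenize_vec_0)
    then obtain z where z: "z \<in> finvecs t" "mat_map (weyl_at c) t r C z = ?u"
      using exact_A[OF L_filt_finvecs[OF u]] by blast
    then obtain z' where z': "z' \<in> L_filt t l d" "mat_map (weyl_at c) t r C z' = ?u"
      using strict_lift[OF C E exact cpx z(1), of d] u by auto
    then have "?C (homogenize_vec l d z') = hpart_vec n d v" by (simp only: mat_map_homogenize_vec[OF C] homogenize_vec_dehomogenize_vec[OF h])
    then show ?thesis using L_filt_finvecs[OF homogenize_vec_L_filt[OF z'(1)]] by blast
  qed
  then obtain w where w: "\<And>d. w d \<in> finvecs t \<and> ?C (w d) = hpart_vec n d v" by metis
  have "?C (\<Sum>d\<in>D. w d) = (\<Sum>d\<in>D. hpart_vec n d v)" by (simp only: hweyl.mat_map_sum w)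
  then have "?C (\<Sum>d\<in>D. w d) = v" using D by simp
  then show ?thesis using w by (metis finvecs_sum)
qed

text \<open>
  Strictness of the homogenized matrix for the \<open>L\<close>-filtration, in which \<open>h\<close> has degree zero. The homogeneous
  parts of \<open>y\<close> of degree \<open>d \<le> j\<close> are in \<open>L\<^sub>j\<close> anyway. For \<open>d > j\<close>, a strict lift for \<open>h = 1\<close> is an element of
  \<open>L\<^sub>j\<close>, and homogenizing it in degree \<open>d\<close> only multiplies its terms by powers of \<open>h\<close>.
\<close>

lemma strict_hom:
  assumes C: "filtered_matrix t l r n C" and E: "filtered_matrix t' l' t l E"
    and exact: "\<And>w. w \<in> finvecs t \<Longrightarrow> mat_map poly_S t r (symbol_matrix l n C) w = 0
      \<Longrightarrow> \<exists>z. mat_map poly_S t' t (symbol_matrix l' l E) z = w"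
    and cpx: "\<And>z. z \<in> finvecs t' \<Longrightarrow> mat_map (weyl_at c) t r C (mat_map (weyl_at c) t' t E z) = 0"
    and y: "y \<in> finvecs t" and u: "mat_map (hom_weyl_at c) t r (homogenize_matrix l n C) y \<in> L_filt r n j"
  shows "\<exists>y'\<in>L_filt t l j. mat_map (hom_weyl_at c) t r (homogenize_matrix l n C) y'
     = mat_map (hom_weyl_at c) t r (homogenize_matrix l n C) y"
proof -
  let ?C = "mat_map (hom_weyl_at c) t r (homogenize_matrix l n C)"
  obtain D where D: "y = (\<Sum>d\<in>D. hpart_vec l d y)" using hpart_vec_decomposition[OF y, of l] by blast
  have "\<exists>w\<in>L_filt t l j. ?C w = ?C (hpart_vec l d y)" for d
  proof (cases "d \<le> j")
    case True
    have "hpart_vec l d y \<in> L_filt t l j" by (rule L_filt_mono[OF hgrade_vec_L_filt[OF hpart_vec_hgrade_vec[OF y]] True])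
    then show ?thesis by blast
  next
    case False
    have Ch: "?C (hpart_vec l d y) = hpart_vec n d (?C y)" by (rule mat_map_hpart_vec[OF C])
    then have h: "?C (hpart_vec l d y) \<in> hgrade_vec r n d" using hpart_vec_hgrade_vec hweyl.mat_map_finvecs by metis
    have "mat_map (weyl_at c) t r C (dehomogenize_vec (hpart_vec l d y)) = dehomogenize_vec (hpart_vec n d (?C y))"
      unfolding dehomogenize_vec_mat_map[symmetric, where n = l and m = n] Ch ..
    moreover have "dehomogenize_vec (hpart_vec n d (?C y)) \<in> L_filt r n j" by (intro dehomogenize_vec_L_filt hpart_vec_L_filt u)
    moreover have "dehomogenize_vec (hpart_vec l d y) \<in> finvecs t"
      using hpart_vec_hgrade_vec[OF y, of l d] by (intro L_filt_finvecs dehomogenize_vec_L_filt hgrade_vec_L_filt)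
    ultimately obtain z where z: "z \<in> L_filt t l j" "mat_map (weyl_at c) t r C z = dehomogenize_vec (hpart_vec n d (?C y))"
      using strict_lift[OF C E exact cpx, of "dehomogenize_vec (hpart_vec l d y)" j] by auto
    from z(1) False have "z \<in> L_filt t l d" by (elim L_filt_mono) simp
    then have "?C (homogenize_vec l d z) = ?C (hpart_vec l d y)"
      using homogenize_vec_dehomogenize_vec[OF h] by (simp only: mat_map_homogenize_vec[OF C] z(2) Ch)
    then show ?thesis using homogenize_vec_L_filt[OF z(1)] by blast
  qed
  then obtain w where w: "\<And>d. w d \<in> L_filt t l j \<and> ?C (w d) = ?C (hpart_vec l d y)" by metis
  have "?C (\<Sum>d\<in>D. w d) = ?C (\<Sum>d\<in>D. hpart_vec l d y)" by (simp only: hweyl.mat_map_sum w)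
  then have "?C (\<Sum>d\<in>D. w d) = ?C y" using D by simp
  then show ?thesis using w by (metis L_filt_sum)
qed

section \<open>Associated graded modules\<close>

lemma (in abelian_group) add_idem_zero:
  assumes x: "x \<in> carrier G" and xx: "x \<oplus> x = x"
  shows "x = \<zero>"
proof -
  have "x = (x \<oplus> x) \<oplus> \<ominus> x" using x by (simp add: a_assoc r_neg)
  then show ?thesis using x by (simp add: xx r_neg)
qed

lemma symbol_vec_sum: "symbol_vec m d (\<Sum>i\<in>I. v i) = (\<Sum>i\<in>I. symbol_vec m d (v i))"
  by (rule ext) (simp add: symbol_vec_def sum_fun_apply L_part_sum)

text \<open>
  A linear map \<open>p\<close> from the filtered free module with shifts \<open>m\<close> to \<open>M\<close>. It induces the filtration \<open>F\<close> on \<open>M\<close>,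
  and the associated graded map \<open>q\<close> of \<open>p\<close> presents \<open>gr M\<close> over the commutative ring: a vector \<open>v\<close> of
  symbols is sent to the family of the classes of \<open>p\<close> at its parts of \<open>L\<close>-degree \<open>j\<close>, where the parts
  are lifted by keeping their coefficients.
\<close>

locale filtered_presentation =
  fixes t :: "'r::comm_ring_1" and M :: "('n::finite expo \<Rightarrow>\<^sub>0 'r, 'b, 'm) module_scheme" (structure)
    and r :: nat and m :: "nat \<Rightarrow> int" and p :: "(nat \<Rightarrow> ('n expo \<Rightarrow>\<^sub>0 'r)) \<Rightarrow> 'b"
  assumes abelian_group_M: "abelian_group M"
    and p_closed: "v \<in> finvecs r \<Longrightarrow> p v \<in> carrier M"
    and p_add: "v \<in> finvecs r \<Longrightarrow> w \<in> finvecs r \<Longrightarrow> p (v + w) = p v \<oplus> p w"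
    and p_smult: "v \<in> finvecs r \<Longrightarrow> p (\<lambda>b. weyl_mult t c (v b)) = c \<odot>\<^bsub>M\<^esub> p v"
begin

definition F :: "int \<Rightarrow> 'b set" where "F j = p ` L_filt r m j"

definition q :: "(nat \<Rightarrow> ('n expo \<Rightarrow>\<^sub>0 'r)) \<Rightarrow> int \<Rightarrow> 'b set" where
  "q v = (\<lambda>j. F (j - 1) +> p (symbol_vec m j v))"

lemma p_0: "p 0 = \<zero>"
proof -
  interpret abelian_group M by (rule abelian_group_M)
  have "p 0 \<oplus> p 0 = p 0"
    using p_add[of 0 0] by simp
  then show ?thesis by (rule add_idem_zero[OF p_closed[OF finvecs_closed(1)]])
qed

lemma p_diff:
  assumes "v \<in> finvecs r" "w \<in> finvecs r"
  shows "p (v - w) = p v \<oplus> \<ominus> p w"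
proof -
  interpret abelian_group M by (rule abelian_group_M)
  have d: "v - w \<in> finvecs r" using assms by simp
  have "p v = p ((v - w) + w)" by simp
  also have "\<dots> = p (v - w) \<oplus> p w" by (rule p_add[OF d assms(2)])
  finally have "p v \<oplus> \<ominus> p w = p (v - w) \<oplus> (p w \<oplus> \<ominus> p w)"
    using p_closed[OF d] p_closed[OF assms(2)] by (simp only: a_assoc a_inv_closed)
  then show ?thesis using p_closed[OF d] p_closed[OF assms(2)] by (simp add: r_neg)
qed

lemma p_sum:
  assumes "\<And>a. a \<in> A \<Longrightarrow> f a \<in> finvecs r"
  shows "p (\<Sum>a\<in>A. f a) = (\<Oplus>a\<in>A. p (f a))"
proof -
  interpret abelian_group M by (rule abelian_group_M)
  show ?thesis using assms
  proof (induction A rule: infinite_finite_induct)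
    case (infinite A)
    then show ?case by (simp only: sum.infinite finsum_infinite p_0 not_False_eq_True)
  next
    case empty
    then show ?case by (simp only: sum.empty finsum_empty p_0)
  next
    case (insert a A)
    have "p (f a + sum f A) = p (f a) \<oplus> p (sum f A)"
      using insert by (intro p_add finvecs_sum) auto
    with insert show ?case by (subst finsum_insert) (auto simp: p_closed)
  qed
qed

lemma abelian_subgroup_F: "abelian_subgroup (F j) M"
proof (rule abelian_subgroupI3[OF _ abelian_group_M], rule additive_subgroupI)
  interpret abelian_group M by (rule abelian_group_M)
  show "subgroup (F j) (add_monoid M)"
  proof
    show "F j \<subseteq> carrier (add_monoid M)"
      using L_filt_finvecs p_closed by (fastforce simp: F_def)
    show "\<one>\<^bsub>add_monoid M\<^esub> \<in> F j"
      unfolding F_def by (rule image_eqI[OF _ L_filt_0]) (simp add: p_0)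
    show "x \<otimes>\<^bsub>add_monoid M\<^esub> y \<in> F j" if xy: "x \<in> F j" "y \<in> F j" for x y
    proof -
      from xy obtain v w where vw: "v \<in> L_filt r m j" "w \<in> L_filt r m j" "x = p v" "y = p w"
        unfolding F_def by blast
      show ?thesis unfolding F_def
        by (rule image_eqI[OF _ L_filt_add[OF vw(1,2)]])
          (simp add: vw(3,4) p_add[OF L_filt_finvecs[OF vw(1)] L_filt_finvecs[OF vw(2)]])
    qed
    show "inv\<^bsub>add_monoid M\<^esub> x \<in> F j" if x: "x \<in> F j" for x
    proof -
      from x obtain v where v: "v \<in> L_filt r m j" "x = p v" unfolding F_def by blast
      have "p (0 - v) = \<zero> \<oplus> \<ominus> p v"
        using p_diff[OF finvecs_closed(1) L_filt_finvecs[OF v(1)]] by (simp only: p_0)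
      then have "inv\<^bsub>add_monoid M\<^esub> x = p (0 - v)"
        using p_closed[OF L_filt_finvecs[OF v(1)]] by (simp add: v(2) a_inv_def[symmetric])
      then show ?thesis unfolding F_def by (rule image_eqI[OF _ L_filt_diff[OF L_filt_0 v(1)]])
    qed
  qed
qed

lemma coset_eq_iff:
  assumes v: "v \<in> finvecs r" and w: "w \<in> finvecs r"
  shows "F j +> p v = F j +> p w \<longleftrightarrow> p (v - w) \<in> F j"
proof -
  interpret abelian_subgroup "F j" M by (rule abelian_subgroup_F)
  have "p (v - w) \<in> F j \<longleftrightarrow> p v \<in> F j +> p w"
    using a_rcos_module[OF p_closed[OF w] p_closed[OF v]] by (simp only: p_diff[OF v w])
  also have "\<dots> \<longleftrightarrow> F j +> p v = F j +> p w"
    using a_rcos_self[OF p_closed[OF v]] a_repr_independence[OF _ p_closed[OF w] a_subgroup, of "p v"]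
    by metis
  finally show ?thesis by simp
qed

lemma coset_0: "F j +> p 0 = F j"
proof -
  interpret abelian_subgroup "F j" M by (rule abelian_subgroup_F)
  show ?thesis unfolding p_0 by (rule a_coset_add_zero[OF a_subset])
qed

text \<open>
  In the class of \<open>p w\<close> modulo \<open>F (j - 1)\<close> only the leading part of \<open>w\<close> matters.
\<close>

lemma coset_symbol_vec:
  assumes "w \<in> L_filt r m j"
  shows "F (j - 1) +> p (symbol_vec m j w) = F (j - 1) +> p w"
proof -
  have w: "w \<in> finvecs r" "symbol_vec m j w \<in> L_filt r m j"
    using assms by (auto intro: L_filt_finvecs symbol_vec_L_filt)
  have "w - symbol_vec m j w \<in> L_filt r m (j - 1)"
    by (rule L_filt_pred[OF L_filt_diff[OF assms w(2)]]) (simp add: symbol_vec_diff symbol_vec_symbol_vec)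
  then have "p (w - symbol_vec m j w) \<in> F (j - 1)" unfolding F_def by (rule imageI)
  then show ?thesis using coset_eq_iff[OF w(1) L_filt_finvecs[OF w(2)], of "j - 1"] by simp
qed

lemma symbol_vec_finvecs: "v \<in> finvecs r \<Longrightarrow> symbol_vec m j v \<in> finvecs r"
  by (rule L_filt_finvecs[OF symbol_vec_L_filt])

lemma q_0: "q 0 = (\<lambda>j. F (j - 1))"
proof -
  have "symbol_vec m j (0 :: nat \<Rightarrow> ('n expo \<Rightarrow>\<^sub>0 'r)) = 0" for j by (rule ext) (simp add: symbol_vec_def)
  then show ?thesis by (simp only: q_def coset_0)
qed

lemma q_eq_0_iff:
  "v \<in> finvecs r \<Longrightarrow> q v = (\<lambda>j. F (j - 1)) \<longleftrightarrow> (\<forall>j. p (symbol_vec m j v) \<in> F (j - 1))"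
  unfolding q_def fun_eq_iff
  using coset_eq_iff[OF symbol_vec_finvecs finvecs_closed(1), of v _ _] coset_0 by (metis diff_0_right)

lemma q_add:
  assumes "v \<in> finvecs r" "w \<in> finvecs r"
  shows "q (v + w) = (\<lambda>j. q v j <+> q w j)"
proof
  fix j
  interpret abelian_subgroup "F (j - 1)" M by (rule abelian_subgroup_F)
  show "q (v + w) j = q v j <+> q w j"
    unfolding q_def symbol_vec_add p_add[OF symbol_vec_finvecs[OF assms(1)] symbol_vec_finvecs[OF assms(2)]]
    by (rule a_rcos_sum[symmetric]) (use assms in \<open>simp_all add: p_closed symbol_vec_finvecs\<close>)
qed

text \<open>
  The scalar multiplication \<open>gr_smult\<close> is a union over all representatives \<open>x\<close> of the classes. Every such \<open>x\<close>
  lifts to vectors \<open>w i\<close> with the same leading parts as \<open>v\<close>, and the leading part of a product is the product of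
  the leading parts; therefore all representatives give the same coset.
\<close>

lemma q_smult:
  assumes v: "v \<in> finvecs r"
  shows "q (\<lambda>b. s * v b) = gr_smult M F s (q v)"
proof
  fix j
  let ?D = "(\<lambda>\<mu>. int (mdeg \<mu>)) ` Poly_Mapping.keys s"
  have coset: "F (j - 1) +> (\<Oplus>d\<in>?D. L_part d s \<odot>\<^bsub>M\<^esub> x (j - d)) = q (\<lambda>b. s * v b) j"
    if x: "x \<in> Pi UNIV (q v)" for x
  proof -
    have "\<exists>w. w \<in> L_filt r m i \<and> symbol_vec m i w = symbol_vec m i v \<and> x i = p w" for i
    proof -
      from x have "x i \<in> F (i - 1) +> p (symbol_vec m i v)" by (simp add: q_def Pi_iff)
      then obtain u where u: "u \<in> L_filt r m (i - 1)" "x i = p u \<oplus> p (symbol_vec m i v)"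
        unfolding a_r_coset_def' F_def by blast
      have "symbol_vec m i (u + symbol_vec m i v) = symbol_vec m i v"
        using symbol_vec_eq_0[OF u(1), of i] by (simp add: symbol_vec_add symbol_vec_symbol_vec)
      moreover have "u + symbol_vec m i v \<in> L_filt r m i"
        by (rule L_filt_add[OF L_filt_mono[OF u(1)] symbol_vec_L_filt[OF v]]) simp
      moreover have "x i = p (u + symbol_vec m i v)"
        by (simp only: u(2) p_add[OF L_filt_finvecs[OF u(1)] symbol_vec_finvecs[OF v]])
      ultimately show ?thesis by blast
    qed
    then obtain w where w: "\<And>i. w i \<in> L_filt r m i" "\<And>i. symbol_vec m i (w i) = symbol_vec m i v" "\<And>i. x i = p (w i)"
      by metis
    \<comment> \<open>the lift of the part of s * v to which the component of s of degree d contributes\<close>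
    define g where "g d = (\<lambda>b. weyl_mult t (L_part d s) (w (j - d) b))" for d
    have g: "g d \<in> L_filt r m j" for d
    proof -
      have "weyl_mult t (L_part d s) (w (j - d) b) \<in> L_le (j - m b)" if "b < r" for b
        using weyl_mult_L_le[OF L_part_in_L_le[of d d s], of "w (j - d) b" "j - d - m b" t] w(1)[of "j - d"] that
        by (simp add: L_filt_eq)
      then show ?thesis using L_filt_finvecs[OF w(1)[of "j - d"]] by (simp add: L_filt_eq g_def finvecs_def)
    qed
    have "symbol_vec m j (\<Sum>d\<in>?D. g d) = symbol_vec m j (\<lambda>b. s * v b)"
    proof
      fix b
      have gd: "L_part (j - m b) (g d b) = L_part (j - m b) (L_part d s * v b)" for d
      proof (cases "b < r")
        case True
        have "L_part (j - d - m b) (w (j - d) b) = L_part (j - d - m b) (v b)"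
          using fun_cong[OF w(2)[of "j - d"], of b] by (simp add: symbol_vec_def)
        moreover have "L_part (d + (j - d - m b)) (g d b) = L_part d (L_part d s) * L_part (j - d - m b) (w (j - d) b)"
          unfolding g_def
          by (rule L_part_mult_L_le[OF L_part_in_L_le[OF order_refl]]) (use w(1)[of "j - d"] True in \<open>simp add: L_filt_eq\<close>)
        moreover have "L_part ((j - d - m b) + d) (v b * L_part d s) = L_part (j - d - m b) (v b) * L_part d s"
          by (rule L_part_mult) (simp add: L_part_L_part)
        ultimately show ?thesis by (simp add: L_part_L_part mult.commute)
      next
        case False
        then show ?thesis using v L_filt_finvecs[OF w(1)[of "j - d"]] by (simp add: g_def finvecs_def)
      qed
      have "symbol_vec m j (\<Sum>d\<in>?D. g d) b = (\<Sum>d\<in>?D. L_part (j - m b) (L_part d s * v b))"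
        by (simp add: symbol_vec_def sum_fun_apply L_part_sum gd)
      also have "\<dots> = L_part (j - m b) ((\<Sum>d\<in>?D. L_part d s) * v b)"
        by (simp only: L_part_sum sum_distrib_right)
      also have "(\<Sum>d\<in>?D. L_part d s) = s" by (rule sum_L_part[symmetric]) auto
      finally show "symbol_vec m j (\<Sum>d\<in>?D. g d) b = symbol_vec m j (\<lambda>b. s * v b) b" by (simp add: symbol_vec_def)
    qed
    moreover have "(\<Sum>d\<in>?D. g d) \<in> L_filt r m j" by (intro L_filt_sum g)
    ultimately have "F (j - 1) +> p (\<Sum>d\<in>?D. g d) = q (\<lambda>b. s * v b) j"
      using coset_symbol_vec[of "\<Sum>d\<in>?D. g d" j] by (simp only: q_def)
    moreover have "p (\<Sum>d\<in>?D. g d) = (\<Oplus>d\<in>?D. L_part d s \<odot>\<^bsub>M\<^esub> x (j - d))"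
    proof -
      have "p (g d) = L_part d s \<odot>\<^bsub>M\<^esub> x (j - d)" for d
        unfolding g_def w(3) by (rule p_smult[OF L_filt_finvecs[OF w(1)]])
      then show ?thesis using p_sum[of ?D g, OF L_filt_finvecs[OF g]] by simp
    qed
    ultimately show ?thesis by simp
  qed
  have "(\<lambda>i. p (symbol_vec m i v)) \<in> Pi UNIV (q v)"
  proof
    fix i
    interpret abelian_subgroup "F (i - 1)" M by (rule abelian_subgroup_F)
    show "p (symbol_vec m i v) \<in> q v i" unfolding q_def by (rule a_rcos_self[OF p_closed[OF symbol_vec_finvecs[OF v]]])
  qed
  with coset show "q (\<lambda>b. s * v b) j = gr_smult M F s (q v) j"
    unfolding gr_smult_def by blast
qed

text \<open>
  An element of the associated graded module has finitely many nonzero components. So the leading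
  parts of lifts of its components can be added up to one vector.
\<close>

lemma gr_lift:
  assumes f: "f \<in> gr_carrier M F" and w: "\<And>j. w j \<in> L_filt r m j" "\<And>j. f j = F (j - 1) +> p (w j)"
  shows "q (\<Sum>j | f j \<noteq> F (j - 1). symbol_vec m j (w j)) = f"
proof
  fix j
  let ?J = "{j. f j \<noteq> F (j - 1)}"
  have fin: "finite ?J" using f by (simp add: gr_carrier_def)
  have "symbol_vec m j (\<Sum>i\<in>?J. symbol_vec m i (w i)) = (\<Sum>i\<in>?J. if j = i then symbol_vec m j (w j) else 0)"
    unfolding symbol_vec_sum by (intro sum.cong refl) (simp add: symbol_vec_symbol_vec)
  also have "\<dots> = (if j \<in> ?J then symbol_vec m j (w j) else 0)" using fin by (simp add: sum.delta)
  finally have s: "symbol_vec m j (\<Sum>i\<in>?J. symbol_vec m i (w i)) = (if j \<in> ?J then symbol_vec m j (w j) else 0)" .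
  show "q (\<Sum>j\<in>?J. symbol_vec m j (w j)) j = f j"
  proof (cases "j \<in> ?J")
    case True
    then show ?thesis using s coset_symbol_vec[OF w(1)] w(2) by (simp only: q_def if_True)
  next
    case False
    then show ?thesis using s coset_0 by (simp add: q_def)
  qed
qed

lemma q_onto: "gr_carrier M F = q ` finvecs r"
proof (intro equalityI subsetI)
  fix f assume f: "f \<in> gr_carrier M F"
  then have "\<forall>j. \<exists>w. w \<in> L_filt r m j \<and> f j = F (j - 1) +> p w"
    unfolding gr_carrier_def by (auto simp: F_def)
  then obtain w where w: "\<And>j. w j \<in> L_filt r m j" "\<And>j. f j = F (j - 1) +> p (w j)" by metis
  have "(\<Sum>j | f j \<noteq> F (j - 1). symbol_vec m j (w j)) \<in> finvecs r"
    by (intro finvecs_sum symbol_vec_finvecs L_filt_finvecs[OF w(1)])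
  from imageI[OF this, of q] show "f \<in> q ` finvecs r" unfolding gr_lift[OF f w] .
next
  fix f assume "f \<in> q ` finvecs r"
  then obtain v where v: "v \<in> finvecs r" "f = q v" by blast
  have "\<exists>x\<in>F j. f j = F (j - 1) +> x" for j
    using symbol_vec_L_filt[OF v(1), of m j] unfolding v(2) q_def F_def by blast
  moreover have "finite {j. f j \<noteq> F (j - 1)}"
  proof -
    obtain D where D: "finite D" "\<And>d. d \<notin> D \<Longrightarrow> symbol_vec m d v = 0"
      using vec_decomposition[of L_part v r m, OF L_part_decomposition v(1)] unfolding symbol_vec_def by auto
    have "{j. f j \<noteq> F (j - 1)} \<subseteq> D"
      using D(2) coset_0 unfolding v(2) q_def by force
    then show ?thesis using D(1) by (rule finite_subset)
  qed
  ultimately show "f \<in> gr_carrier M F" by (simp add: gr_carrier_def)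
qed

end

lemma (in left_module) smult_zero_right: "a \<in> carrier R \<Longrightarrow> a \<odot>\<^bsub>M\<^esub> \<zero>\<^bsub>M\<^esub> = \<zero>\<^bsub>M\<^esub>"
proof -
  assume a: "a \<in> carrier R"
  have c: "a \<odot>\<^bsub>M\<^esub> \<zero>\<^bsub>M\<^esub> \<in> carrier M" using a by (simp add: smult_closed)
  have "a \<odot>\<^bsub>M\<^esub> \<zero>\<^bsub>M\<^esub> \<oplus>\<^bsub>M\<^esub> a \<odot>\<^bsub>M\<^esub> \<zero>\<^bsub>M\<^esub> = a \<odot>\<^bsub>M\<^esub> \<zero>\<^bsub>M\<^esub>"
    using smult_r_distr[OF a M.zero_closed M.zero_closed] by simp
  then show ?thesis by (rule M.add_idem_zero[OF c])
qed

lemma (in left_module) smult_finsum: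
  assumes a: "a \<in> carrier R" and f: "f \<in> A \<rightarrow> carrier M"
  shows "a \<odot>\<^bsub>M\<^esub> finsum M f A = (\<Oplus>\<^bsub>M\<^esub>i\<in>A. a \<odot>\<^bsub>M\<^esub> f i)"
  using f
proof (induction A rule: infinite_finite_induct)
  case (insert x A)
  have "a \<odot>\<^bsub>M\<^esub> finsum M f (insert x A) = a \<odot>\<^bsub>M\<^esub> f x \<oplus>\<^bsub>M\<^esub> a \<odot>\<^bsub>M\<^esub> finsum M f A"
    using insert.prems insert.hyps a by (subst M.finsum_insert) (auto simp: smult_r_distr)
  also have "\<dots> = (\<Oplus>\<^bsub>M\<^esub>i\<in>insert x A. a \<odot>\<^bsub>M\<^esub> f i)"
    using insert a by (subst M.finsum_insert) (auto simp: smult_closed Pi_iff)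
  finally show ?case .
qed (simp_all add: smult_zero_right a)

lemma filtered_presentation_gen_map:
  fixes M :: "('n::finite expo \<Rightarrow>\<^sub>0 'r::comm_ring_1, 'b, 'm) module_scheme"
  assumes M: "left_module (weyl_at t) M" and e: "\<And>a. a < r \<Longrightarrow> e a \<in> carrier M"
  shows "filtered_presentation t M r (gen_map M r e)"
proof -
  interpret left_module "weyl_at t" M by (rule M)
  have c: "(x :: 'n expo \<Rightarrow>\<^sub>0 'r) \<in> carrier (weyl_at t)" for x by (simp add: weyl_at_def)
  have cl: "v a \<odot>\<^bsub>M\<^esub> e a \<in> carrier M" if "a < r" for v a using smult_closed[OF c e[OF that]] .
  show ?thesis
  proof
    fix v w :: "nat \<Rightarrow> 'n expo \<Rightarrow>\<^sub>0 'r" and x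
    show "gen_map M r e v \<in> carrier M" unfolding gen_map_def
      by (rule M.finsum_closed) (simp add: cl)
    have "(v + w) a \<odot>\<^bsub>M\<^esub> e a = v a \<odot>\<^bsub>M\<^esub> e a \<oplus>\<^bsub>M\<^esub> w a \<odot>\<^bsub>M\<^esub> e a" if "a < r" for a
      using smult_l_distr[OF c c e[OF that], of "v a" "w a"] by (simp add: weyl_at_def)
    then have "gen_map M r e (v + w) = (\<Oplus>\<^bsub>M\<^esub>a\<in>{..<r}. v a \<odot>\<^bsub>M\<^esub> e a \<oplus>\<^bsub>M\<^esub> w a \<odot>\<^bsub>M\<^esub> e a)"
      unfolding gen_map_def by (intro M.finsum_cong') (auto simp: cl)
    also have "\<dots> = gen_map M r e v \<oplus>\<^bsub>M\<^esub> gen_map M r e w"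
      unfolding gen_map_def by (rule M.finsum_addf) (auto simp: cl)
    finally show "gen_map M r e (v + w) = gen_map M r e v \<oplus>\<^bsub>M\<^esub> gen_map M r e w" .
    have "weyl_mult t x (v a) \<odot>\<^bsub>M\<^esub> e a = x \<odot>\<^bsub>M\<^esub> (v a \<odot>\<^bsub>M\<^esub> e a)" if "a < r" for a
      using smult_assoc[OF c c e[OF that], of x "v a"] by (simp add: mult_weyl_at)
    then have "gen_map M r e (\<lambda>b. weyl_mult t x (v b)) = (\<Oplus>\<^bsub>M\<^esub>a\<in>{..<r}. x \<odot>\<^bsub>M\<^esub> (v a \<odot>\<^bsub>M\<^esub> e a))"
      unfolding gen_map_def by (intro M.finsum_cong') (auto simp: c cl smult_closed)
    also have "\<dots> = x \<odot>\<^bsub>M\<^esub> gen_map M r e v"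
      unfolding gen_map_def by (rule smult_finsum[OF c, symmetric]) (auto simp: cl)
    finally show "gen_map M r e (\<lambda>b. weyl_mult t x (v b)) = x \<odot>\<^bsub>M\<^esub> gen_map M r e v" .
  qed
qed

text \<open>
  \<open>gr M\<close> is graded by the \<open>L\<close>-degree: the component of \<open>q v\<close> in degree \<open>d\<close> is the image of the part of \<open>v\<close> of
  degree \<open>d\<close>. This yields both the description of the homogeneous elements and the homogeneity of the kernel.
\<close>

lemma graded_quotient_gr_D:
  fixes M :: "('n::finite expo \<Rightarrow>\<^sub>0 'k::field_char_0, 'b, 'm) module_scheme"
  assumes "left_module weyl_algebra M" and "\<And>a. a < r \<Longrightarrow> e a \<in> carrier M"
  shows "graded_quotient poly_S L_part (\<lambda>P. lk P 0) (gr_D M r m e) r m (filtered_presentation.q M r m (gen_map M r e))"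
proof -
  interpret fp: filtered_presentation 1 M r m "gen_map M r e"
    by (rule filtered_presentation_gen_map) (use assms in \<open>simp_all add: weyl_algebra_eq\<close>)
  have F: "img_filt M r m e = fp.F" by (simp add: fun_eq_iff img_filt_def fp.F_def)
  have N: "gr_D M r m e = gr_module M fp.F (\<lambda>d. {f \<in> gr_carrier M fp.F. \<forall>j. j \<noteq> d \<longrightarrow> f j = fp.F (j - 1)})"
    by (simp only: gr_D_def F Let_def)
  have part: "fp.q (symbol_vec m d v) j = (if j = d then fp.q v d else fp.F (j - 1))" for d v j
    using fp.coset_0 by (simp add: fp.q_def symbol_vec_symbol_vec)
  show ?thesis
  proof (rule graded_quotient.intro[OF connected_graded_poly_S], unfold_locales)
    show "carrier (gr_D M r m e) = fp.q ` finvecs r" by (simp add: N gr_module_def fp.q_onto)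
    show "fp.q (v + w) = fp.q v \<oplus>\<^bsub>gr_D M r m e\<^esub> fp.q w" if "v \<in> finvecs r" "w \<in> finvecs r" for v w
      using fp.q_add[OF that] by (simp add: N gr_module_def)
    show "fp.q (\<lambda>b. c \<otimes>\<^bsub>poly_S\<^esub> v b) = c \<odot>\<^bsub>gr_D M r m e\<^esub> fp.q v" if "v \<in> finvecs r" for c v
      using fp.q_smult[OF that] by (simp add: N gr_module_def mult_poly_S)
    show "fp.q 0 = \<zero>\<^bsub>gr_D M r m e\<^esub>" using fp.q_0 by (simp add: N gr_module_def)
    show "mgrade (gr_D M r m e) d = fp.q ` {v \<in> finvecs r. \<forall>b<r. v b \<in> rgrade poly_S (d - m b)}" for d
    proof -
      have "{f \<in> gr_carrier M fp.F. \<forall>j. j \<noteq> d \<longrightarrow> f j = fp.F (j - 1)}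
        = fp.q ` {v \<in> finvecs r. \<forall>b<r. v b \<in> rgrade poly_S (d - m b)}"
      proof (intro equalityI subsetI)
        fix f assume f: "f \<in> {f \<in> gr_carrier M fp.F. \<forall>j. j \<noteq> d \<longrightarrow> f j = fp.F (j - 1)}"
        then obtain v where v: "v \<in> finvecs r" "f = fp.q v" using fp.q_onto by auto
        have "f = fp.q (symbol_vec m d v)" using f part[of d v] by (auto simp: v(2) fun_eq_iff)
        moreover have "symbol_vec m d v \<in> {v \<in> finvecs r. \<forall>b<r. v b \<in> rgrade poly_S (d - m b)}"
          using fp.symbol_vec_finvecs[OF v(1)] by (simp add: rgrade_poly_S symbol_vec_def L_part_L_part)
        ultimately show "f \<in> fp.q ` {v \<in> finvecs r. \<forall>b<r. v b \<in> rgrade poly_S (d - m b)}" by blast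
      next
        fix f assume "f \<in> fp.q ` {v \<in> finvecs r. \<forall>b<r. v b \<in> rgrade poly_S (d - m b)}"
        then obtain v where v: "v \<in> finvecs r" "\<And>b. b < r \<Longrightarrow> L_part (d - m b) (v b) = v b" "f = fp.q v"
          by (auto simp: rgrade_poly_S)
        have "symbol_vec m d v = v"
        proof
          show "symbol_vec m d v b = v b" for b
            using v(1,2) by (cases "b < r") (simp_all add: symbol_vec_def finvecs_def)
        qed
        then have "f j = fp.F (j - 1)" if "j \<noteq> d" for j using part[of d v j] that by (simp add: v(3))
        then show "f \<in> {f \<in> gr_carrier M fp.F. \<forall>j. j \<noteq> d \<longrightarrow> f j = fp.F (j - 1)}"
          using v by (simp add: fp.q_onto)
      qed
      then show ?thesis by (simp add: N gr_module_def)
    qed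
    show "fp.q (\<lambda>b. L_part (d - m b) (v b)) = \<zero>\<^bsub>gr_D M r m e\<^esub>" if "fp.q v = \<zero>\<^bsub>gr_D M r m e\<^esub>" for v d
    proof -
      from that have "fp.q v = (\<lambda>j. fp.F (j - 1))" by (simp add: N gr_module_def)
      then have "fp.q (symbol_vec m d v) = (\<lambda>j. fp.F (j - 1))" using part[of d v] by (auto simp: fun_eq_iff)
      then show ?thesis by (simp add: N gr_module_def symbol_vec_def)
    qed
  qed
qed

section \<open>The three graded modules\<close>

definition basis_vec :: "nat \<Rightarrow> nat \<Rightarrow> ('n::finite expo \<Rightarrow>\<^sub>0 'r::comm_ring_1)" where
  "basis_vec a = (\<lambda>b. if a = b then 1 else 0)"

lemma unitvec_hom_weyl_at: "hweyl.unitvec c = basis_vec"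
  by (auto simp: fun_eq_iff hweyl.unitvec_def basis_vec_def mult_hom_weyl_at)

lemma basis_vec_hgrade_vec: "a < r \<Longrightarrow> basis_vec a \<in> hgrade_vec r m (m a)"
  by (auto simp: hgrade_vec_def basis_vec_def finvecs_def hgrade_def lookup_one when_def mdeg_0 split: if_splits)

lemma hom_image_eq: "hom_image r n \<Phi> = mat_map (hom_weyl_at 1) (r 1) (r 0) (homogenize_matrix (n 1) (n 0) (\<Phi> 1)) ` finvecs (r 1)"
  by (simp only: hom_image_def hom_weyl_algebra_eq hweyl.free_carrier_eq)

lemma graded_quotient_hom_module:
  assumes "filtered_matrix (r 1) (n 1) (r 0) (n 0) (\<Phi> 1)"
  shows "graded_quotient (hom_weyl_at 1) hpart (\<lambda>P. poly (lk P 0) 0) (hom_module r n \<Phi>) (r 0) (n 0) (hom_proj r n \<Phi>)"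
    and "v \<in> finvecs (r 0) \<Longrightarrow> hom_proj r n \<Phi> v = \<zero>\<^bsub>hom_module r n \<Phi>\<^esub> \<longleftrightarrow> v \<in> hom_image r n \<Phi>"
proof -
  have h: "homogenize_matrix (n 1) (n 0) (\<Phi> 1) a b \<in> rgrade (hom_weyl_at 1) (n 1 a - n 0 b)"
    if "a < r 1" "b < r 0" for a b
    using homogenize_matrix_hgrade[OF assms that] by (simp add: mult_hom_weyl_at)
  have p: "hom_proj r n \<Phi> = (\<lambda>v. hom_image r n \<Phi> +>\<^bsub>graded_free_module (hom_weyl_at 1) (r 0) (n 0)\<^esub> v)"
    by (simp only: fun_eq_iff hom_proj_def hom_weyl_algebra_eq) simp
  show "graded_quotient (hom_weyl_at 1) hpart (\<lambda>P. poly (lk P 0) 0) (hom_module r n \<Phi>) (r 0) (n 0) (hom_proj r n \<Phi>)"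
    unfolding p hom_module_def hom_image_def hom_weyl_algebra_eq
    by (rule hweyl.graded_quotient_cokernel(1)[where l = "n 1"]) (rule h)
  show "hom_proj r n \<Phi> v = \<zero>\<^bsub>hom_module r n \<Phi>\<^esub> \<longleftrightarrow> v \<in> hom_image r n \<Phi>" if "v \<in> finvecs (r 0)"
    using hweyl.graded_quotient_cokernel(2)[where l = "n 1", OF h that]
    unfolding p hom_module_def hom_image_def hom_weyl_algebra_eq by (simp add: quotient_module_def)
qed

lemma hpart_vec_add: "hpart_vec m d (v + w) = hpart_vec m d v + hpart_vec m d w"
  by (rule ext) (simp add: hpart_vec_def hpart_add)

lemma hpart_vec_diff: "hpart_vec m d (v - w) = hpart_vec m d v - hpart_vec m d w"
  using hpart_vec_add[of m d "v - w" w] by simp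

lemma hpart_vec_hgrade_vec_id: "v \<in> hgrade_vec r m d \<Longrightarrow> hpart_vec m d v = v"
proof
  fix a assume "v \<in> hgrade_vec r m d"
  then show "hpart_vec m d v a = v a"
    using hpart_hgrade[of "v a" "d - m a" "d - m a"]
    by (cases "a < r") (simp_all add: hpart_vec_def hgrade_vec_def finvecs_def hweyl.hp_0)
qed

lemma L_part_hpart: "L_part d (hpart d' P) = hpart d' (L_part d P)"
  by (rule coeff_eqI) (simp add: lookup_L_part coeff_hpart)

lemma symbol_vec_hpart_vec: "symbol_vec m j (hpart_vec m d v) = hpart_vec m d (symbol_vec m j v)"
  by (simp add: symbol_vec_def hpart_vec_def L_part_hpart)

lemma hgrade_vec_sum: "(\<And>i. i \<in> I \<Longrightarrow> v i \<in> hgrade_vec r m d) \<Longrightarrow> (\<Sum>i\<in>I. v i) \<in> hgrade_vec r m d"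
  by (auto simp: hgrade_vec_def finvecs_def sum_fun_apply intro!: hgrade_sum)

lemma symbol_vec_hgrade_vec: "v \<in> hgrade_vec r m d \<Longrightarrow> symbol_vec m j v \<in> hgrade_vec r m d"
proof -
  assume v: "v \<in> hgrade_vec r m d"
  then have "symbol_vec m j v = hpart_vec m d (symbol_vec m j v)" using symbol_vec_hpart_vec[of m j d v] hpart_vec_hgrade_vec_id[OF v] by simp
  moreover have "symbol_vec m j v \<in> finvecs r" using v by (simp add: hgrade_vec_def symbol_vec_def finvecs_def)
  ultimately show ?thesis by (metis hpart_vec_hgrade_vec)
qed

lemma filtered_presentation_hom_proj:
  assumes "filtered_matrix (r 1) (n 1) (r 0) (n 0) (\<Phi> 1)"
  shows "filtered_presentation (monom 1 2) (hom_module r n \<Phi>) (r 0) (hom_proj r n \<Phi>)"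
proof -
  interpret gq: graded_quotient "hom_weyl_at 1" hpart "\<lambda>P. poly (lk P 0) 0" "hom_module r n \<Phi>" "r 0" "n 0" "hom_proj r n \<Phi>"
    by (rule graded_quotient_hom_module) (rule assms)
  show ?thesis
  proof (rule filtered_presentation.intro)
    show "abelian_group (hom_module r n \<Phi>)" by (rule gq.abelian_group_N)
  qed (simp_all add: gq.q_onto gq.q_add gq.q_smult[unfolded mult_hom_weyl_at])
qed

text \<open>
  Here the grading by total degree and the \<open>L\<close>-filtration interact. The two are compatible, because passing to
  the homogeneous part preserves the \<open>L\<close>-filtration as well as the relations of \<open>M\<^sup>(\<^sup>h\<^sup>)\<close>. In particular, an
  element of \<open>M\<^sup>(\<^sup>h\<^sup>)\<close> that has a representative in \<open>L\<^sub>j\<close> and one of total degree \<open>d\<close> has a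
  representative with both properties.
\<close>

lemma graded_quotient_gr_hom:
  fixes \<Phi> :: "nat \<Rightarrow> nat \<Rightarrow> nat \<Rightarrow> ('n::finite expo \<Rightarrow>\<^sub>0 'k::field_char_0)"
  assumes A: "filtered_matrix (r 1) (n 1) (r 0) (n 0) (\<Phi> 1)"
  shows "graded_quotient (hom_weyl_at 0) hpart (\<lambda>P. poly (lk P 0) 0) (gr_hom_module r n \<Phi>) (r 0) (n 0)
     (filtered_presentation.q (hom_module r n \<Phi>) (r 0) (n 0) (hom_proj r n \<Phi>))"
proof -
  interpret gq: graded_quotient "hom_weyl_at 1" hpart "\<lambda>P. poly (lk P 0) 0" "hom_module r n \<Phi>" "r 0" "n 0" "hom_proj r n \<Phi>"
    by (rule graded_quotient_hom_module) (rule A)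
  interpret fp: filtered_presentation "monom 1 2" "hom_module r n \<Phi>" "r 0" "n 0" "hom_proj r n \<Phi>"
    by (rule filtered_presentation_hom_proj) (rule A)
  let ?M = "hom_module r n \<Phi>" and ?p = "hom_proj r n \<Phi>"
  have grM: "mgrade ?M d = ?p ` hgrade_vec (r 0) (n 0) d" for d
    by (simp add: gq.q_grade mult_hom_weyl_at hgrade_vec_def)
  have hp_eq: "?p (hpart_vec (n 0) d v) = ?p (hpart_vec (n 0) d w)" if "v \<in> finvecs (r 0)" "w \<in> finvecs (r 0)" "?p v = ?p w" for v w d
  proof -
    have "?p (v - w) = \<zero>\<^bsub>?M\<^esub>" using gq.q_diff_eq_0[OF that(1,2)] that(3) by simp
    then have "?p (hpart_vec (n 0) d (v - w)) = \<zero>\<^bsub>?M\<^esub>"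
      unfolding hpart_vec_def using that(1,2) by (intro gq.q_ker[of "v - w" d]) simp_all
    then show ?thesis
      using gq.q_diff_eq_0[of "hpart_vec (n 0) d v" "hpart_vec (n 0) d w"] hpart_vec_hgrade_vec[OF that(1), of "n 0" d] hpart_vec_hgrade_vec[OF that(2), of "n 0" d]
      by (simp add: hpart_vec_diff hgrade_vec_def)
  qed
  define G where "G d = {f \<in> gr_carrier ?M fp.F. \<forall>j. \<exists>x \<in> fp.F j \<inter> mgrade ?M d. f j = fp.F (j - 1) +>\<^bsub>?M\<^esub> x}" for d
  have F: "fp.F = (\<lambda>j. ?p ` L_filt (r 0) (n 0) j)" by (simp add: fun_eq_iff fp.F_def)
  have N: "gr_hom_module r n \<Phi> = gr_module ?M fp.F G"
    unfolding gr_hom_module_def Let_def G_def F ..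
  have G: "G d = fp.q ` hgrade_vec (r 0) (n 0) d" for d
  proof (intro equalityI subsetI)
    fix f assume f: "f \<in> G d"
    have "\<exists>w. w \<in> L_filt (r 0) (n 0) j \<and> w \<in> hgrade_vec (r 0) (n 0) d \<and> f j = fp.F (j - 1) +>\<^bsub>?M\<^esub> ?p w" for j
    proof -
      from f obtain x where x: "x \<in> fp.F j" "x \<in> mgrade ?M d" "f j = fp.F (j - 1) +>\<^bsub>?M\<^esub> x"
        unfolding G_def by blast
      from x(1) obtain w where w: "w \<in> L_filt (r 0) (n 0) j" "x = ?p w" unfolding fp.F_def by blast
      from x(2) obtain u where u: "u \<in> hgrade_vec (r 0) (n 0) d" "x = ?p u" unfolding grM by blast
      have fin: "w \<in> finvecs (r 0)" "u \<in> finvecs (r 0)" using w u by (auto simp: hgrade_vec_def intro: L_filt_finvecs)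
      have "?p (hpart_vec (n 0) d w) = x" using hp_eq[OF fin, of d] w(2) u(2) hpart_vec_hgrade_vec_id[OF u(1)] by simp
      then show ?thesis using hpart_vec_L_filt[OF w(1), of d] hpart_vec_hgrade_vec[OF fin(1), of "n 0" d] x(3) by blast
    qed
    then obtain w where w: "\<And>j. w j \<in> L_filt (r 0) (n 0) j" "\<And>j. w j \<in> hgrade_vec (r 0) (n 0) d"
      "\<And>j. f j = fp.F (j - 1) +>\<^bsub>?M\<^esub> ?p (w j)" by metis
    have fc: "f \<in> gr_carrier ?M fp.F" using f by (simp add: G_def)
    have "(\<Sum>j | f j \<noteq> fp.F (j - 1). symbol_vec (n 0) j (w j)) \<in> hgrade_vec (r 0) (n 0) d"
      by (intro hgrade_vec_sum symbol_vec_hgrade_vec w(2))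
    from imageI[OF this, of fp.q] show "f \<in> fp.q ` hgrade_vec (r 0) (n 0) d"
      unfolding fp.gr_lift[OF fc w(1,3)] .
  next
    fix f assume "f \<in> fp.q ` hgrade_vec (r 0) (n 0) d"
    then obtain v where v: "v \<in> hgrade_vec (r 0) (n 0) d" "f = fp.q v" by blast
    have fin: "v \<in> finvecs (r 0)" using v by (simp add: hgrade_vec_def)
    have "f \<in> gr_carrier ?M fp.F" unfolding fp.q_onto v(2) using fin by (rule imageI)
    moreover have "\<exists>x \<in> fp.F j \<inter> mgrade ?M d. f j = fp.F (j - 1) +>\<^bsub>?M\<^esub> x" for j
      unfolding v(2) fp.q_def grM
      using symbol_vec_L_filt[OF fin, of "n 0" j] symbol_vec_hgrade_vec[OF v(1), of j] by (auto simp: fp.F_def)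
    ultimately show "f \<in> G d" by (simp add: G_def)
  qed
  show ?thesis
  proof (rule graded_quotient.intro[OF connected_graded_hom_weyl_at], unfold_locales)
    show "carrier (gr_hom_module r n \<Phi>) = fp.q ` finvecs (r 0)" by (simp add: N gr_module_def fp.q_onto)
    show "fp.q (v + w) = fp.q v \<oplus>\<^bsub>gr_hom_module r n \<Phi>\<^esub> fp.q w" if "v \<in> finvecs (r 0)" "w \<in> finvecs (r 0)" for v w
      using fp.q_add[OF that] by (simp add: N gr_module_def)
    show "fp.q (\<lambda>b. c \<otimes>\<^bsub>hom_weyl_at 0\<^esub> v b) = c \<odot>\<^bsub>gr_hom_module r n \<Phi>\<^esub> fp.q v" if "v \<in> finvecs (r 0)" for c v
      using fp.q_smult[OF that] by (simp add: N gr_module_def mult_hom_weyl_at weyl_mult_0_t)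
    show "fp.q 0 = \<zero>\<^bsub>gr_hom_module r n \<Phi>\<^esub>" using fp.q_0 by (simp add: N gr_module_def)
    show "mgrade (gr_hom_module r n \<Phi>) d = fp.q ` {v \<in> finvecs (r 0). \<forall>b<r 0. v b \<in> rgrade (hom_weyl_at 0) (d - n 0 b)}" for d
      by (simp add: N gr_module_def G hgrade_vec_def mult_hom_weyl_at)
    show "fp.q (\<lambda>b. hpart (d - n 0 b) (v b)) = \<zero>\<^bsub>gr_hom_module r n \<Phi>\<^esub>"
      if v: "v \<in> finvecs (r 0)" "fp.q v = \<zero>\<^bsub>gr_hom_module r n \<Phi>\<^esub>" for v d
    proof -
      have z: "\<zero>\<^bsub>gr_hom_module r n \<Phi>\<^esub> = (\<lambda>j. fp.F (j - 1))" by (simp add: N gr_module_def)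
      have "?p (symbol_vec (n 0) j (hpart_vec (n 0) d v)) \<in> fp.F (j - 1)" for j
      proof -
        have "?p (symbol_vec (n 0) j v) \<in> fp.F (j - 1)" using v(2) unfolding z fp.q_eq_0_iff[OF v(1)] by blast
        then obtain w where w: "w \<in> L_filt (r 0) (n 0) (j - 1)" "?p (symbol_vec (n 0) j v) = ?p w"
          unfolding fp.F_def by blast
        have "?p (symbol_vec (n 0) j (hpart_vec (n 0) d v)) = ?p (hpart_vec (n 0) d w)"
          unfolding symbol_vec_hpart_vec by (rule hp_eq[OF fp.symbol_vec_finvecs[OF v(1)] L_filt_finvecs[OF w(1)] w(2)])
        then show ?thesis unfolding fp.F_def using hpart_vec_L_filt[OF w(1)] by blast
      qed
      moreover have "hpart_vec (n 0) d v \<in> finvecs (r 0)" using hpart_vec_hgrade_vec[OF v(1)] by (simp add: hgrade_vec_def)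
      ultimately have "fp.q (hpart_vec (n 0) d v) = (\<lambda>j. fp.F (j - 1))" using fp.q_eq_0_iff by blast
      then show ?thesis by (simp add: z hpart_vec_def)
    qed
  qed
qed

section \<open>The two homogenized resolutions\<close>

text \<open>
  What the adapted resolution says in terms of matrices. The last part is minimality: an entry between generators
  of equal degree has \<open>L\<close>-degree at most zero, so it is equal to its own symbol, which vanishes.
\<close>

lemma L_adapted_facts:
  fixes M :: "('n::finite expo \<Rightarrow>\<^sub>0 'k::field_char_0, 'b, 'm) module_scheme"
  assumes "L_adapted_resolution M r n \<Phi> e"
  shows "filtered_matrix (r (Suc i)) (n (Suc i)) (r i) (n i) (\<Phi> (Suc i))"
    and "{v \<in> finvecs (r (Suc i)). mat_map (weyl_at 1) (r (Suc i)) (r i) (\<Phi> (Suc i)) v = 0}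
       = mat_map (weyl_at 1) (r (Suc (Suc i))) (r (Suc i)) (\<Phi> (Suc (Suc i))) ` finvecs (r (Suc (Suc i)))"
    and "{v \<in> finvecs (r (Suc i)). mat_map poly_S (r (Suc i)) (r i) (symbol_matrix (n (Suc i)) (n i) (\<Phi> (Suc i))) v = 0}
       = mat_map poly_S (r (Suc (Suc i))) (r (Suc i)) (symbol_matrix (n (Suc (Suc i))) (n (Suc i)) (\<Phi> (Suc (Suc i))))
         ` finvecs (r (Suc (Suc i)))"
    and "a < r (Suc i) \<Longrightarrow> b < r i \<Longrightarrow> n (Suc i) a = n i b \<Longrightarrow> \<Phi> (Suc i) a b = 0"
proof -
  have fz: "(\<lambda>_. 0) = (0 :: nat \<Rightarrow> 'n expo \<Rightarrow>\<^sub>0 'k)" by (simp add: zero_fun_def)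
  have z: "\<zero>\<^bsub>weyl_at 1\<^esub> = (0 :: 'n expo \<Rightarrow>\<^sub>0 'k)" "\<zero>\<^bsub>poly_S\<^esub> = (0 :: 'n expo \<Rightarrow>\<^sub>0 'k)"
    by (simp_all add: weyl_at_def poly_S_def)
  have res: "free_resolution (weyl_at 1) M r \<Phi> e"
    and adapted: "\<And>i j. mat_map (weyl_at 1) (r (Suc i)) (r i) (\<Phi> (Suc i)) ` L_filt (r (Suc i)) (n (Suc i)) j \<subseteq> L_filt (r i) (n i) j"
    and gres: "graded_min_free_resolution poly_S (gr_D M (r 0) (n 0) e) r n (\<lambda>i. symbol_matrix (n i) (n (i - 1)) (\<Phi> i))
       (\<lambda>a. gr_class M (img_filt M (r 0) (n 0) e) (n 0 a) (e a))"
    using assms by (simp_all add: L_adapted_resolution_def weyl_algebra_eq)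
  show filt: "filtered_matrix (r (Suc i)) (n (Suc i)) (r i) (n i) (\<Phi> (Suc i))" for i
    unfolding filtered_matrix_def
  proof (intro allI impI)
    fix a b assume a: "a < r (Suc i)" and b: "b < r i"
    let ?u = "weyl.unitvec 1 a :: nat \<Rightarrow> 'n expo \<Rightarrow>\<^sub>0 'k"
    have "?u \<in> L_filt (r (Suc i)) (n (Suc i)) (n (Suc i) a)"
      using a by (auto simp: L_filt_eq weyl.unitvec_def mult_weyl_at L_le_def lookup_one when_def mdeg_0 finvecs_def split: if_splits)
    then have "mat_map (weyl_at 1) (r (Suc i)) (r i) (\<Phi> (Suc i)) ?u \<in> L_filt (r i) (n i) (n (Suc i) a)"
      using adapted by blast
    then show "\<Phi> (Suc i) a b \<in> L_le (n (Suc i) a - n i b)"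
      using b by (simp add: L_filt_eq weyl.mat_map_unitvec[OF a])
  qed
  show "{v \<in> finvecs (r (Suc i)). mat_map (weyl_at 1) (r (Suc i)) (r i) (\<Phi> (Suc i)) v = 0}
       = mat_map (weyl_at 1) (r (Suc (Suc i))) (r (Suc i)) (\<Phi> (Suc (Suc i))) ` finvecs (r (Suc (Suc i)))"
    using res by (simp add: free_resolution_def weyl.free_carrier_eq z fz)
  show "{v \<in> finvecs (r (Suc i)). mat_map poly_S (r (Suc i)) (r i) (symbol_matrix (n (Suc i)) (n i) (\<Phi> (Suc i))) v = 0}
       = mat_map poly_S (r (Suc (Suc i))) (r (Suc i)) (symbol_matrix (n (Suc (Suc i))) (n (Suc i)) (\<Phi> (Suc (Suc i))))
         ` finvecs (r (Suc (Suc i)))"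
    using gres by (simp add: graded_min_free_resolution_def free_resolution_def polyS.free_carrier_eq z fz)
  show "\<Phi> (Suc i) a b = 0" if "a < r (Suc i)" "b < r i" "n (Suc i) a = n i b"
  proof -
    have "symbol_matrix (n (Suc i)) (n i) (\<Phi> (Suc i)) a b \<in> rgrade poly_S 0 \<longrightarrow>
      symbol_matrix (n (Suc i)) (n i) (\<Phi> (Suc i)) a b = 0"
      using gres that(1,2) unfolding graded_min_free_resolution_def z diff_Suc_1 by blast
    then have "L_part 0 (\<Phi> (Suc i) a b) = 0"
      by (simp add: symbol_matrix_def that(3) rgrade_poly_S L_part_L_part)
    moreover have "\<Phi> (Suc i) a b \<in> L_le 0" using filt[of i] that by (metis diff_self filtered_matrix_def)
    ultimately have "\<Phi> (Suc i) a b \<in> L_le (0 - 1)" by (rule L_le_pred[rotated])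
    then show ?thesis by (intro poly_mapping_eqI) (fastforce simp: L_le_def)
  qed
qed

lemma symbol_matrix_idem: "symbol_matrix n m (symbol_matrix n m A) = symbol_matrix n m A"
  by (simp add: fun_eq_iff symbol_matrix_def L_part_L_part)

lemma filtered_symbol_matrix: "filtered_matrix r n s m (symbol_matrix n m A)"
  by (simp add: filtered_matrix_def symbol_matrix_def L_part_in_L_le)

lemma symbol_homogenize_matrix: "symbol_matrix n m (homogenize_matrix n m A) = homogenize_matrix n m (symbol_matrix n m A)"
  by (auto simp: fun_eq_iff symbol_matrix_def homogenize_matrix_def lookup_L_part lookup_homogenize intro!: poly_mapping_eqI)

lemma hgrade_disjoint: "P \<in> hgrade d \<Longrightarrow> P \<in> hgrade d' \<Longrightarrow> P = 0 \<or> d = d'"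
  using hpart_hgrade[of P d d'] hpart_hgrade[of P d' d'] by (auto split: if_splits)

lemma exact_lift: "{v \<in> V. f v = 0} = g ` U \<Longrightarrow> w \<in> V \<Longrightarrow> f w = 0 \<Longrightarrow> \<exists>y\<in>U. g y = w"
proof -
  assume e: "{v \<in> V. f v = 0} = g ` U" and w: "w \<in> V" "f w = 0"
  from w have "w \<in> {v \<in> V. f v = 0}" by simp
  then show ?thesis unfolding e by auto
qed

text \<open>
  The case \<open>c = 1\<close> gives the resolution of \<open>M\<^sup>(\<^sup>h\<^sup>)\<close>, and the case \<open>c = 0\<close>, with the symbols of the
  given resolution as matrices \<open>A\<close>, gives that of \<open>gr M\<^sup>(\<^sup>h\<^sup>)\<close>. The two cases differ in how the kernel of \<open>q\<close>
  is identified.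
\<close>

lemma homogenized_resolution:
  fixes N :: "('n::finite expo \<Rightarrow>\<^sub>0 'k::field_char_0 poly, 'b, 'm) graded_module_scheme"
  assumes gq: "graded_quotient (hom_weyl_at c) hpart (\<lambda>P. poly (lk P 0) 0) N (r 0) (n 0) q"
    and filt: "\<And>i. filtered_matrix (r (Suc i)) (n (Suc i)) (r i) (n i) (A (Suc i))"
    and exact: "\<And>i. {v \<in> finvecs (r (Suc i)). mat_map (weyl_at c) (r (Suc i)) (r i) (A (Suc i)) v = 0}
       = mat_map (weyl_at c) (r (Suc (Suc i))) (r (Suc i)) (A (Suc (Suc i))) ` finvecs (r (Suc (Suc i)))"
    and gr_exact: "\<And>i. {v \<in> finvecs (r (Suc i)). mat_map poly_S (r (Suc i)) (r i) (symbol_matrix (n (Suc i)) (n i) (A (Suc i))) v = 0}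
       = mat_map poly_S (r (Suc (Suc i))) (r (Suc i)) (symbol_matrix (n (Suc (Suc i))) (n (Suc i)) (A (Suc (Suc i))))
         ` finvecs (r (Suc (Suc i)))"
    and min: "\<And>i a b. a < r (Suc i) \<Longrightarrow> b < r i \<Longrightarrow> n (Suc i) a = n i b \<Longrightarrow> A (Suc i) a b = 0"
    and ker: "\<And>v. v \<in> finvecs (r 0) \<Longrightarrow> q v = \<zero>\<^bsub>N\<^esub> \<longleftrightarrow>
       v \<in> mat_map (hom_weyl_at c) (r 1) (r 0) (homogenize_matrix (n 1) (n 0) (A 1)) ` finvecs (r 1)"
  shows "graded_min_free_resolution (hom_weyl_at c) N r n (\<lambda>i. homogenize_matrix (n i) (n (i - 1)) (A i)) (\<lambda>a. q (basis_vec a))"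
proof -
  interpret gq: graded_quotient "hom_weyl_at c" hpart "\<lambda>P. poly (lk P 0) 0" N "r 0" "n 0" q by (rule gq)
  have fz: "(\<lambda>_. 0) = (0 :: nat \<Rightarrow> 'n expo \<Rightarrow>\<^sub>0 'k poly)" by (simp add: zero_fun_def)
  have z: "\<zero>\<^bsub>hom_weyl_at c\<^esub> = (0 :: 'n expo \<Rightarrow>\<^sub>0 'k poly)" by (simp add: hom_weyl_at_def)
  let ?H = "\<lambda>i. mat_map (hom_weyl_at c) (r (Suc i)) (r i) (homogenize_matrix (n (Suc i)) (n i) (A (Suc i)))"
  have gen: "gen_map N (r 0) (\<lambda>a. q (basis_vec a)) v = q v" if "v \<in> finvecs (r 0)" for v
    using gq.gen_map_basis[OF that] by (simp only: unitvec_hom_weyl_at)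
  have onto: "gen_map N (r 0) (\<lambda>a. q (basis_vec a)) ` finvecs (r 0) = carrier N"
    unfolding gq.q_onto by (rule image_cong) (simp_all add: gen)
  have ker0: "{v \<in> finvecs (r 0). gen_map N (r 0) (\<lambda>a. q (basis_vec a)) v = \<zero>\<^bsub>N\<^esub>} = ?H 0 ` finvecs (r 1)"
    using ker unfolding One_nat_def by (auto simp: gen)
  have cpx: "mat_map (weyl_at c) (r (Suc i)) (r i) (A (Suc i))
      (mat_map (weyl_at c) (r (Suc (Suc i))) (r (Suc i)) (A (Suc (Suc i))) v) = 0"
    if "v \<in> finvecs (r (Suc (Suc i)))" for i v
    using exact[of i] that by blast
  have kerS: "{v \<in> finvecs (r (Suc i)). ?H i v = 0} = ?H (Suc i) ` finvecs (r (Suc (Suc i)))" for i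
  proof (intro equalityI subsetI)
    fix v assume v: "v \<in> {v \<in> finvecs (r (Suc i)). ?H i v = 0}"
    have "\<exists>w\<in>finvecs (r (Suc (Suc i))). ?H (Suc i) w = v"
    proof (rule exact_hom[OF filt filt filt _ cpx])
      show "\<exists>y. mat_map poly_S (r (Suc (Suc (Suc i)))) (r (Suc (Suc i)))
          (symbol_matrix (n (Suc (Suc (Suc i)))) (n (Suc (Suc i))) (A (Suc (Suc (Suc i))))) y = w"
        if "w \<in> finvecs (r (Suc (Suc i)))" "mat_map poly_S (r (Suc (Suc i))) (r (Suc i))
          (symbol_matrix (n (Suc (Suc i))) (n (Suc i)) (A (Suc (Suc i)))) w = 0" for w
        using exact_lift[OF gr_exact[of "Suc i"], of w] that by blast
      show "\<exists>y\<in>finvecs (r (Suc (Suc i))). mat_map (weyl_at c) (r (Suc (Suc i))) (r (Suc i)) (A (Suc (Suc i))) y = w"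
        if "w \<in> finvecs (r (Suc i))" "mat_map (weyl_at c) (r (Suc i)) (r i) (A (Suc i)) w = 0" for w
        using exact_lift[OF exact[of i], of w] that by blast
    qed (use v in simp_all)
    then show "v \<in> ?H (Suc i) ` finvecs (r (Suc (Suc i)))" by blast
  next
    fix v assume "v \<in> ?H (Suc i) ` finvecs (r (Suc (Suc i)))"
    then obtain w where w: "w \<in> finvecs (r (Suc (Suc i)))" "v = ?H (Suc i) w" by blast
    have "?H i v = 0" unfolding w(2) by (rule complex_hom[OF filt filt cpx w(1)])
    then show "v \<in> {v \<in> finvecs (r (Suc i)). ?H i v = 0}" by (simp add: w(2))
  qed
  have deg: "homogenize_matrix (n (Suc i)) (n i) (A (Suc i)) a b \<in> hgrade (n (Suc i) a - n i b)"
    if "a < r (Suc i)" "b < r i" for i a b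
    by (rule homogenize_matrix_hgrade[OF filt that])
  have min': "homogenize_matrix (n (Suc i)) (n i) (A (Suc i)) a b = 0"
    if ab: "a < r (Suc i)" "b < r i" and 0: "homogenize_matrix (n (Suc i)) (n i) (A (Suc i)) a b \<in> hgrade 0" for i a b
    using hgrade_disjoint[OF deg[OF ab] 0]
  proof
    assume "n (Suc i) a - n i b = 0"
    then show ?thesis using min[OF ab] by (simp add: homogenize_matrix_def homogenize_0)
  qed
  have e: "q (basis_vec a) \<in> mgrade N (n 0 a)" "q (basis_vec a) \<in> carrier N" if "a < r 0" for a
    using basis_vec_hgrade_vec[OF that, of "n 0"] by (auto simp: gq.q_grade gq.q_onto hgrade_vec_def mult_hom_weyl_at)
  show ?thesis
    unfolding graded_min_free_resolution_def free_resolution_def hweyl.free_carrier_eq z fz mult_hom_weyl_at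
      hweyl.carrier_R
    using e onto ker0 kerS deg min' by (simp add: diff_Suc_1)
qed

lemma resolution_hom_module:
  fixes M :: "('n::finite expo \<Rightarrow>\<^sub>0 'k::field_char_0, 'b, 'm) module_scheme"
  assumes "L_adapted_resolution M r n \<Phi> e"
  shows "graded_min_free_resolution (hom_weyl_at 1) (hom_module r n \<Phi>) r n
     (\<lambda>i. homogenize_matrix (n i) (n (i - 1)) (\<Phi> i)) (\<lambda>a. hom_proj r n \<Phi> (basis_vec a))"
proof -
  note facts = L_adapted_facts[OF assms]
  have A: "filtered_matrix (r 1) (n 1) (r 0) (n 0) (\<Phi> 1)" using facts(1)[of 0] by simp
  show ?thesis
    using graded_quotient_hom_module(2)[of r n \<Phi>, OF A]
    by (intro homogenized_resolution graded_quotient_hom_module(1)[of r n \<Phi>, OF A] facts) (simp_all only: hom_image_eq)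
qed

text \<open>
  Relations of \<open>gr M\<^sup>(\<^sup>h\<^sup>)\<close>: if \<open>q v = 0\<close>, then the part of \<open>v\<close> of \<open>L\<close>-degree \<open>j\<close> is the leading part of
  an element of \<open>L\<^sub>j\<close> in the image of the first homogenized matrix \<open>\<psi>\<^sub>1\<close>. By strictness this element is
  \<open>\<psi>\<^sub>1 y\<close> with \<open>y\<close> in \<open>L\<^sub>j\<close>, and its leading part is the image of the leading part of \<open>y\<close> under the symbols of \<open>\<psi>\<^sub>1\<close>.
\<close>

lemma resolution_gr_hom_module:
  fixes M :: "('n::finite expo \<Rightarrow>\<^sub>0 'k::field_char_0, 'b, 'm) module_scheme"
  assumes res: "L_adapted_resolution M r n \<Phi> e"
  shows "graded_min_free_resolution (hom_weyl_at 0) (gr_hom_module r n \<Phi>) r n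
     (\<lambda>i. homogenize_matrix (n i) (n (i - 1)) (symbol_matrix (n i) (n (i - 1)) (\<Phi> i)))
     (\<lambda>a. filtered_presentation.q (hom_module r n \<Phi>) (r 0) (n 0) (hom_proj r n \<Phi>) (basis_vec a))"
proof -
  note facts = L_adapted_facts[OF res]
  have A: "filtered_matrix (r 1) (n 1) (r 0) (n 0) (\<Phi> 1)" using facts(1)[of 0] by simp
  interpret gq: graded_quotient "hom_weyl_at 1" hpart "\<lambda>P. poly (lk P 0) 0" "hom_module r n \<Phi>" "r 0" "n 0" "hom_proj r n \<Phi>"
    by (rule graded_quotient_hom_module) (rule A)
  interpret fp: filtered_presentation "monom 1 2" "hom_module r n \<Phi>" "r 0" "n 0" "hom_proj r n \<Phi>"
    by (rule filtered_presentation_hom_proj) (rule A)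
  interpret gr: graded_quotient "hom_weyl_at 0" hpart "\<lambda>P. poly (lk P 0) 0" "gr_hom_module r n \<Phi>" "r 0" "n 0" fp.q
    by (rule graded_quotient_gr_hom) (rule A)
  let ?p = "hom_proj r n \<Phi>"
  let ?P = "mat_map (hom_weyl_at 1) (r 1) (r 0) (homogenize_matrix (n 1) (n 0) (\<Phi> 1))"
  let ?S = "mat_map (hom_weyl_at 0) (r 1) (r 0) (homogenize_matrix (n 1) (n 0) (symbol_matrix (n 1) (n 0) (\<Phi> 1)))"
  have HA: "filtered_matrix (r 1) (n 1) (r 0) (n 0) (homogenize_matrix (n 1) (n 0) (\<Phi> 1))"
    using A by (simp add: filtered_matrix_def homogenize_matrix_def homogenize_L_le)
  have symbol_vec: "symbol_vec (n 0) j (?P y) = ?S (symbol_vec (n 1) j y)" if "y \<in> L_filt (r 1) (n 1) j" for y j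
    using symbol_vec_mat_map[OF HA that, of "monom 1 2"]
    by (simp only: mat_map_hom_weyl_at symbol_homogenize_matrix monom_eq_0)
  have P_ker: "?p v = ?p w \<longleftrightarrow> v - w \<in> ?P ` finvecs (r 1)" if "v \<in> finvecs (r 0)" "w \<in> finvecs (r 0)" for v w
    using gq.q_diff_eq_0[OF that] graded_quotient_hom_module(2)[of r n \<Phi> "v - w", OF A finvecs_closed(3)[OF that]]
    by (simp only: hom_image_eq)
  have zero: "\<zero>\<^bsub>gr_hom_module r n \<Phi>\<^esub> = (\<lambda>j. fp.F (j - 1))" by (simp only: gr.q_zero[symmetric] fp.q_0)
  have ker: "fp.q v = \<zero>\<^bsub>gr_hom_module r n \<Phi>\<^esub> \<longleftrightarrow> v \<in> ?S ` finvecs (r 1)" if v: "v \<in> finvecs (r 0)" for v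
  proof
    assume "fp.q v = \<zero>\<^bsub>gr_hom_module r n \<Phi>\<^esub>"
    then have F: "?p (symbol_vec (n 0) j v) \<in> fp.F (j - 1)" for j unfolding zero fp.q_eq_0_iff[OF v] by blast
    have "\<exists>y. y \<in> finvecs (r 1) \<and> ?S y = symbol_vec (n 0) j v" for j
    proof -
      from F[of j] obtain w where w: "w \<in> L_filt (r 0) (n 0) (j - 1)" "?p (symbol_vec (n 0) j v) = ?p w"
        unfolding fp.F_def by blast
      from w(2) obtain y where y: "y \<in> finvecs (r 1)" "symbol_vec (n 0) j v - w = ?P y"
        unfolding P_ker[OF fp.symbol_vec_finvecs[OF v] L_filt_finvecs[OF w(1)]] by blast
      have "?P y \<in> L_filt (r 0) (n 0) j"
        unfolding y(2)[symmetric] by (rule L_filt_diff[OF symbol_vec_L_filt[OF v] L_filt_mono[OF w(1)]]) simp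
      have "\<exists>y'\<in>L_filt (r 1) (n 1) j. ?P y' = ?P y"
      proof (rule strict_hom[OF A _ _ _ y(1)])
        show "filtered_matrix (r 2) (n 2) (r 1) (n 1) (\<Phi> 2)" using facts(1)[of 1] by (simp add: numeral_2_eq_2)
        show "\<exists>z. mat_map poly_S (r 2) (r 1) (symbol_matrix (n 2) (n 1) (\<Phi> 2)) z = w"
          if "w \<in> finvecs (r 1)" "mat_map poly_S (r 1) (r 0) (symbol_matrix (n 1) (n 0) (\<Phi> 1)) w = 0" for w
          using exact_lift[OF facts(3)[of 0]] that unfolding numeral_2_eq_2 One_nat_def by blast
        show "mat_map (weyl_at 1) (r 1) (r 0) (\<Phi> 1) (mat_map (weyl_at 1) (r 2) (r 1) (\<Phi> 2) z) = 0"
          if "z \<in> finvecs (r 2)" for z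
          using facts(2)[of 0] that by (auto simp: numeral_2_eq_2)
      qed fact
      then obtain y' where y': "y' \<in> L_filt (r 1) (n 1) j" "?P y' = ?P y" by blast
      have "?S (symbol_vec (n 1) j y') = symbol_vec (n 0) j (symbol_vec (n 0) j v - w)"
        by (simp only: symbol_vec[OF y'(1), symmetric] y'(2) y(2))
      also have "\<dots> = symbol_vec (n 0) j v"
        using symbol_vec_eq_0[OF w(1), of j] by (simp add: symbol_vec_diff symbol_vec_symbol_vec)
      finally show ?thesis using L_filt_finvecs[OF symbol_vec_L_filt[OF L_filt_finvecs[OF y'(1)]]] by blast
    qed
    then obtain y where y: "\<And>j. y j \<in> finvecs (r 1)" "\<And>j. ?S (y j) = symbol_vec (n 0) j v" by metis
    obtain D where D: "v = (\<Sum>d\<in>D. symbol_vec (n 0) d v)"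
      using vec_decomposition[of L_part v "r 0" "n 0", OF L_part_decomposition v] unfolding symbol_vec_def by auto
    have "?S (\<Sum>d\<in>D. y d) = v" using D by (simp only: hweyl.mat_map_sum y(2))
    then show "v \<in> ?S ` finvecs (r 1)" using finvecs_sum[of D y "r 1"] y(1) by blast
  next
    assume "v \<in> ?S ` finvecs (r 1)"
    then obtain y where y: "y \<in> finvecs (r 1)" "v = ?S y" by blast
    have "?p (symbol_vec (n 0) j v) \<in> fp.F (j - 1)" for j
    proof -
      let ?y = "symbol_vec (n 1) j y"
      have yL: "?y \<in> L_filt (r 1) (n 1) j" by (rule symbol_vec_L_filt[OF y(1)])
      have "symbol_vec (n 0) j (?P ?y) = ?S ?y" using symbol_vec[OF yL] by (simp add: symbol_vec_symbol_vec)
      also have "\<dots> = symbol_vec (n 0) j v"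
      proof
        fix b
        have "L_part (j - n 0 b) (y a * homogenize_matrix (n 1) (n 0) (symbol_matrix (n 1) (n 0) (\<Phi> 1)) a b)
          = L_part (j - n 1 a) (y a) * homogenize_matrix (n 1) (n 0) (symbol_matrix (n 1) (n 0) (\<Phi> 1)) a b" for a
          using L_part_mult[of "n 1 a - n 0 b" "homogenize_matrix (n 1) (n 0) (symbol_matrix (n 1) (n 0) (\<Phi> 1)) a b" "j - n 1 a" "y a"]
          by (simp add: symbol_homogenize_matrix[symmetric] symbol_matrix_def L_part_L_part)
        then show "?S ?y b = symbol_vec (n 0) j v b"
          by (simp add: y(2) symbol_vec_def hweyl.mat_map_apply mult_hom_weyl_at weyl_mult_0_t L_part_sum)
      qed
      finally have s: "symbol_vec (n 0) j (symbol_vec (n 0) j v - ?P ?y) = 0" by (simp add: symbol_vec_diff symbol_vec_symbol_vec)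
      have PL: "?P ?y \<in> L_filt (r 0) (n 0) j"
        unfolding mat_map_hom_weyl_at by (rule mat_map_L_filt[OF HA yL])
      have "symbol_vec (n 0) j v - ?P ?y \<in> L_filt (r 0) (n 0) (j - 1)"
        by (rule L_filt_pred[OF L_filt_diff[OF symbol_vec_L_filt[OF v] PL] s])
      moreover have "?p (symbol_vec (n 0) j v) = ?p (symbol_vec (n 0) j v - ?P ?y)"
        using P_ker[OF fp.symbol_vec_finvecs[OF v] finvecs_closed(3)[OF fp.symbol_vec_finvecs[OF v] hweyl.mat_map_finvecs]]
          L_filt_finvecs[OF yL] by simp
      ultimately show ?thesis unfolding fp.F_def by (simp only: imageI)
    qed
    then show "fp.q v = \<zero>\<^bsub>gr_hom_module r n \<Phi>\<^esub>" unfolding zero fp.q_eq_0_iff[OF v] by blast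
  qed
  show ?thesis
  proof (rule homogenized_resolution[where A = "\<lambda>i. symbol_matrix (n i) (n (i - 1)) (\<Phi> i)" and r = r and n = n and q = fp.q, OF gr.graded_quotient_axioms])
    fix i a b
    show "filtered_matrix (r (Suc i)) (n (Suc i)) (r i) (n i) (symbol_matrix (n (Suc i)) (n (Suc i - 1)) (\<Phi> (Suc i)))"
      by (simp add: filtered_symbol_matrix)
    show "symbol_matrix (n (Suc i)) (n (Suc i - 1)) (\<Phi> (Suc i)) a b = 0"
      if "a < r (Suc i)" "b < r i" "n (Suc i) a = n i b"
      using facts(4)[OF that] by (simp add: symbol_matrix_def)
  qed (use facts(3) ker in \<open>simp_all add: symbol_matrix_idem mat_map_poly_S\<close>)
qed

theorem proposition5p1:
  fixes M :: "('n::finite expo \<Rightarrow>\<^sub>0 'k::field_char_0, 'm) module"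
    and r :: "nat \<Rightarrow> nat"
    and n :: "nat \<Rightarrow> nat \<Rightarrow> int"
    and \<Phi> :: "nat \<Rightarrow> nat \<Rightarrow> nat \<Rightarrow> ('n expo \<Rightarrow>\<^sub>0 'k)"
    and e :: "nat \<Rightarrow> 'm"
  assumes "fin_gen_left_module weyl_algebra M"
    and "L_adapted_resolution M r n \<Phi> e"
  shows "graded_betti hom_weyl_algebra (hom_module r n \<Phi>) = graded_betti poly_S (gr_D M (r 0) (n 0) e)
    \<and> graded_betti poly_Sh (gr_hom_module r n \<Phi>) = graded_betti poly_S (gr_D M (r 0) (n 0) e)"
proof -
  have A: "filtered_matrix (r 1) (n 1) (r 0) (n 0) (\<Phi> 1)" using L_adapted_facts(1)[OF assms(2), of 0] by simp
  have "graded_betti poly_S (gr_D M (r 0) (n 0) e) i j = card {a. a < r i \<and> n i a = j}" for i j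
  proof -
    have "graded_quotient poly_S L_part (\<lambda>P. lk P 0) (gr_D M (r 0) (n 0) e) (r 0) (n 0)
        (filtered_presentation.q M (r 0) (n 0) (gen_map M (r 0) e))"
      by (rule graded_quotient_gr_D) (use assms in \<open>simp_all add: fin_gen_left_module_def
        L_adapted_resolution_def free_resolution_def\<close>)
    moreover have "graded_min_free_resolution poly_S (gr_D M (r 0) (n 0) e) r n (\<lambda>i. symbol_matrix (n i) (n (i - 1)) (\<Phi> i))
       (\<lambda>a. gr_class M (img_filt M (r 0) (n 0) e) (n 0 a) (e a))"
      using assms(2) by (simp only: L_adapted_resolution_def simp_thms)
    ultimately show ?thesis by (rule graded_quotient.graded_betti_eq)
  qed
  moreover have "graded_betti hom_weyl_algebra (hom_module r n \<Phi>) i j = card {a. a < r i \<and> n i a = j}" for i j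
    unfolding hom_weyl_algebra_eq
    by (rule graded_quotient.graded_betti_eq[OF graded_quotient_hom_module(1)[where \<Phi> = \<Phi>, OF A] resolution_hom_module[OF assms(2)]])
  moreover have "graded_betti poly_Sh (gr_hom_module r n \<Phi>) i j = card {a. a < r i \<and> n i a = j}" for i j
    unfolding poly_Sh_eq
    by (rule graded_quotient.graded_betti_eq[OF graded_quotient_gr_hom[where \<Phi> = \<Phi>, OF A] resolution_gr_hom_module[OF assms(2)]])
  ultimately show ?thesis by (simp add: fun_eq_iff)
qed

end
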